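(* Let $\exp(tQ)$ be a symmetric ergodic Markov semigroup on $\{1,\dots,n\}$, $n\ge2$ (i.e. $Q$ is a symmetric irreducible $Q$-matrix). Let $A$ be a Hermitian $n\times n$ matrix with $n$ distinct eigenvalues $\kappa_1,\dots,\kappa_n\in\mathbb{R}$ of order $\Theta(1)$ and orthonormal eigenbasis $\{|i\rangle\}_{i=1}^n$, and for $\gamma>0$ let $$\mathcal{L}_\gamma(X)=i[H,X]+\gamma\mathcal{L}_S(X),\qquad\mathcal{L}_S(X)=-[A,[A,X]],\qquad X\in\mathcal{B}(\mathbb{C}^n),$$ where $H=\sum_{i,j}h_{ij}|i\rangle\langle j|$ with $h_{ij}=\sqrt{Q_{ij}/2}$ for $i\ne j$ and $h_{ii}=0$. Then: (1) $\mathcal{L}_\gamma$ is primitive and hypocoercive, with the maximally mixed state $\frac{\mathbf 1}{n}$ as the unique invariant state. Moreover $\exp(t\mathcal{L}_\gamma)$ is a second-order lift of $\exp(tQ)$ (in the sense defined in the context). (2) At a particular $\gamma=\gamma_{\max}>0$, the $L^2$ convergence rate of $\exp(t\mathcal{L}_\gamma)$ satisfies $$\Omega\left(\frac{\sqrt{\lambda_Q}}{1+K_1+K_2\lambda_Q^{-1/2}}\right)\le\nu(\mathcal{L}_{\gamma_{\max}})\le\mathcal{O}(\sqrt{\lambda_Q}),$$ where $\lambda_Q$ is the spectral gap of $Q$, and $K_1,K_2>0$ are any constants such that $$\|[H,[H,Y]]\|_{2,\frac{\mathbf 1}{n}}\le K_1\|Qy\|_{\ell^2(\nu)}+K_2\sqrt{-\langle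 y,Qy\rangle_{\ell^2(\nu)}}$$ for all $Y=\sum_jy_j|j\rangle\langle j|$, $y\in\mathbb{C}^n$.
   Context: $\|X\|_{2,\frac{\mathbf 1}{n}}^2=\frac1n\mathrm{tr}(X^*X)$ on $\mathcal{B}(\mathbb{C}^n)$, with corresponding inner product. In the norms $\ell^2(\nu)$, $\nu$ is the uniform probability on $\{1,\dots,n\}$: $\langle x,y\rangle_{\ell^2(\nu)}=\frac1n\sum_i\bar x_iy_i$. The spectral gap $\lambda_Q$ is the smallest nonzero eigenvalue of $-Q$. A quantum Markov semigroup $\exp(t\mathcal{L})$ (completely positive, unital) is primitive if it has a unique invariant state and this state is full rank. With invariant state $\frac{\mathbf 1}{n}$, consider the estimate $\|e^{t\mathcal{L}}X\|_{2,\frac{\mathbf 1}{n}}\le Ce^{-\nu t}\|X\|_{2,\frac{\mathbf 1}{n}}$ for all $t\ge0$ and all $X$ with $\mathrm{tr}X=0$. The semigroup is hypocoercive if this holds for some $C>1,\nu>0$ but does not hold with $C=1$ for any $\nu>0$. The $L^2$ convergence rate $\nu(\mathcal{L})$ is the rate in this estimate with prefactor $C=\mathcal{O}(1)$ (supremum of rates over prefactors bounded by a constant of the allowed type). Lift: identify $\mathbb{C}^n$ (with $\langle\cdot,\cdot\rangle_{\ell^2(\nu)}$) with the subspace $\mathcal{H}_O=\{\sum_jx_j|j\rangle\langle j|\}$ of $\mathcal{H}=\mathcal{B}(\mathbb{C}^n)$. $\exp(t\mathcal{L}_\gamma)$ is a second-order lift of $\exp(tQ)$ if $\langle X,\mathcal{L}_\gamma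 Y\rangle_{\mathcal{H}}=0$ for all $X,Y\in\mathcal{H}_O$, and there is a positive bounded operator $\mathsf{S}$ on $\mathcal{H}_O^\perp$ with $\langle\mathcal{L}_\gamma X,\mathsf{S}\mathcal{L}_\gamma Y\rangle_{\mathcal{H}}=-\langle x,Qy\rangle_{\ell^2(\nu)}$ for all $X=\sum_jx_j|j\rangle\langle j|$, $Y=\sum_jy_j|j\rangle\langle j|$. Asymptotic notation: the spectrum of $\mathcal{L}_S$ is regarded as of order one; the constants implied in $\mathcal{O},\Omega$ (and the bound on the prefactor $C$) depend only on $\min_{i\ne j}|\kappa_i-\kappa_j|$ and $\max_{i,j}|\kappa_i-\kappa_j|$. *)

theory Defs
  imports
    "HOL-Analysis.Analysis"
    "Jordan_Normal_Form.Schur_Decomposition"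
    "Jordan_Normal_Form.DL_Rank"
begin

(* The dimension n is a variable (the implied constants of the theorem are uniform in n), so
   operators on C^n are matrices in carrier_mat n n and indices run over {..<n}. *)

definition mtrace :: "complex mat \<Rightarrow> complex" where
  "mtrace X = (\<Sum>i<dim_row X. X $$ (i, i))"

definition commutator :: "complex mat \<Rightarrow> complex mat \<Rightarrow> complex mat" where
  "commutator X Y = X * Y - Y * X"

definition hermitian_mat :: "complex mat \<Rightarrow> bool" where
  "hermitian_mat A \<longleftrightarrow> mat_adjoint A = A"

(* 0 \<le> z for complex z means that z is real and non-negative; M *\<^sub>v v \<bullet>c v is <v, M v>. *)
definition positive_mat :: "nat \<Rightarrow> complex mat \<Rightarrow> bool" where
  "positive_mat n M \<longleftrightarrow>
     M \<in> carrier_mat n n \<and> (\<forall>v \<in> carrier_vec n. 0 \<le> (M *\<^sub>v v) \<bullet>c v)"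

definition hs_inner :: "nat \<Rightarrow> complex mat \<Rightarrow> complex mat \<Rightarrow> complex" where
  "hs_inner n X Y = mtrace (mat_adjoint X * Y) / of_nat n"

definition hs_norm :: "nat \<Rightarrow> complex mat \<Rightarrow> real" where
  "hs_norm n X = sqrt (Re (hs_inner n X X))"

definition l2_inner :: "nat \<Rightarrow> complex vec \<Rightarrow> complex vec \<Rightarrow> complex" where
  "l2_inner n x y = (\<Sum>i<n. cnj (x $ i) * y $ i) / of_nat n"

definition l2_norm :: "nat \<Rightarrow> complex vec \<Rightarrow> real" where
  "l2_norm n x = sqrt (Re (l2_inner n x x))"

definition linear_superop :: "nat \<Rightarrow> (complex mat \<Rightarrow> complex mat) \<Rightarrow> bool" where
  "linear_superop n F \<longleftrightarrow>
     (\<forall>X \<in> carrier_mat n n. F X \<in> carrier_mat n n) \<and>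
     (\<forall>X \<in> carrier_mat n n. \<forall>Y \<in> carrier_mat n n. F (X + Y) = F X + F Y) \<and>
     (\<forall>a. \<forall>X \<in> carrier_mat n n. F (a \<cdot>\<^sub>m X) = a \<cdot>\<^sub>m F X)"

(* exp(t L) X as the entrywise sum of the exponential series *)
definition semigroup_exp ::
    "nat \<Rightarrow> (complex mat \<Rightarrow> complex mat) \<Rightarrow> real \<Rightarrow> complex mat \<Rightarrow> complex mat" where
  "semigroup_exp n L t X =
     mat n n (\<lambda>(i, j). \<Sum>k. complex_of_real (t ^ k / fact k) * ((L ^^ k) X) $$ (i, j))"

(* id \<otimes> F on (k * n) \<times> (k * n) matrices, seen as k \<times> k arrays of n \<times> n blocks *)
definition ampliation ::
    "nat \<Rightarrow> nat \<Rightarrow> (complex mat \<Rightarrow> complex mat) \<Rightarrow> complex mat \<Rightarrow> complex mat" where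
  "ampliation n k F M =
     mat (k * n) (k * n) (\<lambda>(r, s).
       F (mat n n (\<lambda>(i, j). M $$ ((r div n) * n + i, (s div n) * n + j))) $$ (r mod n, s mod n))"

definition completely_positive :: "nat \<Rightarrow> (complex mat \<Rightarrow> complex mat) \<Rightarrow> bool" where
  "completely_positive n F \<longleftrightarrow>
     linear_superop n F \<and>
     (\<forall>k M. positive_mat (k * n) M \<longrightarrow> positive_mat (k * n) (ampliation n k F M))"

definition quantum_Markov_generator :: "nat \<Rightarrow> (complex mat \<Rightarrow> complex mat) \<Rightarrow> bool" where
  "quantum_Markov_generator n L \<longleftrightarrow>
     linear_superop n L \<and>
     (\<forall>t\<ge>0. completely_positive n (semigroup_exp n L t) \<and>
             semigroup_exp n L t (1\<^sub>m n) = 1\<^sub>m n)"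

definition quantum_state :: "nat \<Rightarrow> complex mat \<Rightarrow> bool" where
  "quantum_state n \<rho> \<longleftrightarrow> positive_mat n \<rho> \<and> mtrace \<rho> = 1"

(* The semigroup acts on observables (Heisenberg picture), so invariance of a state is
   invariance of its expectation values. *)
definition invariant_state ::
    "nat \<Rightarrow> (complex mat \<Rightarrow> complex mat) \<Rightarrow> complex mat \<Rightarrow> bool" where
  "invariant_state n L \<rho> \<longleftrightarrow>
     quantum_state n \<rho> \<and>
     (\<forall>t\<ge>0. \<forall>X \<in> carrier_mat n n. mtrace (\<rho> * semigroup_exp n L t X) = mtrace (\<rho> * X))"

definition primitive :: "nat \<Rightarrow> (complex mat \<Rightarrow> complex mat) \<Rightarrow> bool" where
  "primitive n L \<longleftrightarrow>
     quantum_Markov_generator n L \<and>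
     (\<exists>\<rho>. (\<forall>\<sigma>. invariant_state n L \<sigma> \<longleftrightarrow> \<sigma> = \<rho>) \<and> vec_space.rank n \<rho> = n)"

definition maximally_mixed :: "nat \<Rightarrow> complex mat" where
  "maximally_mixed n = (1 / of_nat n) \<cdot>\<^sub>m 1\<^sub>m n"

definition decay_estimate ::
    "nat \<Rightarrow> (complex mat \<Rightarrow> complex mat) \<Rightarrow> real \<Rightarrow> real \<Rightarrow> bool" where
  "decay_estimate n L C \<nu> \<longleftrightarrow>
     (\<forall>t\<ge>0. \<forall>X \<in> carrier_mat n n. mtrace X = 0 \<longrightarrow>
        hs_norm n (semigroup_exp n L t X) \<le> C * exp (- \<nu> * t) * hs_norm n X)"

definition hypocoercive :: "nat \<Rightarrow> (complex mat \<Rightarrow> complex mat) \<Rightarrow> bool" where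
  "hypocoercive n L \<longleftrightarrow>
     (\<exists>C>1. \<exists>\<nu>>0. decay_estimate n L C \<nu>) \<and> \<not> (\<exists>\<nu>>0. decay_estimate n L 1 \<nu>)"

(* The condition "prefactor C = O(1)" is rendered by an explicit bound C on the prefactors. The
   rate 0 is admitted so that the set is nonempty for contractive semigroups and C \<ge> 1. *)
definition L2_rate :: "nat \<Rightarrow> (complex mat \<Rightarrow> complex mat) \<Rightarrow> real \<Rightarrow> real" where
  "L2_rate n L C = Sup {\<nu>. 0 \<le> \<nu> \<and> (\<exists>C'\<le>C. decay_estimate n L C' \<nu>)}"

definition Q_matrix :: "nat \<Rightarrow> real mat \<Rightarrow> bool" where
  "Q_matrix n Q \<longleftrightarrow>
     Q \<in> carrier_mat n n \<and>
     (\<forall>i<n. \<forall>j<n. i \<noteq> j \<longrightarrow> 0 \<le> Q $$ (i, j)) \<and>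
     (\<forall>i<n. (\<Sum>j<n. Q $$ (i, j)) = 0)"

definition irreducible_Q :: "nat \<Rightarrow> real mat \<Rightarrow> bool" where
  "irreducible_Q n Q \<longleftrightarrow>
     (\<forall>i<n. \<forall>j<n. (i, j) \<in> {(a, b). a < n \<and> b < n \<and> a \<noteq> b \<and> 0 < Q $$ (a, b)}\<^sup>*)"

definition spectral_gap :: "real mat \<Rightarrow> real" where
  "spectral_gap Q = Min {\<mu>. eigenvalue (- Q) \<mu> \<and> \<mu> \<noteq> 0}"

definition apply_Q :: "real mat \<Rightarrow> complex vec \<Rightarrow> complex vec" where
  "apply_Q Q y = map_mat complex_of_real Q *\<^sub>v y"

definition orthonormal_eigenbasis ::
    "nat \<Rightarrow> complex mat \<Rightarrow> (nat \<Rightarrow> real) \<Rightarrow> (nat \<Rightarrow> complex vec) \<Rightarrow> bool" where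
  "orthonormal_eigenbasis n A \<kappa> u \<longleftrightarrow>
     (\<forall>i<n. u i \<in> carrier_vec n) \<and>
     (\<forall>i<n. \<forall>j<n. u i \<bullet>c u j = (if i = j then 1 else 0)) \<and>
     (\<forall>i<n. A *\<^sub>v u i = complex_of_real (\<kappa> i) \<cdot>\<^sub>v u i)"

(* the operator \<Sum>_{i,j} c_{ij} |i><j| with |i> = u i *)
definition basis_op ::
    "nat \<Rightarrow> (nat \<Rightarrow> complex vec) \<Rightarrow> (nat \<Rightarrow> nat \<Rightarrow> complex) \<Rightarrow> complex mat" where
  "basis_op n u c =
     mat n n (\<lambda>(a, b). \<Sum>i<n. \<Sum>j<n. c i j * (u i $ a * cnj (u j $ b)))"

definition diag_op :: "nat \<Rightarrow> (nat \<Rightarrow> complex vec) \<Rightarrow> complex vec \<Rightarrow> complex mat" where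
  "diag_op n u x = basis_op n u (\<lambda>i j. if i = j then x $ j else 0)"

definition Hamiltonian :: "nat \<Rightarrow> (nat \<Rightarrow> complex vec) \<Rightarrow> real mat \<Rightarrow> complex mat" where
  "Hamiltonian n u Q =
     basis_op n u (\<lambda>i j. if i = j then 0 else complex_of_real (sqrt (Q $$ (i, j) / 2)))"

definition dephasing :: "complex mat \<Rightarrow> complex mat \<Rightarrow> complex mat" where
  "dephasing A X = - commutator A (commutator A X)"

definition Lindbladian ::
    "complex mat \<Rightarrow> complex mat \<Rightarrow> real \<Rightarrow> complex mat \<Rightarrow> complex mat" where
  "Lindbladian H A \<gamma> X = \<i> \<cdot>\<^sub>m commutator H X + complex_of_real \<gamma> \<cdot>\<^sub>m dephasing A X"

definition min_gap :: "nat \<Rightarrow> (nat \<Rightarrow> real) \<Rightarrow> real" where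
  "min_gap n \<kappa> = Min {\<bar>\<kappa> i - \<kappa> j\<bar> | i j. i < n \<and> j < n \<and> i \<noteq> j}"

definition max_gap :: "nat \<Rightarrow> (nat \<Rightarrow> real) \<Rightarrow> real" where
  "max_gap n \<kappa> = Max {\<bar>\<kappa> i - \<kappa> j\<bar> | i j. i < n \<and> j < n}"

definition standing_assumptions ::
    "nat \<Rightarrow> real mat \<Rightarrow> complex mat \<Rightarrow> (nat \<Rightarrow> real) \<Rightarrow> (nat \<Rightarrow> complex vec) \<Rightarrow> bool" where
  "standing_assumptions n Q A \<kappa> u \<longleftrightarrow>
     2 \<le> n \<and> Q_matrix n Q \<and> transpose_mat Q = Q \<and> irreducible_Q n Q \<and>
     A \<in> carrier_mat n n \<and> hermitian_mat A \<and>
     inj_on \<kappa> {..<n} \<and> orthonormal_eigenbasis n A \<kappa> u"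

definition H_O :: "nat \<Rightarrow> (nat \<Rightarrow> complex vec) \<Rightarrow> complex mat set" where
  "H_O n u = diag_op n u ` carrier_vec n"

definition H_O_perp :: "nat \<Rightarrow> (nat \<Rightarrow> complex vec) \<Rightarrow> complex mat set" where
  "H_O_perp n u = {X \<in> carrier_mat n n. \<forall>Y \<in> H_O n u. hs_inner n Y X = 0}"

definition positive_bounded_op_on ::
    "nat \<Rightarrow> complex mat set \<Rightarrow> (complex mat \<Rightarrow> complex mat) \<Rightarrow> bool" where
  "positive_bounded_op_on n V S \<longleftrightarrow>
     (\<forall>X \<in> V. S X \<in> V) \<and>
     (\<forall>X \<in> V. \<forall>Y \<in> V. S (X + Y) = S X + S Y) \<and>
     (\<forall>a. \<forall>X \<in> V. S (a \<cdot>\<^sub>m X) = a \<cdot>\<^sub>m S X) \<and>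
     (\<forall>X \<in> V. 0 \<le> hs_inner n X (S X)) \<and>
     (\<exists>B. \<forall>X \<in> V. hs_norm n (S X) \<le> B * hs_norm n X)"

(* The first conjunct says that L maps H_O into its orthogonal complement, so S is applied
   within its domain in the second. *)
definition second_order_lift ::
    "nat \<Rightarrow> (nat \<Rightarrow> complex vec) \<Rightarrow> (complex mat \<Rightarrow> complex mat) \<Rightarrow> real mat \<Rightarrow> bool" where
  "second_order_lift n u L Q \<longleftrightarrow>
     (\<forall>X \<in> H_O n u. \<forall>Y \<in> H_O n u. hs_inner n X (L Y) = 0) \<and>
     (\<exists>S. positive_bounded_op_on n (H_O_perp n u) S \<and>
        (\<forall>x \<in> carrier_vec n. \<forall>y \<in> carrier_vec n.
           hs_inner n (L (diag_op n u x)) (S (L (diag_op n u y))) = - l2_inner n x (apply_Q Q y)))"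

(* < y, Q y > is real for symmetric Q, hence the real part. *)
definition double_commutator_bound ::
    "nat \<Rightarrow> (nat \<Rightarrow> complex vec) \<Rightarrow> real mat \<Rightarrow> real \<Rightarrow> real \<Rightarrow> bool" where
  "double_commutator_bound n u Q K\<^sub>1 K\<^sub>2 \<longleftrightarrow>
     (\<forall>y \<in> carrier_vec n.
        hs_norm n (commutator (Hamiltonian n u Q)
          (commutator (Hamiltonian n u Q) (diag_op n u y)))
        \<le> K\<^sub>1 * l2_norm n (apply_Q Q y) + K\<^sub>2 * sqrt (- Re (l2_inner n y (apply_Q Q y))))"

end

theory Submission
  imports Defs "HOL-Real_Asymp.Real_Asymp"
begin

text \<open>
  In the eigenbasis of \<open>A\<close> an observable becomes an array \<open>z\<close>. The dissipator multiplies the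
  entry \<open>z i j\<close> by \<open>- (\<kappa> i - \<kappa> j)\<^sup>2\<close>: it kills the diagonal arrays and damps the off-diagonal
  ones at a rate between \<open>\<delta>\<^sup>2\<close> and \<open>\<Delta>\<^sup>2\<close>. The Hamiltonian part \<open>T = i[H, -]\<close> is antisymmetric
  and maps diagonal arrays to arrays with zero diagonal, and the choice of the matrix elements
  of \<open>H\<close> makes \<open>T\<^sup>* T\<close> on the diagonal equal to \<open>D = - Q\<close> (\<open>hsp_T_diag\<close>). This is the
  second-order lift, with the identity as the positive operator. It also shows why no decay
  with prefactor one is possible: on a diagonal array the norm has derivative zero.

  Decay comes from a modified energy in the style of Dolbeault, Mouhot and Schmeiser. Write
  \<open>p\<close> and \<open>q\<close> for the diagonal and off-diagonal parts of \<open>z\<close> and take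
  \<open>|z|\<^sup>2 / 2 - \<epsilon> \<langle>z, T D\<^sup>-\<^sup>1 p\<rangle>\<close>. Along the flow the second term produces \<open>- \<epsilon> |p|\<^sup>2\<close>, which is
  the missing dissipation on the diagonal, and error terms that are controlled by \<open>|q|\<^sup>2\<close>, by
  \<open>\<gamma> \<Delta>\<^sup>2 |p| |q| / \<surd>\<lambda>\<close> and by the double commutator, \<open>K |p| |q|\<close>. The inverse of \<open>D\<close> itself,
  which is bounded on mean-zero vectors by the Poincare inequality, is what makes the error
  terms scale correctly in the spectral gap \<open>\<lambda>\<close>. With \<open>\<gamma> = \<surd>\<lambda> (1 + K)\<close> one may take
  \<open>\<epsilon>\<close> of order \<open>\<surd>\<lambda> / (1 + K)\<close> (\<open>coordinate_decay\<close>, \<open>optimal_decay\<close>). Here \<open>K\<close> is the best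
  constant in \<open>|T T Y| \<le> K |Q y|\<close> for mean-zero \<open>y\<close> with diagonal array \<open>Y\<close>; it depends on neither \<open>K\<^sub>1\<close> nor \<open>K\<^sub>2\<close>, and it is at most
  \<open>K\<^sub>1 + K\<^sub>2 / \<surd>\<lambda>\<close>, so a single \<open>\<gamma>\<close> serves all admissible pairs.

  The upper bound holds for every \<open>\<gamma>\<close> (\<open>decay_rate_upper\<close>). If \<open>X\<close> is the diagonal array of a
  normalised eigenvector for \<open>\<lambda>\<close>, then \<open>\<langle>X, z t\<rangle>\<close> starts at one and decreases with slope at
  most \<open>|T X| = \<surd>\<lambda>\<close>; hence the norm is still at least a half at time \<open>1 / (2 \<surd>\<lambda>)\<close>, which
  bounds the rate by \<open>2 \<surd>\<lambda> ln (2 C)\<close>.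

  Complete positivity of the semigroup is obtained from an Euler product. With
  \<open>J = - i H - \<gamma> A\<^sup>2\<close> one has \<open>L X = J\<^sup>* X + X J + 2 \<gamma> A X A\<close>, so that
  \<open>(1 + s J)\<^sup>* X (1 + s J) + 2 \<gamma> s A X A\<close> is visibly completely positive and agrees with
  \<open>X + s L X\<close> up to order \<open>s\<^sup>2\<close>; its \<open>N\<close>-th power at \<open>s = t / N\<close> converges to \<open>exp (t L)\<close>
  (\<open>exp_completely_positive\<close>). Uniqueness of the invariant state follows from decay: an
  invariant state annihilates every traceless observable.
\<close>

section \<open>Symmetric Markov chains and their spectral gap\<close>

locale symmetric_chain =
  fixes n :: nat and q :: "nat \<Rightarrow> nat \<Rightarrow> real"
  assumes two_states: "2 \<le> n"
    and sym: "\<lbrakk>i < n; j < n\<rbrakk> \<Longrightarrow> q i j = q j i"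
    and rate_nonneg: "\<lbrakk>i < n; j < n; i \<noteq> j\<rbrakk> \<Longrightarrow> 0 \<le> q i j"
    and row_sum: "i < n \<Longrightarrow> (\<Sum>j<n. q i j) = 0"
    and irreducible: "\<lbrakk>i < n; j < n\<rbrakk> \<Longrightarrow> (i, j) \<in> {(a, b). a < n \<and> b < n \<and> a \<noteq> b \<and> 0 < q a b}\<^sup>*"
begin

text \<open>
  The operator \<open>- Q\<close>. It acts on real observables, where the spectral gap is found, and on
  complex ones, which form the diagonal of an array.
\<close>
definition D :: "(nat \<Rightarrow> 'a::real_vector) \<Rightarrow> nat \<Rightarrow> 'a" where
  "D y i = - (\<Sum>j<n. q i j *\<^sub>R y j)"

lemma D_add: "D (\<lambda>i. x i + y i) i = D x i + D y i"
  by (simp add: D_def scaleR_add_right sum.distrib)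

lemma D_scaleR: "D (\<lambda>i. c *\<^sub>R y i) i = c *\<^sub>R D y i"
  by (simp add: D_def scaleR_sum_right mult.commute)

lemma sum_D: "(\<Sum>i<n. D y i) = 0"
proof -
  have "(\<Sum>i<n. D y i) = - (\<Sum>j<n. \<Sum>i<n. q i j *\<^sub>R y j)"
    unfolding D_def sum_negf by (subst sum.swap) simp
  also have "(\<Sum>j<n. \<Sum>i<n. q i j *\<^sub>R y j) = (\<Sum>j<n. (\<Sum>i<n. q j i) *\<^sub>R y j)"
    unfolding scaleR_sum_left by (intro sum.cong refl) (auto simp: sym)
  also have "\<dots> = 0"
    by (intro sum.neutral) (auto simp: row_sum)
  finally show ?thesis by simp
qed

text \<open>
  Summation by parts: in the expanded right-hand side the two diagonal terms vanish because
  rows and columns of \<open>q\<close> sum to zero, and symmetry of \<open>q\<close> makes the two cross terms equal.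
\<close>
lemma dirichlet_form:
  fixes y z :: "nat \<Rightarrow> 'a::real_inner"
  shows "(\<Sum>i<n. inner (y i) (D z i)) = (\<Sum>i<n. \<Sum>j<n. q i j * inner (y i - y j) (z i - z j)) / 2"
proof -
  have a: "(\<Sum>i<n. \<Sum>j<n. q i j * inner (y i) (z i)) = 0"
    by (simp flip: sum_distrib_right add: row_sum)
  have b: "(\<Sum>i<n. \<Sum>j<n. q i j * inner (y j) (z j)) = 0"
    by (subst sum.swap) (use a in \<open>simp add: sym\<close>)
  have c: "(\<Sum>i<n. \<Sum>j<n. q i j * inner (y i) (z j)) = - (\<Sum>i<n. inner (y i) (D z i))"
    by (simp add: D_def inner_sum_right sum_negf)
  have d: "(\<Sum>i<n. \<Sum>j<n. q i j * inner (y j) (z i)) = - (\<Sum>i<n. inner (y i) (D z i))"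
    by (subst sum.swap) (use c in \<open>simp add: sym\<close>)
  have "(\<Sum>i<n. \<Sum>j<n. q i j * inner (y i - y j) (z i - z j))
    = (\<Sum>i<n. \<Sum>j<n. q i j * inner (y i) (z i)) + (\<Sum>i<n. \<Sum>j<n. q i j * inner (y j) (z j))
      - (\<Sum>i<n. \<Sum>j<n. q i j * inner (y i) (z j)) - (\<Sum>i<n. \<Sum>j<n. q i j * inner (y j) (z i))"
    by (simp add: inner_diff_left inner_diff_right algebra_simps sum.distrib sum_subtractf)
  with a b c d show ?thesis by simp
qed

lemma D_selfadjoint:
  fixes y z :: "nat \<Rightarrow> 'a::real_inner"
  shows "(\<Sum>i<n. inner (D y i) (z i)) = (\<Sum>i<n. inner (y i) (D z i))"
proof -
  have "(\<Sum>i<n. inner (D y i) (z i)) = (\<Sum>i<n. inner (z i) (D y i))"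
    by (simp add: inner_commute)
  also have "\<dots> = (\<Sum>i<n. inner (y i) (D z i))"
    unfolding dirichlet_form by (simp add: inner_commute)
  finally show ?thesis .
qed

lemma dirichlet_term_nonneg:
  fixes y :: "nat \<Rightarrow> 'a::real_inner"
  shows "i < n \<Longrightarrow> j < n \<Longrightarrow> 0 \<le> q i j * inner (y i - y j) (y i - y j)"
  by (cases "i = j") (auto intro: mult_nonneg_nonneg rate_nonneg)

lemma dirichlet_nonneg:
  fixes y :: "nat \<Rightarrow> 'a::real_inner"
  shows "0 \<le> (\<Sum>i<n. inner (y i) (D y i))"
  unfolding dirichlet_form by (auto intro!: sum_nonneg dirichlet_term_nonneg)

text \<open>
  The Dirichlet form is a sum of nonnegative terms, so \<open>y\<close> agrees along every transition of
  positive rate, and irreducibility joins any two states by such transitions.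
\<close>
lemma dirichlet_zero_const:
  fixes y :: "nat \<Rightarrow> 'a::real_inner"
  assumes "(\<Sum>i<n. inner (y i) (D y i)) = 0" and "i < n" and "j < n"
  shows "y i = y j"
proof -
  have *: "y a = y b" if "a < n" "b < n" "0 < q a b" for a b
  proof -
    have z: "(\<Sum>i<n. \<Sum>j<n. q i j * inner (y i - y j) (y i - y j)) = 0"
      using assms(1) unfolding dirichlet_form by simp
    have "(\<Sum>j<n. q a j * inner (y a - y j) (y a - y j)) = 0"
      using sum_nonneg_0[OF _ _ z, of a] that by (force intro!: sum_nonneg dirichlet_term_nonneg)
    then have "q a b * inner (y a - y b) (y a - y b) = 0"
      using sum_nonneg_0[where i = b and s = "{..<n}" and f = "\<lambda>j. q a j * inner (y a - y j) (y a - y j)"]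
        that dirichlet_term_nonneg[of a _ y] by auto
    with that show ?thesis by simp
  qed
  show ?thesis
    using irreducible[OF assms(2,3)] by (induction rule: rtrancl_induct) (auto dest: *)
qed

text \<open>
  The mean-zero unit sphere is compact. Real vectors of variable length \<open>n\<close> are functions on
  \<open>nat\<close> that vanish from \<open>n\<close> on, and the sphere is a closed subset of a product of compact
  intervals.
\<close>
lemma rayleigh_minimizer:
  "\<exists>v :: nat \<Rightarrow> real. (\<Sum>i<n. v i) = 0 \<and> (\<Sum>i<n. (v i)\<^sup>2) = 1 \<and>
     (\<forall>y. (\<Sum>i<n. y i) = 0 \<longrightarrow>
        (\<Sum>i<n. v i * D v i) * (\<Sum>i<n. (y i)\<^sup>2) \<le> (\<Sum>i<n. y i * D y i))"
proof -
  define P :: "(nat \<Rightarrow> real) set" where "P = PiE UNIV (\<lambda>i. if i < n then {-1..1} else {0})"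
  define K where "K = P \<inter> {y. (\<Sum>i<n. y i) = 0} \<inter> {y. (\<Sum>i<n. (y i)\<^sup>2) = 1}"
  have coord: "continuous_on S (\<lambda>y :: nat \<Rightarrow> real. y i)" for i and S :: "(nat \<Rightarrow> real) set"
    by (rule continuous_on_subset[OF continuous_on_product_coordinates subset_UNIV])
  have "compactin (product_topology (\<lambda>_::nat. euclidean :: real topology) UNIV) P"
    unfolding P_def by (subst compactin_PiE) (auto simp: compactin_euclidean_iff)
  then have "compact P"
    by (simp add: euclidean_product_topology flip: compactin_euclidean_iff)
  moreover have "closed {y :: nat \<Rightarrow> real. (\<Sum>i<n. y i) = 0}" "closed {y :: nat \<Rightarrow> real. (\<Sum>i<n. (y i)\<^sup>2) = 1}"
    by (intro closed_Collect_eq continuous_on_sum continuous_on_power continuous_on_const coord)+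
  ultimately have "compact K" unfolding K_def by (intro compact_Int_closed)
  moreover have "K \<noteq> {}"
  proof -
    define m where "m = n - 2"
    have n: "n = Suc (Suc m)" using two_states by (simp add: m_def)
    \<comment> \<open>The vector with entries \<open>1 / sqrt 2\<close> and \<open>- 1 / sqrt 2\<close> shows that the sphere is nonempty.\<close>
    define e where "e i = (if i = 0 then 1 / sqrt 2 else if i = 1 then - (1 / sqrt 2) else 0)" for i :: nat
    have "\<bar>e i\<bar> \<le> 1" for i by (simp add: e_def real_le_rsqrt)
    then have "e i \<in> {-1..1}" for i unfolding atLeastAtMost_iff by (meson abs_le_iff minus_le_iff)
    moreover have "(\<Sum>i<n. e i) = 0" "(\<Sum>i<n. (e i)\<^sup>2) = 1"
      unfolding n sum.lessThan_Suc_shift by (simp_all add: e_def power_divide)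
    moreover have "e i = 0" if "\<not> i < n" for i using that n by (simp add: e_def)
    ultimately have "e \<in> K" unfolding K_def P_def PiE_UNIV_domain by simp
    then show ?thesis by blast
  qed
  moreover have "continuous_on K (\<lambda>v. \<Sum>i<n. v i * D v i)"
    unfolding D_def real_scaleR_def
    by (intro continuous_on_sum continuous_on_mult continuous_on_minus continuous_on_const coord)
  ultimately obtain v where v: "v \<in> K" and min: "\<And>y. y \<in> K \<Longrightarrow> (\<Sum>i<n. v i * D v i) \<le> (\<Sum>i<n. y i * D y i)"
    using continuous_attains_inf[of K "\<lambda>v. \<Sum>i<n. v i * D v i"] by blast
  have "(\<Sum>i<n. v i * D v i) * (\<Sum>i<n. (y i)\<^sup>2) \<le> (\<Sum>i<n. y i * D y i)" if y: "(\<Sum>i<n. y i) = 0" for y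
  proof (cases "(\<Sum>i<n. (y i)\<^sup>2) = 0")
    case True
    then have "\<forall>i\<in>{..<n}. y i = 0"
      by (subst (asm) sum_nonneg_eq_0_iff) auto
    then show ?thesis using True by simp
  next
    case False
    define s where "s = (\<Sum>i<n. (y i)\<^sup>2)"
    have s: "s > 0" using False sum_nonneg[of "{..<n}" "\<lambda>i. (y i)\<^sup>2"] unfolding s_def by force
    define w where "w i = (if i < n then y i / sqrt s else 0)" for i
    have sw: "(\<Sum>i<n. (w i)\<^sup>2) = 1"
      using s by (simp add: w_def power_divide s_def flip: sum_divide_distrib)
    have "w \<in> K"
    proof -
      have "\<bar>w i\<bar> \<le> 1" if "i < n" for i
      proof -
        have "(w i)\<^sup>2 \<le> (\<Sum>i<n. (w i)\<^sup>2)" by (rule member_le_sum) (use that in auto)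
        then show ?thesis using sw abs_square_le_1[of "w i"] by linarith
      qed
      moreover have "(\<Sum>i<n. w i) = 0"
        using y by (simp add: w_def flip: sum_divide_distrib)
      moreover have "w i = 0" if "\<not> i < n" for i using that by (simp add: w_def)
      ultimately show ?thesis using sw unfolding K_def P_def PiE_UNIV_domain
        by (simp add: abs_le_iff minus_le_iff)
    qed
    from min[OF this] have "(\<Sum>i<n. v i * D v i) \<le> (\<Sum>i<n. w i * D w i)" .
    also have "(\<Sum>i<n. w i * D w i) = (\<Sum>i<n. y i * D y i) / s"
    proof -
      have "D w i = D y i / sqrt s" for i
        using s by (simp add: D_def w_def sum_divide_distrib)
      then show ?thesis using s by (simp add: w_def sum_divide_distrib)
    qed
    finally show ?thesis using s by (simp add: s_def[symmetric] field_simps)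
  qed
  with v show ?thesis unfolding K_def by blast
qed

text \<open>
  The first variation at the minimiser \<open>v\<close>: perturbing \<open>v\<close> in the direction of its own
  residual \<open>w = D v - \<mu> v\<close>, which has mean zero, changes the excess of the Rayleigh quotient
  to \<open>2 t |w|\<^sup>2 + O(t\<^sup>2)\<close>. As this stays nonnegative for both signs of \<open>t\<close>, the residual
  vanishes. The minimum is positive because a null vector of the Dirichlet form is constant,
  hence zero if it has mean zero.
\<close>
lemma gap_exists:
  "\<exists>\<mu> > 0. (\<exists>v :: nat \<Rightarrow> real. (\<Sum>i<n. v i) = 0 \<and> (\<Sum>i<n. (v i)\<^sup>2) = 1 \<and> (\<forall>i<n. D v i = \<mu> * v i)) \<and>
     (\<forall>y :: nat \<Rightarrow> real. (\<Sum>i<n. y i) = 0 \<longrightarrow> \<mu> * (\<Sum>i<n. (y i)\<^sup>2) \<le> (\<Sum>i<n. y i * D y i))"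
proof -
  obtain v :: "nat \<Rightarrow> real" where v0: "(\<Sum>i<n. v i) = 0" and v1: "(\<Sum>i<n. (v i)\<^sup>2) = 1"
    and min': "\<And>y. (\<Sum>i<n. y i) = 0 \<Longrightarrow> (\<Sum>i<n. v i * D v i) * (\<Sum>i<n. (y i)\<^sup>2) \<le> (\<Sum>i<n. y i * D y i)"
    using rayleigh_minimizer by blast
  define \<mu> where "\<mu> = (\<Sum>i<n. v i * D v i)"
  note min = min'[folded \<mu>_def]
  have "\<mu> \<ge> 0" unfolding \<mu>_def using dirichlet_nonneg[of v] by (simp add: inner_real_def)
  moreover have "\<mu> \<noteq> 0"
  proof
    assume "\<mu> = 0"
    then have c: "v i = v 0" if "i < n" for i
      using dirichlet_zero_const[of v i 0] that two_states unfolding \<mu>_def by (simp add: inner_real_def)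
    have "(\<Sum>i<n. v i) = (\<Sum>i<n. v 0)" by (rule sum.cong[OF refl], rule c) simp
    then have "v 0 = 0" using v0 two_states by simp
    with c have "\<forall>i<n. v i = 0" by metis
    then have "(\<Sum>i<n. (v i)\<^sup>2) = 0" by simp
    with v1 show False by simp
  qed
  ultimately have "\<mu> > 0" by simp
  define w where "w i = D v i - \<mu> * v i" for i
  define b where "b = (\<Sum>i<n. (w i)\<^sup>2)"
  define c where "c = (\<Sum>i<n. w i * D w i) - \<mu> * (\<Sum>i<n. (w i)\<^sup>2)"
  have w0: "(\<Sum>i<n. w i) = 0"
    using sum_D[of v] v0 by (simp add: w_def sum_subtractf flip: sum_distrib_left)
  have "c \<ge> 0" using min[OF w0] by (simp add: c_def)
  have quad: "0 \<le> 2 * t * b + t\<^sup>2 * c" for t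
  proof -
    have "(\<Sum>i<n. v i + t * w i) = 0" using v0 w0 by (simp add: sum.distrib flip: sum_distrib_left)
    from min[OF this]
    have "\<mu> * (\<Sum>i<n. (v i + t * w i)\<^sup>2) \<le> (\<Sum>i<n. (v i + t * w i) * (D v i + t * D w i))"
      using D_add[of v "\<lambda>i. t * w i"] D_scaleR[of t w] by simp
    also have "\<dots> = \<mu> + t * (\<Sum>i<n. v i * D w i) + t * (\<Sum>i<n. w i * D v i) + t\<^sup>2 * (\<Sum>i<n. w i * D w i)"
      unfolding \<mu>_def sum_distrib_left sum.distrib[symmetric]
      by (intro sum.cong refl) (simp add: algebra_simps power2_eq_square)
    also have "(\<Sum>i<n. v i * D w i) = (\<Sum>i<n. w i * D v i)"
      using D_selfadjoint[of v w] by (simp add: inner_real_def mult.commute)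
    also have "(\<Sum>i<n. (v i + t * w i)\<^sup>2) = (\<Sum>i<n. (v i)\<^sup>2) + 2 * t * (\<Sum>i<n. w i * v i) + t\<^sup>2 * (\<Sum>i<n. (w i)\<^sup>2)"
      unfolding sum_distrib_left sum.distrib[symmetric]
      by (intro sum.cong refl) (simp add: algebra_simps power2_eq_square)
    finally have "0 \<le> 2 * t * ((\<Sum>i<n. w i * D v i) - \<mu> * (\<Sum>i<n. w i * v i)) + t\<^sup>2 * c"
      using v1 by (simp add: c_def algebra_simps)
    also have "(\<Sum>i<n. w i * D v i) - \<mu> * (\<Sum>i<n. w i * v i) = b"
      unfolding b_def sum_distrib_left sum_subtractf[symmetric]
      by (intro sum.cong refl) (simp add: w_def algebra_simps power2_eq_square)
    finally show ?thesis .
  qed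
  have "b = 0"
  proof (rule ccontr)
    assume "b \<noteq> 0"
    \<comment> \<open>The minimiser of the quadratic is \<open>t = - b / c\<close>; dividing by \<open>c + 1\<close> covers the case
      \<open>c = 0\<close>.\<close>
    have "2 * (- b / (c + 1)) * b + (- b / (c + 1))\<^sup>2 * c = - (b\<^sup>2 * (c + 2) / (c + 1)\<^sup>2)"
      using \<open>c \<ge> 0\<close> by (simp add: divide_simps power2_eq_square) (simp add: algebra_simps)
    moreover have "b\<^sup>2 * (c + 2) / (c + 1)\<^sup>2 > 0" using \<open>b \<noteq> 0\<close> \<open>c \<ge> 0\<close> by simp
    ultimately show False using quad[of "- b / (c + 1)"] by linarith
  qed
  then have "\<forall>i<n. D v i = \<mu> * v i"
    unfolding b_def by (subst (asm) sum_nonneg_eq_0_iff) (auto simp: w_def)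
  with \<open>\<mu> > 0\<close> v0 v1 min show ?thesis by blast
qed

text \<open>
  The least nonzero eigenvalue of \<open>- Q\<close>, see \<open>spectral_gap_eq\<close>. It is characterised here by
  having a mean-zero eigenvector and satisfying the Poincare inequality, the two properties
  that the estimates rest on.
\<close>
definition gap :: real where
  "gap = (SOME \<mu>. \<mu> > 0 \<and>
     (\<exists>v :: nat \<Rightarrow> real. (\<Sum>i<n. v i) = 0 \<and> (\<Sum>i<n. (v i)\<^sup>2) = 1 \<and> (\<forall>i<n. D v i = \<mu> * v i)) \<and>
     (\<forall>y :: nat \<Rightarrow> real. (\<Sum>i<n. y i) = 0 \<longrightarrow> \<mu> * (\<Sum>i<n. (y i)\<^sup>2) \<le> (\<Sum>i<n. y i * D y i)))"

lemma gap_pos: "gap > 0"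
  and gap_eigenvector: "\<exists>v :: nat \<Rightarrow> real. (\<Sum>i<n. v i) = 0 \<and> (\<Sum>i<n. (v i)\<^sup>2) = 1 \<and> (\<forall>i<n. D v i = gap * v i)"
  and poincare_real: "(\<Sum>i<n. y i) = 0 \<Longrightarrow> gap * (\<Sum>i<n. (y i)\<^sup>2) \<le> (\<Sum>i<n. y i * D (y :: nat \<Rightarrow> real) i)"
  using someI_ex[OF gap_exists] unfolding gap_def[symmetric] by blast+

lemma Re_D: "Re (D y i) = D (\<lambda>j. Re (y j)) i" and Im_D: "Im (D y i) = D (\<lambda>j. Im (y j)) i"
  by (simp_all add: D_def)

lemma poincare:
  fixes y :: "nat \<Rightarrow> complex"
  assumes "(\<Sum>i<n. y i) = 0"
  shows "gap * (\<Sum>i<n. (cmod (y i))\<^sup>2) \<le> (\<Sum>i<n. inner (y i) (D y i))"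
proof -
  have "(\<Sum>i<n. Re (y i)) = 0" "(\<Sum>i<n. Im (y i)) = 0"
    using assms by (simp_all flip: Re_sum Im_sum)
  from poincare_real[OF this(1)] poincare_real[OF this(2)] show ?thesis
    by (simp add: inner_complex_def cmod_power2 Re_D Im_D sum.distrib distrib_left)
qed

text \<open>
  On mean-zero vectors \<open>D\<close> agrees with the sum of \<open>D\<close> and the all-ones matrix. That sum is
  injective by the Poincare inequality and hence invertible, and summing the equation over
  all states shows that the solution has mean zero again. Giving the solution by a fixed
  matrix \<open>g\<close> allows it to be differentiated along a trajectory.
\<close>
lemma D_inverse:
  "\<exists>g :: nat \<Rightarrow> nat \<Rightarrow> real. \<forall>p :: nat \<Rightarrow> complex. (\<Sum>i<n. p i) = 0 \<longrightarrow>
     (\<Sum>i<n. \<Sum>k<n. g i k *\<^sub>R p k) = 0 \<and> (\<forall>i<n. D (\<lambda>i. \<Sum>k<n. g i k *\<^sub>R p k) i = p i)"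
proof -
  define A where "A = mat n n (\<lambda>(i, j). 1 - q i j)"
  have A: "A \<in> carrier_mat n n" by (simp add: A_def)
  have "v = 0\<^sub>v n" if v: "v \<in> carrier_vec n" and Av: "A *\<^sub>v v = 0\<^sub>v n" for v
  proof -
    define y where "y i = v $ i" for i
    have e: "(\<Sum>j<n. y j) + D y i = 0" if "i < n" for i
    proof -
      have "0 = (A *\<^sub>v v) $ i" using that Av by simp
      also have "\<dots> = (\<Sum>j<n. (1 - q i j) * y j)"
        using that v by (simp add: A_def scalar_prod_def y_def lessThan_atLeast0)
      also have "\<dots> = (\<Sum>j<n. y j) + D y i"
        by (simp add: D_def left_diff_distrib sum_subtractf)
      finally show ?thesis by simp
    qed
    then have "(\<Sum>i<n. (\<Sum>j<n. y j) + D y i) = 0" by simp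
    then have m: "(\<Sum>j<n. y j) = 0" using sum_D[of y] two_states by (simp add: sum.distrib)
    with e have "D y i = 0" if "i < n" for i using that by simp
    then have "gap * (\<Sum>i<n. (y i)\<^sup>2) \<le> 0" using poincare_real[OF m] by simp
    then have "(\<Sum>i<n. (y i)\<^sup>2) = 0"
      using gap_pos sum_nonneg[of "{..<n}" "\<lambda>i. (y i)\<^sup>2"] by (simp add: mult_le_0_iff) 
    then have "\<forall>i\<in>{..<n}. y i = 0"
      by (subst (asm) sum_nonneg_eq_0_iff) auto
    then show ?thesis using v by (intro eq_vecI) (auto simp: y_def)
  qed
  then have "Determinant.det A \<noteq> 0" using det_0_iff_vec_prod_zero_field[OF A] by blast
  from det_non_zero_imp_unit[OF A this, of "()"]
  obtain B where B: "B \<in> carrier_mat n n" and AB: "A * B = 1\<^sub>m n"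
    by (auto simp: Units_def ring_mat_simps)
  define g where "g i k = B $$ (i, k)" for i k
  have AB': "(\<Sum>j<n. (1 - q i j) * g j k) = (if i = k then 1 else 0)" if "i < n" "k < n" for i k
  proof -
    have "(\<Sum>j<n. (1 - q i j) * g j k) = (A * B) $$ (i, k)"
      using that A B by (simp add: scalar_prod_def A_def g_def lessThan_atLeast0)
    then show ?thesis using AB that by simp
  qed
  have "(\<Sum>i<n. \<Sum>k<n. g i k *\<^sub>R p k) = 0 \<and> (\<forall>i<n. D (\<lambda>i. \<Sum>k<n. g i k *\<^sub>R p k) i = p i)"
    if p: "(\<Sum>i<n. p i) = 0" for p :: "nat \<Rightarrow> complex"
  proof -
    define y where "y i = (\<Sum>k<n. g i k *\<^sub>R p k)" for i
    have e: "(\<Sum>j<n. y j) + D y i = p i" if "i < n" for i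
    proof -
      have "(\<Sum>j<n. y j) + D y i = (\<Sum>j<n. (1 - q i j) *\<^sub>R y j)"
        unfolding D_def by (simp add: scaleR_diff_left sum_subtractf)
      also have "\<dots> = (\<Sum>j<n. \<Sum>k<n. ((1 - q i j) * g j k) *\<^sub>R p k)"
        unfolding y_def by (simp only: scaleR_sum_right scaleR_scaleR)
      also have "\<dots> = (\<Sum>k<n. (\<Sum>j<n. (1 - q i j) * g j k) *\<^sub>R p k)"
        unfolding scaleR_sum_left by (rule sum.swap)
      also have "\<dots> = (\<Sum>k<n. if i = k then p k else 0)"
      proof (intro sum.cong refl)
        fix k assume "k \<in> {..<n}"
        then show "(\<Sum>j<n. (1 - q i j) * g j k) *\<^sub>R p k = (if i = k then p k else 0)"
          using AB'[OF that, of k] by simp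
      qed
      also have "\<dots> = p i" using that by simp
      finally show ?thesis .
    qed
    have "(\<Sum>i<n. (\<Sum>j<n. y j) + D y i) = (\<Sum>i<n. p i)"
      by (intro sum.cong refl e) simp
    then have "(\<Sum>j<n. y j) = 0" using sum_D[of y] two_states p by (simp add: sum.distrib)
    with e show ?thesis unfolding y_def by auto
  qed
  then show ?thesis by blast
qed

end

text \<open>
  An eigenvector for a nonzero eigenvalue has mean zero, since the entries of \<open>D v\<close> sum to
  zero; the Poincare inequality therefore bounds its eigenvalue from below.
\<close>
lemma (in symmetric_chain) spectral_gap_eq:
  assumes Q: "Q \<in> carrier_mat n n" and q: "\<And>i j. i < n \<Longrightarrow> j < n \<Longrightarrow> Q $$ (i, j) = q i j"
  shows "spectral_gap Q = gap"
proof -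
  have mQ: "- Q \<in> carrier_mat n n" using Q by simp
  have mult: "((- Q) *\<^sub>v v) $ i = D (\<lambda>j. v $ j) i" if "v \<in> carrier_vec n" "i < n" for v i
    using that Q by (simp add: D_def scalar_prod_def lessThan_atLeast0 q sum_negf)
  have ev: "eigenvalue (- Q) \<mu> \<longleftrightarrow> (\<exists>v \<in> carrier_vec n. v \<noteq> 0\<^sub>v n \<and> (\<forall>i<n. D (\<lambda>j. v $ j) i = \<mu> * v $ i))" for \<mu>
  proof -
    have "(- Q) *\<^sub>v v = \<mu> \<cdot>\<^sub>v v \<longleftrightarrow> (\<forall>i<n. D (\<lambda>j. v $ j) i = \<mu> * v $ i)" if v: "v \<in> carrier_vec n" for v
      using Q v mult[OF v] by (auto simp: vec_eq_iff simp del: index_mult_mat_vec)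
    then show ?thesis using Q unfolding eigenvalue_def eigenvector_def by auto
  qed
  have fin: "finite {\<mu>. eigenvalue (- Q) \<mu> \<and> \<mu> \<noteq> 0}"
  proof (rule finite_subset)
    show "finite {\<mu>. poly (char_poly (- Q)) \<mu> = 0}"
      using degree_monic_char_poly[OF mQ] by (intro poly_roots_finite) auto
    show "{\<mu>. eigenvalue (- Q) \<mu> \<and> \<mu> \<noteq> 0} \<subseteq> {\<mu>. poly (char_poly (- Q)) \<mu> = 0}"
      using eigenvalue_root_char_poly[OF mQ] by auto
  qed
  show ?thesis
    unfolding spectral_gap_def
  proof (rule Min_eqI[OF fin])
    fix \<mu> assume "\<mu> \<in> {\<mu>. eigenvalue (- Q) \<mu> \<and> \<mu> \<noteq> 0}"
    then obtain v where v: "v \<in> carrier_vec n" "v \<noteq> 0\<^sub>v n" and e: "\<And>i. i < n \<Longrightarrow> D (\<lambda>j. v $ j) i = \<mu> * v $ i"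
      and "\<mu> \<noteq> 0" by (auto simp: ev)
    have "(\<Sum>i<n. D (\<lambda>j. v $ j) i) = \<mu> * (\<Sum>i<n. v $ i)"
      unfolding sum_distrib_left by (intro sum.cong refl) (simp add: e)
    then have "(\<Sum>i<n. v $ i) = 0" using \<open>\<mu> \<noteq> 0\<close> by (simp add: sum_D)
    from poincare_real[OF this]
    have "gap * (\<Sum>i<n. (v $ i)\<^sup>2) \<le> (\<Sum>i<n. v $ i * (\<mu> * v $ i))"
      by (simp add: e)
    also have "\<dots> = \<mu> * (\<Sum>i<n. (v $ i)\<^sup>2)"
      unfolding sum_distrib_left by (intro sum.cong refl) (simp add: power2_eq_square)
    finally have 1: "gap * (\<Sum>i<n. (v $ i)\<^sup>2) \<le> \<mu> * (\<Sum>i<n. (v $ i)\<^sup>2)" .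
    have "(\<Sum>i<n. (v $ i)\<^sup>2) \<noteq> 0"
    proof
      assume "(\<Sum>i<n. (v $ i)\<^sup>2) = 0"
      then have "\<forall>i\<in>{..<n}. v $ i = 0" by (subst (asm) sum_nonneg_eq_0_iff) auto
      then show False using v by (auto simp: vec_eq_iff)
    qed
    then have "0 < (\<Sum>i<n. (v $ i)\<^sup>2)" using sum_nonneg[of "{..<n}" "\<lambda>i. (v $ i)\<^sup>2"] by simp
    with 1 show "gap \<le> \<mu>" by simp
  next
    obtain v where v: "(\<Sum>i<n. (v i)\<^sup>2) = 1" "\<forall>i<n. D v i = gap * v i" using gap_eigenvector by blast
    have "D (\<lambda>j. vec n v $ j) i = D v i" for i by (simp add: D_def)
    moreover have "vec n v \<noteq> 0\<^sub>v n"
    proof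
      assume "vec n v = 0\<^sub>v n"
      then have "v i = 0" if "i < n" for i using that by (metis index_vec index_zero_vec(1))
      then show False using v(1) by simp
    qed
    ultimately have "eigenvalue (- Q) gap"
      unfolding ev using v(2) by (intro bexI[of _ "vec n v"]) auto
    then show "gap \<in> {\<mu>. eigenvalue (- Q) \<mu> \<and> \<mu> \<noteq> 0}" using gap_pos by simp
  qed
qed

section \<open>Square arrays of complex numbers\<close>

text \<open>
  The real part of the Hilbert--Schmidt inner product of the \<open>n \<times> n\<close> corners, without the
  factor \<open>1 / n\<close>. In a real bilinear form the antisymmetry of \<open>i[H, -]\<close> and the derivative
  of a squared norm have no conjugates to track.
\<close>
definition hsp :: "nat \<Rightarrow> (nat \<Rightarrow> nat \<Rightarrow> complex) \<Rightarrow> (nat \<Rightarrow> nat \<Rightarrow> complex) \<Rightarrow> real" where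
  "hsp n f g = (\<Sum>i<n. \<Sum>j<n. inner (f i j) (g i j))"

definition hsn :: "nat \<Rightarrow> (nat \<Rightarrow> nat \<Rightarrow> complex) \<Rightarrow> real" where
  "hsn n f = sqrt (hsp n f f)"

definition diag_array :: "(nat \<Rightarrow> complex) \<Rightarrow> nat \<Rightarrow> nat \<Rightarrow> complex" where
  "diag_array y i j = (if i = j then y i else 0)"

definition off_diag :: "(nat \<Rightarrow> nat \<Rightarrow> complex) \<Rightarrow> nat \<Rightarrow> nat \<Rightarrow> complex" where
  "off_diag f i j = (if i = j then 0 else f i j)"

lemma hsp_cong:
  "(\<And>i j. i < n \<Longrightarrow> j < n \<Longrightarrow> f i j = f' i j) \<Longrightarrow> (\<And>i j. i < n \<Longrightarrow> j < n \<Longrightarrow> g i j = g' i j) \<Longrightarrow> hsp n f g = hsp n f' g'"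
  unfolding hsp_def by (auto intro!: sum.cong)

lemma hsp_commute: "hsp n f g = hsp n g f"
  by (simp add: hsp_def inner_commute)

lemma hsp_add_left: "hsp n (\<lambda>i j. f i j + g i j) k = hsp n f k + hsp n g k"
  by (simp add: hsp_def inner_add_left sum.distrib)

lemma hsp_add_right: "hsp n k (\<lambda>i j. f i j + g i j) = hsp n k f + hsp n k g"
  by (simp add: hsp_def inner_add_right sum.distrib)

lemma hsp_scaleR_left: "hsp n (\<lambda>i j. c *\<^sub>R f i j) k = c * hsp n f k"
  by (simp add: hsp_def sum_distrib_left)

lemma hsp_scaleR_right: "hsp n k (\<lambda>i j. c *\<^sub>R f i j) = c * hsp n k f"
  by (simp add: hsp_def sum_distrib_left)

lemma hsp_self: "hsp n f f = (\<Sum>i<n. \<Sum>j<n. (cmod (f i j))\<^sup>2)"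
  by (simp add: hsp_def power2_norm_eq_inner)

lemma hsp_self_nonneg: "0 \<le> hsp n f f"
  by (simp add: hsp_self sum_nonneg)

lemma hsn_nonneg: "0 \<le> hsn n f"
  by (simp add: hsn_def hsp_self_nonneg)

lemma hsn_power2: "(hsn n f)\<^sup>2 = hsp n f f"
  by (simp add: hsn_def hsp_self_nonneg)

text \<open>
  The Cauchy--Schwarz inequality for each entry, followed by the one for the square-summed
  entries over \<open>{..<n} \<times> {..<n}\<close>.
\<close>
lemma hsp_Cauchy_Schwarz: "\<bar>hsp n f g\<bar> \<le> hsn n f * hsn n g"
proof -
  define I where "I = {..<n} \<times> {..<n}"
  have l2: "hsn n f = L2_set (\<lambda>x. cmod (f (fst x) (snd x))) I" for f
    by (simp add: hsn_def hsp_self L2_set_def I_def sum.cartesian_product split_def)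
  have "\<bar>hsp n f g\<bar> = \<bar>\<Sum>x\<in>I. inner (f (fst x) (snd x)) (g (fst x) (snd x))\<bar>"
    by (simp add: hsp_def I_def sum.cartesian_product split_def)
  also have "\<dots> \<le> (\<Sum>x\<in>I. \<bar>inner (f (fst x) (snd x)) (g (fst x) (snd x))\<bar>)"
    by (rule sum_abs)
  also have "\<dots> \<le> (\<Sum>x\<in>I. \<bar>cmod (f (fst x) (snd x))\<bar> * \<bar>cmod (g (fst x) (snd x))\<bar>)"
    by (intro sum_mono) (use Cauchy_Schwarz_ineq2 in simp)
  also have "\<dots> \<le> hsn n f * hsn n g"
    unfolding l2 by (rule L2_set_mult_ineq)
  finally show ?thesis .
qed

lemma hsp_diag_left: "hsp n (diag_array a) f = (\<Sum>i<n. inner (a i) (f i i))"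
proof -
  have "(\<Sum>j<n. inner (diag_array a i j) (f i j)) = inner (a i) (f i i)" if "i < n" for i
  proof -
    have "(\<Sum>j<n. inner (diag_array a i j) (f i j)) = (\<Sum>j<n. if i = j then inner (a i) (f i i) else 0)"
      by (intro sum.cong refl) (simp add: diag_array_def)
    then show ?thesis using that by simp
  qed
  then show ?thesis unfolding hsp_def by (intro sum.cong refl) simp
qed

lemma diag_plus_off: "z i j = diag_array (\<lambda>i. z i i) i j + off_diag z i j"
  by (simp add: diag_array_def off_diag_def)

lemma hsp_diag_off_left: "hsp n z f = hsp n (diag_array (\<lambda>i. z i i)) f + hsp n (off_diag z) f"
  unfolding hsp_add_left[symmetric] diag_plus_off[symmetric] ..

lemma hsp_diag_off: "hsp n (diag_array a) (off_diag z) = 0"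
  by (simp add: hsp_diag_left off_diag_def)

lemma hsp_split: "hsp n z z = (hsn n (diag_array (\<lambda>i. z i i)))\<^sup>2 + (hsn n (off_diag z))\<^sup>2"
  unfolding hsn_power2
  by (metis (no_types, lifting) add.right_neutral add_0 hsp_commute hsp_diag_off hsp_diag_off_left)

lemma hsp_has_derivative:
  assumes "\<And>i j. i < n \<Longrightarrow> j < n \<Longrightarrow> ((\<lambda>t. a t i j) has_vector_derivative a' i j) (at t)"
    and "\<And>i j. i < n \<Longrightarrow> j < n \<Longrightarrow> ((\<lambda>t. b t i j) has_vector_derivative b' i j) (at t)"
  shows "((\<lambda>t. hsp n (a t) (b t)) has_real_derivative (hsp n a' (b t) + hsp n (a t) b')) (at t)"
proof -
  have "((\<lambda>t. \<Sum>i<n. \<Sum>j<n. inner (a t i j) (b t i j)) has_vector_derivative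
     (\<Sum>i<n. \<Sum>j<n. inner (a t i j) (b' i j) + inner (a' i j) (b t i j))) (at t)"
    by (intro has_vector_derivative_sum bounded_bilinear.has_vector_derivative[OF bounded_bilinear_inner] assms) auto
  then show ?thesis
    unfolding hsp_def has_real_derivative_iff_has_vector_derivative by (simp add: sum.distrib add.commute)
qed

section \<open>Hypocoercivity in eigenbasis coordinates\<close>

context symmetric_chain
begin

text \<open>
  The matrix elements of the Hamiltonian.
\<close>
definition h :: "nat \<Rightarrow> nat \<Rightarrow> real" where
  "h i j = (if i = j then 0 else sqrt (q i j / 2))"

text \<open>
  The map \<open>X \<mapsto> i [H, X]\<close> in coordinates.
\<close>
definition T :: "(nat \<Rightarrow> nat \<Rightarrow> complex) \<Rightarrow> nat \<Rightarrow> nat \<Rightarrow> complex" where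
  "T f i j = \<i> * (\<Sum>k<n. h i k *\<^sub>R f k j - h k j *\<^sub>R f i k)"

lemma h_sym: "i < n \<Longrightarrow> j < n \<Longrightarrow> h i j = h j i"
  by (simp add: h_def sym)

lemma T_cong: "(\<And>i j. i < n \<Longrightarrow> j < n \<Longrightarrow> f i j = f' i j) \<Longrightarrow> i < n \<Longrightarrow> j < n \<Longrightarrow> T f i j = T f' i j"
  unfolding T_def by (intro arg_cong[of _ _ "\<lambda>x. \<i> * x"] sum.cong) auto

lemma inner_ii_left: "inner (\<i> * z) w = - inner z (\<i> * w)"
  by (simp add: inner_complex_def)

lemma inner_ii: "inner (\<i> * z) (\<i> * w) = inner z w"
  by (simp add: inner_complex_def)

text \<open>
  Commutation with a Hermitian matrix is symmetric for the Hilbert--Schmidt product, and the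
  factor \<open>\<i>\<close> turns this into antisymmetry. In coordinates both halves of the commutator are
  matched by exchanging two summation indices and using the symmetry of \<open>h\<close>.
\<close>
lemma hsp_T_antisym: "hsp n (T f) g = - hsp n f (T g)"
proof -
  have "hsp n (T f) g = - (\<Sum>i<n. \<Sum>j<n. \<Sum>k<n. h i k * inner (f k j) (\<i> * g i j))
      + (\<Sum>i<n. \<Sum>j<n. \<Sum>k<n. h k j * inner (f i k) (\<i> * g i j))"
    unfolding hsp_def T_def inner_ii_left
    by (simp add: inner_sum_left inner_diff_left sum_subtractf sum_negf)
  moreover have "hsp n f (T g) = (\<Sum>i<n. \<Sum>j<n. \<Sum>k<n. h i k * inner (f i j) (\<i> * g k j))
      - (\<Sum>i<n. \<Sum>j<n. \<Sum>k<n. h k j * inner (f i j) (\<i> * g i k))"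
    unfolding hsp_def T_def
    by (simp add: sum_distrib_left right_diff_distrib inner_sum_right inner_diff_right sum_subtractf)
  moreover have "(\<Sum>i<n. \<Sum>j<n. \<Sum>k<n. h i k * inner (f k j) (\<i> * g i j))
      = (\<Sum>i<n. \<Sum>j<n. \<Sum>k<n. h i k * inner (f i j) (\<i> * g k j))"
  proof -
    have "(\<Sum>i<n. \<Sum>j<n. \<Sum>k<n. h i k * inner (f k j) (\<i> * g i j))
      = (\<Sum>j<n. \<Sum>k<n. \<Sum>i<n. h i k * inner (f k j) (\<i> * g i j))"
      by (subst sum.swap, rule sum.cong[OF refl], rule sum.swap)
    also have "\<dots> = (\<Sum>j<n. \<Sum>k<n. \<Sum>i<n. h k i * inner (f k j) (\<i> * g i j))"
      by (intro sum.cong refl) (simp add: h_sym)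
    also have "\<dots> = (\<Sum>k<n. \<Sum>j<n. \<Sum>i<n. h k i * inner (f k j) (\<i> * g i j))"
      by (rule sum.swap)
    finally show ?thesis .
  qed
  moreover have "(\<Sum>i<n. \<Sum>j<n. \<Sum>k<n. h k j * inner (f i k) (\<i> * g i j))
      = (\<Sum>i<n. \<Sum>j<n. \<Sum>k<n. h k j * inner (f i j) (\<i> * g i k))"
  proof (rule sum.cong[OF refl])
    fix i
    have "(\<Sum>j<n. \<Sum>k<n. h k j * inner (f i k) (\<i> * g i j)) = (\<Sum>k<n. \<Sum>j<n. h j k * inner (f i k) (\<i> * g i j))"
      by (subst sum.swap) (intro sum.cong refl, simp add: h_sym)
    then show "(\<Sum>j<n. \<Sum>k<n. h k j * inner (f i k) (\<i> * g i j)) = (\<Sum>j<n. \<Sum>k<n. h k j * inner (f i j) (\<i> * g i k))" .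
  qed
  ultimately show ?thesis by simp
qed

lemma hsp_T_self: "hsp n z (T z) = 0"
  using hsp_T_antisym[of z z] by (simp add: hsp_commute)

lemma T_diag:
  assumes "i < n" "j < n"
  shows "T (diag_array a) i j = \<i> * (h i j *\<^sub>R (a j - a i))"
proof -
  have "(\<Sum>k<n. h i k *\<^sub>R diag_array a k j - h k j *\<^sub>R diag_array a i k)
     = (\<Sum>k<n. if k = j then h i j *\<^sub>R a j else 0) - (\<Sum>k<n. if k = i then h i j *\<^sub>R a i else 0)"
    unfolding sum_subtractf[symmetric] by (intro sum.cong refl) (simp add: diag_array_def)
  with assms show ?thesis by (simp add: T_def scaleR_diff_right)
qed

lemma T_diag_diag: "i < n \<Longrightarrow> T (diag_array a) i i = 0"
  by (simp add: T_diag)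

text \<open>
  The lifting identity. An entry of \<open>T\<close> on a diagonal array is \<open>\<i> h i j (a j - a i)\<close>, and
  \<open>(h i j)\<^sup>2 = q i j / 2\<close> turns the sum of products into the Dirichlet form.
\<close>
lemma hsp_T_diag: "hsp n (T (diag_array a)) (T (diag_array b)) = (\<Sum>i<n. inner (a i) (D b i))"
proof -
  have "inner (T (diag_array a) i j) (T (diag_array b) i j) = q i j * inner (a i - a j) (b i - b j) / 2"
    if "i < n" "j < n" for i j
  proof -
    have "inner (T (diag_array a) i j) (T (diag_array b) i j) = (h i j)\<^sup>2 * inner (a j - a i) (b j - b i)"
      using that by (simp add: T_diag inner_ii power2_eq_square)
    also have "inner (a j - a i) (b j - b i) = inner (a i - a j) (b i - b j)"
      by (simp add: inner_diff_left inner_diff_right)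
    also have "(h i j)\<^sup>2 * inner (a i - a j) (b i - b j) = q i j * inner (a i - a j) (b i - b j) / 2"
      using that rate_nonneg[of i j] by (simp add: h_def)
    finally show ?thesis .
  qed
  then show ?thesis
    unfolding hsp_def dirichlet_form sum_divide_distrib by (intro sum.cong refl) auto
qed

text \<open>
  A commutator is traceless.
\<close>
lemma sum_T_diag: "(\<Sum>i<n. T f i i) = 0"
proof -
  have "(\<Sum>i<n. \<Sum>k<n. h i k *\<^sub>R f k i) = (\<Sum>i<n. \<Sum>k<n. h k i *\<^sub>R f i k)"
    by (rule sum.swap)
  then show ?thesis
    by (simp add: T_def sum_subtractf flip: sum_distrib_left)
qed

lemma hsn_diag: "hsn n (diag_array y) = sqrt (\<Sum>i<n. (cmod (y i))\<^sup>2)"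
  by (simp add: hsn_def hsp_diag_left) (simp add: diag_array_def power2_norm_eq_inner)

lemma T_has_derivative:
  assumes "\<And>i j. i < n \<Longrightarrow> j < n \<Longrightarrow> ((\<lambda>t. z t i j) has_vector_derivative z' i j) (at t)"
    and "i < n" "j < n"
  shows "((\<lambda>t. T (z t) i j) has_vector_derivative T z' i j) (at t)"
  unfolding T_def
  by (intro has_vector_derivative_mult_right has_vector_derivative_sum has_vector_derivative_diff
      bounded_linear.has_vector_derivative[OF bounded_linear_scaleR_right] assms) (use assms in auto)

text \<open>
  Both bounds follow by combining the Poincare inequality with Cauchy--Schwarz for
  \<open>\<langle>y, D y\<rangle>\<close>.
\<close>
lemma hsn_diag_le_D:
  assumes "(\<Sum>i<n. y i) = 0"
  shows "hsn n (diag_array y) \<le> hsn n (diag_array (D y)) / gap"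
    and "(\<Sum>i<n. inner (y i) (D y i)) \<le> (hsn n (diag_array (D y)))\<^sup>2 / gap"
proof -
  let ?a = "hsn n (diag_array y)" and ?b = "hsn n (diag_array (D y))"
  have e: "(\<Sum>i<n. inner (y i) (D y i)) = hsp n (diag_array y) (diag_array (D y))"
    unfolding hsp_diag_left by (simp add: diag_array_def)
  have le: "(\<Sum>i<n. inner (y i) (D y i)) \<le> ?a * ?b"
    unfolding e using hsp_Cauchy_Schwarz by (rule abs_le_D1)
  moreover have "gap * ?a\<^sup>2 \<le> (\<Sum>i<n. inner (y i) (D y i))"
    using poincare[OF assms] by (simp add: hsn_diag sum_nonneg)
  ultimately have "?a * (gap * ?a) \<le> ?a * ?b" by (simp add: power2_eq_square algebra_simps)
  then have "gap * ?a \<le> ?b"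
    using hsn_nonneg[of n "diag_array y"] hsn_nonneg[of n "diag_array (D y)"] by (cases "?a = 0") auto
  then show ab: "?a \<le> ?b / gap" using gap_pos by (simp add: field_simps)
  have "?a * ?b \<le> ?b / gap * ?b" by (rule mult_right_mono[OF ab hsn_nonneg])
  with le show "(\<Sum>i<n. inner (y i) (D y i)) \<le> ?b\<^sup>2 / gap" by (simp add: power2_eq_square)
qed

text \<open>
  Only the existence of some bound matters, so the entries are estimated crudely by the sum
  of all \<open>\<bar>h i j\<bar>\<close>.
\<close>
lemma T_bounded: "\<exists>c\<ge>0. \<forall>f. hsn n (T f) \<le> c * hsn n f"
proof -
  define s where "s = (\<Sum>i<n. \<Sum>j<n. \<bar>h i j\<bar>)"
  have s0: "s \<ge> 0" by (simp add: s_def sum_nonneg)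
  have "hsn n (T f) \<le> real n * (2 * s) * hsn n f" for f
  proof -
    have f: "cmod (f i j) \<le> hsn n f" if "i < n" "j < n" for i j
    proof -
      have "(cmod (f i j))\<^sup>2 \<le> (\<Sum>j<n. (cmod (f i j))\<^sup>2)"
        by (rule member_le_sum) (use that in auto)
      also have "\<dots> \<le> hsp n f f"
        unfolding hsp_self
        by (rule member_le_sum[of i "{..<n}" "\<lambda>i. \<Sum>j<n. (cmod (f i j))\<^sup>2"]) (use that in \<open>auto intro: sum_nonneg\<close>)
      finally show ?thesis unfolding hsn_def by (rule real_le_rsqrt)
    qed
    have T: "cmod (T f i j) \<le> 2 * s * hsn n f" if ij: "i < n" "j < n" for i j
    proof -
      have "cmod (T f i j) \<le> (\<Sum>k<n. cmod (h i k *\<^sub>R f k j - h k j *\<^sub>R f i k))"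
        by (simp add: T_def norm_mult norm_sum)
      also have "\<dots> \<le> (\<Sum>k<n. \<bar>h i k\<bar> * hsn n f + \<bar>h j k\<bar> * hsn n f)"
      proof (intro sum_mono order_trans[OF norm_triangle_ineq4] add_mono)
        fix k assume "k \<in> {..<n}"
        then have k: "k < n" by simp
        show "cmod (h i k *\<^sub>R f k j) \<le> \<bar>h i k\<bar> * hsn n f"
          using f[OF k ij(2)] by (simp add: mult_left_mono)
        show "cmod (h k j *\<^sub>R f i k) \<le> \<bar>h j k\<bar> * hsn n f"
          using f[OF ij(1) k] by (simp add: h_sym[OF k ij(2)] mult_left_mono)
      qed
      also have "\<dots> = ((\<Sum>k<n. \<bar>h i k\<bar>) + (\<Sum>k<n. \<bar>h j k\<bar>)) * hsn n f"
        by (simp add: sum.distrib sum_distrib_right distrib_right)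
      also have "\<dots> \<le> (s + s) * hsn n f"
        unfolding s_def
        by (intro mult_right_mono add_mono hsn_nonneg member_le_sum[of _ "{..<n}" "\<lambda>i. \<Sum>k<n. \<bar>h i k\<bar>"])
           (use ij in \<open>auto intro: sum_nonneg\<close>)
      finally show ?thesis by simp
    qed
    have "hsp n (T f) (T f) \<le> (\<Sum>i<n. \<Sum>j<n. (2 * s * hsn n f)\<^sup>2)"
      unfolding hsp_self by (intro sum_mono power_mono T) auto
    also have "\<dots> = (real n * (2 * s) * hsn n f)\<^sup>2"
      by (simp add: power2_eq_square)
    finally show ?thesis
      unfolding hsn_def[of n "T f"] by (rule real_le_lsqrt[rotated]) (use s0 hsn_nonneg[of n f] in simp)
  qed
  then show ?thesis using s0 by (intro exI[of _ "real n * (2 * s)"]) auto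
qed

text \<open>
  Ensures that the constant controlling the double commutator is finite for each chain; its
  size enters the convergence rate only through the infimum of all such constants.
\<close>
lemma TT_bounded_by_D:
  "\<exists>K\<ge>0. \<forall>y. (\<Sum>i<n. y i) = 0 \<longrightarrow> hsn n (T (T (diag_array y))) \<le> K * hsn n (diag_array (D y))"
proof -
  obtain c where c: "c \<ge> 0" "\<And>f. hsn n (T f) \<le> c * hsn n f" using T_bounded by blast
  have "hsn n (T (T (diag_array y))) \<le> c * c / gap * hsn n (diag_array (D y))" if "(\<Sum>i<n. y i) = 0" for y
  proof -
    have "hsn n (T (T (diag_array y))) \<le> c * hsn n (T (diag_array y))" by (rule c)
    also have "\<dots> \<le> c * (c * hsn n (diag_array y))" by (intro mult_left_mono c)
    also have "\<dots> \<le> c * (c * (hsn n (diag_array (D y)) / gap))" by (intro mult_left_mono hsn_diag_le_D that c)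
    finally show ?thesis by simp
  qed
  then show ?thesis using c gap_pos by (intro exI[of _ "c * c / gap"]) auto
qed

end

locale dephased_lift = symmetric_chain +
  fixes \<kappa> :: "nat \<Rightarrow> real" and \<delta> \<Delta> :: real
  assumes gap_lower: "\<lbrakk>i < n; j < n; i \<noteq> j\<rbrakk> \<Longrightarrow> \<delta> \<le> \<bar>\<kappa> i - \<kappa> j\<bar>"
    and gap_upper: "\<lbrakk>i < n; j < n\<rbrakk> \<Longrightarrow> \<bar>\<kappa> i - \<kappa> j\<bar> \<le> \<Delta>"
    and \<delta>_pos: "0 < \<delta>"
begin

text \<open>
  The dissipator \<open>X \<mapsto> - [A, [A, X]]\<close> in coordinates.
\<close>
definition S :: "(nat \<Rightarrow> nat \<Rightarrow> complex) \<Rightarrow> nat \<Rightarrow> nat \<Rightarrow> complex" where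
  "S f i j = - ((\<kappa> i - \<kappa> j)\<^sup>2 *\<^sub>R f i j)"

definition L :: "real \<Rightarrow> (nat \<Rightarrow> nat \<Rightarrow> complex) \<Rightarrow> nat \<Rightarrow> nat \<Rightarrow> complex" where
  "L \<gamma> f i j = T f i j + \<gamma> *\<^sub>R S f i j"

definition D_inv :: "nat \<Rightarrow> nat \<Rightarrow> real" where
  "D_inv = (SOME g. \<forall>p :: nat \<Rightarrow> complex. (\<Sum>i<n. p i) = 0 \<longrightarrow>
     (\<Sum>i<n. \<Sum>k<n. g i k *\<^sub>R p k) = 0 \<and> (\<forall>i<n. D (\<lambda>i. \<Sum>k<n. g i k *\<^sub>R p k) i = p i))"

text \<open>
  The solution \<open>y\<close> of \<open>D y = p\<close>, where \<open>p\<close> is the diagonal of \<open>f\<close>, provided \<open>p\<close> has mean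
  zero.
\<close>
definition potential :: "(nat \<Rightarrow> nat \<Rightarrow> complex) \<Rightarrow> nat \<Rightarrow> complex" where
  "potential f i = (\<Sum>k<n. D_inv i k *\<^sub>R f k k)"

text \<open>
  The array \<open>T D\<^sup>-\<^sup>1 p\<close>, whose pairing with \<open>f\<close> is the cross term of the modified energy.
\<close>
definition corrector :: "(nat \<Rightarrow> nat \<Rightarrow> complex) \<Rightarrow> nat \<Rightarrow> nat \<Rightarrow> complex" where
  "corrector f = T (diag_array (potential f))"

lemma sum_potential: "(\<Sum>i<n. f i i) = 0 \<Longrightarrow> (\<Sum>i<n. potential f i) = 0"
  and D_potential: "(\<Sum>i<n. f i i) = 0 \<Longrightarrow> i < n \<Longrightarrow> D (potential f) i = f i i"
  using someI_ex[OF D_inverse, folded D_inv_def] unfolding potential_def by blast+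

lemma hsp_corrector_self: "(\<Sum>i<n. f i i) = 0 \<Longrightarrow> hsp n (corrector f) (corrector f) = (\<Sum>i<n. inner (potential f i) (f i i))"
  unfolding corrector_def hsp_T_diag by (intro sum.cong refl) (simp add: D_potential)

text \<open>
  The squared norm \<open>w\<^sup>2\<close> of the corrector equals \<open>\<langle>y, D y\<rangle> = \<langle>y, p\<rangle>\<close>. The Poincare
  inequality gives \<open>\<surd>gap |y| \<le> w\<close>, and Cauchy--Schwarz gives \<open>w\<^sup>2 \<le> |y| |p|\<close>.
\<close>
lemma hsn_corrector:
  assumes "(\<Sum>i<n. f i i) = 0"
  shows "hsn n (corrector f) \<le> hsn n (diag_array (\<lambda>i. f i i)) / sqrt gap"
proof -
  let ?w = "hsn n (corrector f)" and ?y = "hsn n (diag_array (potential f))" and ?p = "hsn n (diag_array (\<lambda>i. f i i))"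
  have "?w\<^sup>2 = hsp n (diag_array (potential f)) (diag_array (\<lambda>i. f i i))"
    unfolding hsn_power2 hsp_corrector_self[of f, OF assms] hsp_diag_left by (simp add: diag_array_def)
  also have "\<dots> \<le> ?y * ?p" using hsp_Cauchy_Schwarz by (rule abs_le_D1)
  finally have 1: "?w\<^sup>2 \<le> ?y * ?p" .
  have "gap * ?y\<^sup>2 \<le> ?w\<^sup>2"
    using poincare[OF sum_potential[of f, OF assms]] unfolding hsn_power2 corrector_def hsp_T_diag by (simp add: hsp_diag_left diag_array_def power2_norm_eq_inner)
  then have "sqrt (gap * ?y\<^sup>2) \<le> sqrt (?w\<^sup>2)" by (rule real_sqrt_le_mono)
  then have 2: "sqrt gap * ?y \<le> ?w" by (simp add: real_sqrt_mult hsn_nonneg)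
  have "sqrt gap * ?w\<^sup>2 \<le> sqrt gap * (?y * ?p)" using 1 gap_pos by (intro mult_left_mono) auto
  also have "\<dots> \<le> ?w * ?p" using mult_right_mono[OF 2 hsn_nonneg[of n "diag_array (\<lambda>i. f i i)"]] by (simp add: mult.assoc)
  finally have "?w * (sqrt gap * ?w) \<le> ?w * ?p" by (simp add: power2_eq_square algebra_simps)
  then have "sqrt gap * ?w \<le> ?p"
    using hsn_nonneg[of n "corrector f"] hsn_nonneg[of n "diag_array (\<lambda>i. f i i)"] by (cases "?w = 0") auto
  then show ?thesis using gap_pos by (simp add: field_simps)
qed

lemma hsp_corrector_right: "hsp n z (corrector f) = hsp n (off_diag z) (corrector f)"
  by (subst hsp_diag_off_left) (simp add: hsp_diag_left corrector_def T_diag_diag)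

lemma hsp_corrector_bound:
  assumes "(\<Sum>i<n. z i i) = 0"
  shows "\<bar>hsp n z (corrector z)\<bar> \<le> hsn n (off_diag z) * (hsn n (diag_array (\<lambda>i. z i i)) / sqrt gap)"
  by (subst hsp_corrector_right, rule order_trans[OF hsp_Cauchy_Schwarz]) (intro mult_left_mono hsn_corrector assms hsn_nonneg)

lemma hsp_S: "hsp n z (S z) \<le> - \<delta>\<^sup>2 * (hsn n (off_diag z))\<^sup>2"
proof -
  have "inner (z i j) (S z i j) \<le> - \<delta>\<^sup>2 * (cmod (off_diag z i j))\<^sup>2" if "i < n" "j < n" for i j
  proof (cases "i = j")
    case False
    have "\<delta>\<^sup>2 \<le> \<bar>\<kappa> i - \<kappa> j\<bar>\<^sup>2" by (rule power_mono) (use gap_lower[OF that False] \<delta>_pos in auto)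
    then have "\<delta>\<^sup>2 * (cmod (z i j))\<^sup>2 \<le> (\<kappa> i - \<kappa> j)\<^sup>2 * (cmod (z i j))\<^sup>2"
      by (intro mult_right_mono) auto
    then show ?thesis using False by (simp add: S_def off_diag_def power2_norm_eq_inner)
  qed (simp add: S_def off_diag_def)
  then show ?thesis
    unfolding hsn_power2 hsp_self sum_distrib_left unfolding hsp_def by (intro sum_mono) auto
qed

lemma hsn_S: "hsn n (S z) \<le> \<Delta>\<^sup>2 * hsn n (off_diag z)"
proof -
  have "cmod (S z i j) \<le> \<Delta>\<^sup>2 * cmod (off_diag z i j)" if "i < n" "j < n" for i j
  proof (cases "i = j")
    case False
    have "\<bar>\<kappa> i - \<kappa> j\<bar>\<^sup>2 \<le> \<Delta>\<^sup>2" by (rule power_mono) (use gap_upper[OF that] in auto)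
    then show ?thesis using False by (simp add: S_def off_diag_def mult_right_mono)
  qed (simp add: S_def off_diag_def)
  then have "(cmod (S z i j))\<^sup>2 \<le> \<Delta>\<^sup>2 ^ 2 * (cmod (off_diag z i j))\<^sup>2" if "i < n" "j < n" for i j
    using that power_mono[of "cmod (S z i j)" "\<Delta>\<^sup>2 * cmod (off_diag z i j)" 2] by (simp add: power_mult_distrib)
  then have "hsp n (S z) (S z) \<le> \<Delta>\<^sup>2 ^ 2 * hsp n (off_diag z) (off_diag z)"
    unfolding hsp_self sum_distrib_left by (intro sum_mono) auto
  then have "sqrt (hsp n (S z) (S z)) \<le> sqrt (\<Delta>\<^sup>2 ^ 2 * hsp n (off_diag z) (off_diag z))" by (rule real_sqrt_le_mono)
  then show ?thesis unfolding hsn_def by (simp only: real_sqrt_mult real_sqrt_abs abs_power2 abs_numeral)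
qed

lemma sum_L_diag: "(\<Sum>i<n. L \<gamma> z i i) = 0"
  by (simp add: L_def S_def sum_T_diag)

text \<open>
  The part of the cross term in which the corrector is differentiated. Moving \<open>T\<close> across by
  antisymmetry identifies the pairing as \<open>- w\<^sup>2\<close>, where \<open>w\<close> is the norm of the corrector of
  \<open>L \<gamma> z\<close>. But the corrector has zero diagonal, so the pairing sees only the off-diagonal
  part of \<open>z\<close>; by Cauchy--Schwarz \<open>w\<close> is at most the norm of that part.
\<close>
lemma hsp_corrector_L_lower: "hsp n z (corrector (L \<gamma> z)) \<ge> - (hsn n (off_diag z))\<^sup>2"
proof -
  let ?w = "hsn n (corrector (L \<gamma> z))"
  have "hsp n z (corrector (L \<gamma> z)) = - hsp n (diag_array (potential (L \<gamma> z))) (T z)"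
    unfolding corrector_def using hsp_T_antisym[of z "diag_array (potential (L \<gamma> z))"] by (simp add: hsp_commute)
  also have "hsp n (diag_array (potential (L \<gamma> z))) (T z) = ?w\<^sup>2"
    unfolding hsn_power2 hsp_corrector_self[of "L \<gamma> z", OF sum_L_diag] hsp_diag_left by (simp add: L_def S_def)
  finally have 1: "hsp n z (corrector (L \<gamma> z)) = - ?w\<^sup>2" .
  have "\<bar>hsp n z (corrector (L \<gamma> z))\<bar> \<le> hsn n (off_diag z) * ?w"
    by (subst hsp_corrector_right) (rule hsp_Cauchy_Schwarz)
  with 1 have "?w * ?w \<le> hsn n (off_diag z) * ?w" by (simp add: power2_eq_square)
  then have "?w \<le> hsn n (off_diag z)" using hsn_nonneg[of n "corrector (L \<gamma> z)"] hsn_nonneg[of n "off_diag z"]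
    by (cases "?w = 0") auto
  then have "?w\<^sup>2 \<le> (hsn n (off_diag z))\<^sup>2" by (rule power_mono) (rule hsn_nonneg)
  with 1 show ?thesis by simp
qed

text \<open>
  The source of dissipation on the diagonal: for the diagonal part \<open>p\<close> the lifting identity
  gives \<open>\<langle>T p, T D\<^sup>-\<^sup>1 p\<rangle> = \<langle>p, D D\<^sup>-\<^sup>1 p\<rangle> = |p|\<^sup>2\<close>. The off-diagonal part meets
  \<open>T T D\<^sup>-\<^sup>1 p\<close>, which the double commutator bound controls by \<open>K |p|\<close>, and the dissipator
  meets the corrector.
\<close>
lemma hsp_L_corrector_lower:
  assumes tr: "(\<Sum>i<n. z i i) = 0" and \<gamma>: "0 \<le> \<gamma>"
    and K: "\<And>y. (\<Sum>i<n. y i) = 0 \<Longrightarrow> hsn n (T (T (diag_array y))) \<le> K * hsn n (diag_array (D y))"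
  shows "hsp n (L \<gamma> z) (corrector z) \<ge> (hsn n (diag_array (\<lambda>i. z i i)))\<^sup>2
     - (K + \<gamma> * \<Delta>\<^sup>2 / sqrt gap) * (hsn n (diag_array (\<lambda>i. z i i)) * hsn n (off_diag z))"
proof -
  let ?p = "hsn n (diag_array (\<lambda>i. z i i))" and ?q = "hsn n (off_diag z)"
  have "hsp n (T z) (corrector z) = - hsp n (diag_array (\<lambda>i. z i i)) (T (corrector z)) - hsp n (off_diag z) (T (corrector z))"
    unfolding hsp_T_antisym by (subst hsp_diag_off_left) simp
  also have "- hsp n (diag_array (\<lambda>i. z i i)) (T (corrector z)) = hsp n (T (diag_array (\<lambda>i. z i i))) (T (diag_array (potential z)))"
    unfolding hsp_T_antisym corrector_def by simp
  also have "\<dots> = ?p\<^sup>2"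
    unfolding hsp_T_diag hsn_power2 hsp_diag_left by (intro sum.cong refl) (simp add: D_potential tr diag_array_def)
  finally have 1: "hsp n (T z) (corrector z) = ?p\<^sup>2 - hsp n (off_diag z) (T (corrector z))" .
  have "hsn n (diag_array (D (potential z))) = ?p"
    unfolding hsn_diag by (intro arg_cong[of _ _ sqrt] sum.cong refl) (simp add: D_potential tr)
  with K[OF sum_potential[of z, OF tr]] have "hsn n (T (corrector z)) \<le> K * ?p" unfolding corrector_def by simp
  then have "?q * hsn n (T (corrector z)) \<le> ?q * (K * ?p)" by (intro mult_left_mono hsn_nonneg)
  with hsp_Cauchy_Schwarz[of n "off_diag z" "T (corrector z)"] have 2: "hsp n (off_diag z) (T (corrector z)) \<le> K * (?p * ?q)"
    by (simp add: algebra_simps)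
  have "\<bar>hsp n (S z) (corrector z)\<bar> \<le> (\<Delta>\<^sup>2 * ?q) * (?p / sqrt gap)"
    by (rule order_trans[OF hsp_Cauchy_Schwarz]) (intro mult_mono hsn_S hsn_corrector tr hsn_nonneg, simp add: hsn_nonneg)
  then have "\<gamma> * \<bar>hsp n (S z) (corrector z)\<bar> \<le> \<gamma> * ((\<Delta>\<^sup>2 * ?q) * (?p / sqrt gap))"
    using \<gamma> by (intro mult_left_mono)
  moreover have "- (\<gamma> * hsp n (S z) (corrector z)) \<le> \<gamma> * \<bar>hsp n (S z) (corrector z)\<bar>"
    using \<gamma> mult_left_mono[of "- hsp n (S z) (corrector z)" "\<bar>hsp n (S z) (corrector z)\<bar>" \<gamma>] by simp
  ultimately have 3: "\<gamma> * hsp n (S z) (corrector z) \<ge> - (\<gamma> * \<Delta>\<^sup>2 / sqrt gap * (?p * ?q))"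
    by (simp add: algebra_simps)
  have "hsp n (L \<gamma> z) (corrector z) = hsp n (T z) (corrector z) + \<gamma> * hsp n (S z) (corrector z)"
    unfolding L_def hsp_add_left hsp_scaleR_left ..
  with 1 2 3 show ?thesis by (simp add: algebra_simps)
qed

definition energy :: "real \<Rightarrow> (nat \<Rightarrow> nat \<Rightarrow> complex) \<Rightarrow> real" where
  "energy \<epsilon> z = hsp n z z / 2 - \<epsilon> * hsp n z (corrector z)"

text \<open>
  The derivative of the modified energy along \<open>z' = L \<gamma> z\<close>, as a function of \<open>z\<close>.
\<close>
definition energy_rate :: "real \<Rightarrow> real \<Rightarrow> (nat \<Rightarrow> nat \<Rightarrow> complex) \<Rightarrow> real" where
  "energy_rate \<gamma> \<epsilon> z = hsp n z (L \<gamma> z) - \<epsilon> * (hsp n (L \<gamma> z) (corrector z) + hsp n z (corrector (L \<gamma> z)))"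

lemma energy_equiv:
  assumes tr: "(\<Sum>i<n. z i i) = 0" and \<epsilon>: "0 \<le> \<epsilon>" "\<epsilon> \<le> sqrt gap / 2"
  shows "hsp n z z / 4 \<le> energy \<epsilon> z" and "energy \<epsilon> z \<le> 3 / 4 * hsp n z z"
proof -
  let ?p = "hsn n (diag_array (\<lambda>i. z i i))" and ?q = "hsn n (off_diag z)"
  have "\<epsilon> * \<bar>hsp n z (corrector z)\<bar> \<le> \<epsilon> * (?q * (?p / sqrt gap))"
    by (intro mult_left_mono hsp_corrector_bound tr \<epsilon>)
  also have "\<dots> = \<epsilon> / sqrt gap * (?p * ?q)" by simp
  also have "\<dots> \<le> 1 / 2 * (?p * ?q)"
    by (intro mult_right_mono mult_nonneg_nonneg hsn_nonneg) (use \<epsilon> gap_pos in \<open>simp add: field_simps\<close>)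
  also have "\<dots> \<le> 1 / 4 * (?p\<^sup>2 + ?q\<^sup>2)"
    using sum_squares_bound[of ?p ?q] by (simp add: mult.commute)
  finally have "\<bar>\<epsilon> * hsp n z (corrector z)\<bar> \<le> hsp n z z / 4"
    using \<epsilon> by (simp add: abs_mult hsp_split)
  then show "hsp n z z / 4 \<le> energy \<epsilon> z" "energy \<epsilon> z \<le> 3 / 4 * hsp n z z" unfolding energy_def by (simp_all add: abs_le_iff)
qed

text \<open>
  The dissipator supplies \<open>- \<gamma> \<delta>\<^sup>2 |q|\<^sup>2\<close> and the cross term \<open>- \<epsilon> |p|\<^sup>2\<close>. Half of the latter
  absorbs the mixed error \<open>\<epsilon> M |p| |q|\<close> at the price of \<open>\<epsilon> M\<^sup>2 |q|\<^sup>2 / 2\<close>, and the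
  assumption on \<open>\<epsilon>\<close> leaves a net decrease of \<open>\<epsilon> (|p|\<^sup>2 + |q|\<^sup>2) / 2\<close>, which dominates the
  energy because that is at most \<open>3 / 4\<close> of the squared norm.
\<close>
lemma energy_rate_le:
  assumes tr: "(\<Sum>i<n. z i i) = 0" and \<gamma>: "0 \<le> \<gamma>"
    and K: "\<And>y. (\<Sum>i<n. y i) = 0 \<Longrightarrow> hsn n (T (T (diag_array y))) \<le> K * hsn n (diag_array (D y))"
    and \<epsilon>: "0 \<le> \<epsilon>" "\<epsilon> \<le> sqrt gap / 2"
      "\<epsilon> * (3 / 2 + (K + \<gamma> * \<Delta>\<^sup>2 / sqrt gap)\<^sup>2 / 2) \<le> \<gamma> * \<delta>\<^sup>2"
  shows "energy_rate \<gamma> \<epsilon> z \<le> - (2 / 3 * \<epsilon>) * energy \<epsilon> z"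
proof -
  let ?p = "hsn n (diag_array (\<lambda>i. z i i))" and ?q = "hsn n (off_diag z)"
  define M where "M = K + \<gamma> * \<Delta>\<^sup>2 / sqrt gap"
  have "hsp n z (L \<gamma> z) = \<gamma> * hsp n z (S z)"
    unfolding L_def hsp_add_right hsp_scaleR_right hsp_T_self by simp
  also have "\<dots> \<le> \<gamma> * (- \<delta>\<^sup>2 * ?q\<^sup>2)" using hsp_S \<gamma> by (rule mult_left_mono)
  finally have 1: "hsp n z (L \<gamma> z) \<le> - (\<gamma> * \<delta>\<^sup>2 * ?q\<^sup>2)" by simp
  have "hsp n (L \<gamma> z) (corrector z) + hsp n z (corrector (L \<gamma> z)) \<ge> ?p\<^sup>2 - M * (?p * ?q) - ?q\<^sup>2"
    using hsp_L_corrector_lower[of z \<gamma> K, OF tr \<gamma> K, folded M_def] hsp_corrector_L_lower[of z \<gamma>] by linarith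
  moreover have half_squares_bound: "a * b \<le> a\<^sup>2 / 2 + b\<^sup>2 / 2" for a b :: real
    using sum_squares_bound[of a b] by simp
  have "M * (?p * ?q) \<le> ?p\<^sup>2 / 2 + M\<^sup>2 * ?q\<^sup>2 / 2"
    using half_squares_bound[of ?p "M * ?q"] by (simp only: power_mult_distrib mult.left_commute)
  ultimately have "hsp n (L \<gamma> z) (corrector z) + hsp n z (corrector (L \<gamma> z)) \<ge> ?p\<^sup>2 / 2 - (1 + M\<^sup>2 / 2) * ?q\<^sup>2"
    by (simp add: algebra_simps)
  then have "\<epsilon> * (hsp n (L \<gamma> z) (corrector z) + hsp n z (corrector (L \<gamma> z))) \<ge> \<epsilon> * (?p\<^sup>2 / 2 - (1 + M\<^sup>2 / 2) * ?q\<^sup>2)"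
    using \<epsilon>(1) by (rule mult_left_mono)
  moreover have "\<epsilon> * (3 / 2 + M\<^sup>2 / 2) * ?q\<^sup>2 \<le> \<gamma> * \<delta>\<^sup>2 * ?q\<^sup>2"
    using \<epsilon>(3)[folded M_def] by (rule mult_right_mono) simp
  ultimately have "energy_rate \<gamma> \<epsilon> z \<le> - (\<epsilon> / 2 * (?p\<^sup>2 + ?q\<^sup>2))"
    using 1 unfolding energy_rate_def by (simp add: algebra_simps)
  also have "\<dots> = - (2 / 3 * \<epsilon> * (3 / 4 * hsp n z z))" by (simp add: hsp_split)
  also have "\<dots> \<le> - (2 / 3 * \<epsilon> * energy \<epsilon> z)"
    using mult_left_mono[OF energy_equiv(2)[of z \<epsilon>, OF tr \<epsilon>(1,2)], of "2 / 3 * \<epsilon>"] \<epsilon>(1) by simp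
  finally show ?thesis by simp
qed

lemma corrector_has_derivative:
  assumes "\<And>i j. i < n \<Longrightarrow> j < n \<Longrightarrow> ((\<lambda>t. z t i j) has_vector_derivative z' i j) (at t)"
    and "i < n" "j < n"
  shows "((\<lambda>t. corrector (z t) i j) has_vector_derivative corrector z' i j) (at t)"
  unfolding corrector_def
proof (rule T_has_derivative[OF _ assms(2,3)])
  fix i j assume "i < n" "j < n"
  have "((\<lambda>t. potential (z t) i) has_vector_derivative potential z' i) (at t)"
    unfolding potential_def
    by (intro has_vector_derivative_sum bounded_linear.has_vector_derivative[OF bounded_linear_scaleR_right] assms(1)) auto
  then show "((\<lambda>t. diag_array (potential (z t)) i j) has_vector_derivative diag_array (potential z') i j) (at t)"
    unfolding diag_array_def by auto
qed

text \<open>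
  Gronwall's inequality for the modified energy, which lies between \<open>1 / 4\<close> and \<open>3 / 4\<close> of
  the squared norm. The resulting prefactor \<open>\<surd>3\<close> is rounded up to 2.
\<close>
theorem coordinate_decay:
  fixes z :: "real \<Rightarrow> nat \<Rightarrow> nat \<Rightarrow> complex"
  assumes ode: "\<And>t i j. i < n \<Longrightarrow> j < n \<Longrightarrow> ((\<lambda>t. z t i j) has_vector_derivative L \<gamma> (z t) i j) (at t)"
    and tr: "\<And>t. (\<Sum>i<n. z t i i) = 0" and \<gamma>: "0 \<le> \<gamma>"
    and K: "\<And>y. (\<Sum>i<n. y i) = 0 \<Longrightarrow> hsn n (T (T (diag_array y))) \<le> K * hsn n (diag_array (D y))"
    and \<epsilon>: "0 \<le> \<epsilon>" "\<epsilon> \<le> sqrt gap / 2"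
      "\<epsilon> * (3 / 2 + (K + \<gamma> * \<Delta>\<^sup>2 / sqrt gap)\<^sup>2 / 2) \<le> \<gamma> * \<delta>\<^sup>2"
    and t: "0 \<le> t"
  shows "hsn n (z t) \<le> 2 * exp (- (\<epsilon> / 3) * t) * hsn n (z 0)"
proof -
  let ?r = "2 / 3 * \<epsilon>"
  have dE: "((\<lambda>t. energy \<epsilon> (z t)) has_real_derivative energy_rate \<gamma> \<epsilon> (z t)) (at t)" for t
  proof -
    have "((\<lambda>t. hsp n (z t) (z t)) has_real_derivative hsp n (L \<gamma> (z t)) (z t) + hsp n (z t) (L \<gamma> (z t))) (at t)"
      by (rule hsp_has_derivative) (auto intro: ode)
    moreover have "((\<lambda>t. hsp n (z t) (corrector (z t))) has_real_derivative
        hsp n (L \<gamma> (z t)) (corrector (z t)) + hsp n (z t) (corrector (L \<gamma> (z t)))) (at t)"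
      by (rule hsp_has_derivative) (auto intro: ode corrector_has_derivative)
    ultimately show ?thesis
      unfolding energy_def energy_rate_def
      by (auto intro!: derivative_eq_intros simp: hsp_commute[of n "L \<gamma> (z t)" "z t"])
  qed
  have "energy \<epsilon> (z t) * exp (?r * t) \<le> energy \<epsilon> (z 0) * exp (?r * 0)"
  proof (rule DERIV_nonpos_imp_nonincreasing[OF t])
    fix s
    have "((\<lambda>t. energy \<epsilon> (z t) * exp (?r * t)) has_real_derivative
      (energy_rate \<gamma> \<epsilon> (z s) + ?r * energy \<epsilon> (z s)) * exp (?r * s)) (at s)"
      by (auto intro!: derivative_eq_intros dE simp: algebra_simps)
    moreover have "energy_rate \<gamma> \<epsilon> (z s) + ?r * energy \<epsilon> (z s) \<le> 0"
      using energy_rate_le[of "z s" \<gamma> K \<epsilon>, OF tr \<gamma> K \<epsilon>] by simp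
    ultimately show "\<exists>y. ((\<lambda>t. energy \<epsilon> (z t) * exp (?r * t)) has_real_derivative y) (at s) \<and> y \<le> 0"
      by (intro exI[of _ "(energy_rate \<gamma> \<epsilon> (z s) + ?r * energy \<epsilon> (z s)) * exp (?r * s)"] conjI mult_nonpos_nonneg) auto
  qed
  then have "energy \<epsilon> (z t) * exp (?r * t) * exp (- ?r * t) \<le> energy \<epsilon> (z 0) * exp (- ?r * t)" by simp
  then have "energy \<epsilon> (z t) \<le> energy \<epsilon> (z 0) * exp (- ?r * t)"
    unfolding mult.assoc exp_add[symmetric] by simp
  then have "hsp n (z t) (z t) / 4 \<le> energy \<epsilon> (z 0) * exp (- ?r * t)"
    using energy_equiv(1)[of "z t" \<epsilon>, OF tr \<epsilon>(1,2)] by linarith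
  also have "\<dots> \<le> 3 / 4 * hsp n (z 0) (z 0) * exp (- ?r * t)"
    by (intro mult_right_mono energy_equiv(2) tr \<epsilon>) simp
  finally have "hsp n (z t) (z t) \<le> 3 * (hsp n (z 0) (z 0) * exp (- ?r * t))" by simp
  also have "\<dots> \<le> 2\<^sup>2 * (hsp n (z 0) (z 0) * exp (- ?r * t))"
    by (intro mult_right_mono mult_nonneg_nonneg hsp_self_nonneg) auto
  also have "\<dots> = (2 * exp (- (\<epsilon> / 3) * t) * hsn n (z 0))\<^sup>2"
    by (simp add: power_mult_distrib hsn_power2 flip: exp_double)
  finally have "sqrt (hsp n (z t) (z t)) \<le> 2 * exp (- (\<epsilon> / 3) * t) * hsn n (z 0)"
    by (intro real_le_lsqrt) (simp_all add: hsn_nonneg hsp_self_nonneg)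
  then show ?thesis unfolding hsn_def[of n "z t"] .
qed

end

section \<open>Exponentials of linear maps on matrices\<close>

text \<open>
  Submultiplicative and bounded below by each entry, which is all that the exponential
  series requires.
\<close>
definition norm1 :: "nat \<Rightarrow> complex mat \<Rightarrow> real" where
  "norm1 n X = (\<Sum>i<n. \<Sum>j<n. cmod (X $$ (i, j)))"

lemma norm1_nonneg: "0 \<le> norm1 n X"
  by (simp add: norm1_def sum_nonneg)

lemma entry_le_norm1: "i < n \<Longrightarrow> j < n \<Longrightarrow> cmod (X $$ (i, j)) \<le> norm1 n X"
  unfolding norm1_def
  by (rule order_trans[OF member_le_sum[of j "{..<n}" "\<lambda>j. cmod (X $$ (i, j))"]
        member_le_sum[of i "{..<n}" "\<lambda>i. \<Sum>j<n. cmod (X $$ (i, j))"]])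
     (auto intro: sum_nonneg)

lemma norm1_add: "X \<in> carrier_mat n n \<Longrightarrow> Y \<in> carrier_mat n n \<Longrightarrow> norm1 n (X + Y) \<le> norm1 n X + norm1 n Y"
  unfolding norm1_def sum.distrib[symmetric] by (intro sum_mono) (auto intro: norm_triangle_ineq)

lemma norm1_minus: "X \<in> carrier_mat n n \<Longrightarrow> Y \<in> carrier_mat n n \<Longrightarrow> norm1 n (X - Y) \<le> norm1 n X + norm1 n Y"
  unfolding norm1_def sum.distrib[symmetric] by (intro sum_mono) (auto intro: norm_triangle_ineq4)

lemma norm1_uminus: "X \<in> carrier_mat n n \<Longrightarrow> norm1 n (- X) = norm1 n X"
  unfolding norm1_def by (intro sum.cong refl) auto

lemma norm1_smult: "X \<in> carrier_mat n n \<Longrightarrow> norm1 n (a \<cdot>\<^sub>m X) = cmod a * norm1 n X"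
  unfolding norm1_def sum_distrib_left by (intro sum.cong refl) (auto simp: norm_mult)

lemma norm1_mult:
  assumes X: "X \<in> carrier_mat n n" and Y: "Y \<in> carrier_mat n n"
  shows "norm1 n (X * Y) \<le> norm1 n X * norm1 n Y"
proof -
  have "norm1 n (X * Y) = (\<Sum>i<n. \<Sum>j<n. cmod (\<Sum>k<n. X $$ (i, k) * Y $$ (k, j)))"
    unfolding norm1_def using X Y by (intro sum.cong refl) (auto simp: scalar_prod_def lessThan_atLeast0)
  also have "\<dots> \<le> (\<Sum>i<n. \<Sum>j<n. \<Sum>k<n. cmod (X $$ (i, k)) * cmod (Y $$ (k, j)))"
    by (intro sum_mono order_trans[OF norm_sum]) (simp add: norm_mult)
  also have "\<dots> = (\<Sum>i<n. \<Sum>k<n. cmod (X $$ (i, k)) * (\<Sum>j<n. cmod (Y $$ (k, j))))"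
    unfolding sum_distrib_left by (rule sum.cong[OF refl], rule sum.swap)
  also have "\<dots> \<le> (\<Sum>i<n. \<Sum>k<n. cmod (X $$ (i, k)) * norm1 n Y)"
    unfolding norm1_def
    by (intro sum_mono mult_left_mono member_le_sum[of _ "{..<n}" "\<lambda>i. \<Sum>j<n. cmod (Y $$ (i, j))"])
       (auto intro: sum_nonneg)
  also have "\<dots> = norm1 n X * norm1 n Y" by (simp add: norm1_def sum_distrib_right)
  finally show ?thesis .
qed

definition mtendsto :: "nat \<Rightarrow> (nat \<Rightarrow> complex mat) \<Rightarrow> complex mat \<Rightarrow> bool" where
  "mtendsto n X Y \<longleftrightarrow> (\<forall>i<n. \<forall>j<n. (\<lambda>N. X N $$ (i, j)) \<longlonglongrightarrow> Y $$ (i, j))"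

lemma mtendsto_norm1:
  assumes "mtendsto n X Y" "\<And>N. X N \<in> carrier_mat n n" "Y \<in> carrier_mat n n"
  shows "(\<lambda>N. norm1 n (X N - Y)) \<longlonglongrightarrow> 0"
proof -
  have "(\<lambda>N. norm1 n (X N - Y)) = (\<lambda>N. \<Sum>i<n. \<Sum>j<n. cmod (X N $$ (i, j) - Y $$ (i, j)))"
    unfolding norm1_def using assms(2,3) by (intro ext sum.cong refl) auto
  moreover have "(\<lambda>N. \<Sum>i<n. \<Sum>j<n. cmod (X N $$ (i, j) - Y $$ (i, j))) \<longlonglongrightarrow> 0"
    using assms(1) unfolding mtendsto_def
    by (intro tendsto_null_sum tendsto_norm_zero LIM_zero) auto
  ultimately show ?thesis by simp
qed

lemma mtendsto_iff_norm1:
  assumes "\<And>N. X N \<in> carrier_mat n n" "Y \<in> carrier_mat n n"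
  shows "mtendsto n X Y \<longleftrightarrow> (\<lambda>N. norm1 n (X N - Y)) \<longlonglongrightarrow> 0"
proof
  assume *: "(\<lambda>N. norm1 n (X N - Y)) \<longlonglongrightarrow> 0"
  show "mtendsto n X Y"
    unfolding mtendsto_def
  proof (intro allI impI)
    fix i j assume ij: "i < n" "j < n"
    show "(\<lambda>N. X N $$ (i, j)) \<longlonglongrightarrow> Y $$ (i, j)"
    proof (rule LIM_zero_cancel, rule Lim_null_comparison[OF _ *], rule always_eventually, rule allI)
      fix N
      show "cmod (X N $$ (i, j) - Y $$ (i, j)) \<le> norm1 n (X N - Y)"
        using entry_le_norm1[OF ij, of "X N - Y"] ij assms(2) by simp
    qed
  qed
qed (rule mtendsto_norm1[OF _ assms])

text \<open>
  The constant \<open>B\<close> is a parameter since a uniform bound for a whole family of maps is what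
  dominates the series in the Euler product.
\<close>
locale superop =
  fixes n :: nat and F :: "complex mat \<Rightarrow> complex mat" and B :: real
  assumes linear: "linear_superop n F"
    and B_nonneg: "0 \<le> B"
    and bounded: "X \<in> carrier_mat n n \<Longrightarrow> norm1 n (F X) \<le> B * norm1 n X"
begin

lemma closed: "X \<in> carrier_mat n n \<Longrightarrow> F X \<in> carrier_mat n n"
  and add: "X \<in> carrier_mat n n \<Longrightarrow> Y \<in> carrier_mat n n \<Longrightarrow> F (X + Y) = F X + F Y"
  and smult: "X \<in> carrier_mat n n \<Longrightarrow> F (a \<cdot>\<^sub>m X) = a \<cdot>\<^sub>m F X"
  using linear unfolding linear_superop_def by blast+

lemma zero: "F (0\<^sub>m n n) = 0\<^sub>m n n"
proof -
  have "F (0\<^sub>m n n) = 0 \<cdot>\<^sub>m F (0\<^sub>m n n)" using smult[of "0\<^sub>m n n" 0] by simp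
  also have "\<dots> = 0\<^sub>m n n" using closed[of "0\<^sub>m n n"] by (intro eq_matI) auto
  finally show ?thesis .
qed

lemma minus:
  assumes "X \<in> carrier_mat n n" "Y \<in> carrier_mat n n"
  shows "F (X - Y) = F X - F Y"
proof -
  have "X - Y = X + (- 1) \<cdot>\<^sub>m Y" using assms by (intro eq_matI) auto
  then have "F (X - Y) = F X + (- 1) \<cdot>\<^sub>m F Y" using assms by (simp add: add smult)
  also have "\<dots> = F X - F Y" using closed[OF assms(1)] closed[OF assms(2)] by (intro eq_matI) auto
  finally show ?thesis .
qed

lemma pow_closed: "X \<in> carrier_mat n n \<Longrightarrow> (F ^^ k) X \<in> carrier_mat n n"
  by (induction k) (auto intro: closed)

lemma pow_add: "X \<in> carrier_mat n n \<Longrightarrow> Y \<in> carrier_mat n n \<Longrightarrow> (F ^^ k) (X + Y) = (F ^^ k) X + (F ^^ k) Y"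
  by (induction k) (auto simp: add pow_closed)

lemma pow_smult: "X \<in> carrier_mat n n \<Longrightarrow> (F ^^ k) (a \<cdot>\<^sub>m X) = a \<cdot>\<^sub>m (F ^^ k) X"
  by (induction k) (auto simp: smult pow_closed)

lemma pow_bounded: "X \<in> carrier_mat n n \<Longrightarrow> norm1 n ((F ^^ k) X) \<le> B ^ k * norm1 n X"
proof (induction k)
  case (Suc k)
  have "norm1 n ((F ^^ Suc k) X) \<le> B * norm1 n ((F ^^ k) X)" using Suc by (simp add: bounded pow_closed)
  also have "\<dots> \<le> B * (B ^ k * norm1 n X)" using Suc B_nonneg by (intro mult_left_mono) auto
  finally show ?case by (simp add: mult.assoc)
qed simp

lemma tendsto_superop:
  assumes "mtendsto n X Y" "\<And>N. X N \<in> carrier_mat n n" "Y \<in> carrier_mat n n"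
  shows "mtendsto n (\<lambda>N. F (X N)) (F Y)"
proof (subst mtendsto_iff_norm1)
  show "(\<lambda>N. norm1 n (F (X N) - F Y)) \<longlonglongrightarrow> 0"
  proof (rule Lim_null_comparison[OF _ tendsto_mult_right_zero[OF mtendsto_norm1[OF assms]]])
    show "\<forall>\<^sub>F N in sequentially. norm (norm1 n (F (X N) - F Y)) \<le> B * norm1 n (X N - Y)"
    proof (intro always_eventually allI)
      fix N
      have "norm1 n (F (X N - Y)) \<le> B * norm1 n (X N - Y)" using assms by (intro bounded) auto
      then show "norm (norm1 n (F (X N) - F Y)) \<le> B * norm1 n (X N - Y)"
        using assms by (simp add: minus norm1_nonneg)
    qed
  qed
qed (use assms closed in auto)

definition coef :: "complex mat \<Rightarrow> nat \<Rightarrow> nat \<Rightarrow> nat \<Rightarrow> complex" where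
  "coef X i j k = ((F ^^ k) X) $$ (i, j) / fact k"

lemma coef_bound:
  assumes "X \<in> carrier_mat n n" "i < n" "j < n"
  shows "cmod (coef X i j k * z ^ k) \<le> inverse (fact k) * (B * cmod z) ^ k * norm1 n X"
proof -
  have "cmod (((F ^^ k) X) $$ (i, j)) \<le> B ^ k * norm1 n X"
    using entry_le_norm1[OF assms(2,3)] pow_bounded[OF assms(1)] order_trans by blast
  then have "inverse (fact k) * cmod z ^ k * cmod (((F ^^ k) X) $$ (i, j))
     \<le> inverse (fact k) * cmod z ^ k * (B ^ k * norm1 n X)"
    by (intro mult_left_mono) auto
  then show ?thesis
    by (simp add: coef_def norm_mult norm_divide norm_power power_mult_distrib field_simps)
qed

lemma coef_summable:
  assumes "X \<in> carrier_mat n n" "i < n" "j < n"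
  shows "summable (\<lambda>k. coef X i j k * z ^ k)"
  by (rule summable_comparison_test'[OF summable_mult2[OF summable_exp] coef_bound[OF assms]])

lemma exp_entry:
  assumes "i < n" "j < n"
  shows "semigroup_exp n F t X $$ (i, j) = (\<Sum>k. coef X i j k * complex_of_real t ^ k)"
  using assms by (simp add: semigroup_exp_def coef_def mult.commute)

lemma exp_closed: "semigroup_exp n F t X \<in> carrier_mat n n"
  by (simp add: semigroup_exp_def)

lemma exp_dim [simp]: "dim_row (semigroup_exp n F t X) = n" "dim_col (semigroup_exp n F t X) = n"
  by (simp_all add: semigroup_exp_def)

lemma exp_zero: "X \<in> carrier_mat n n \<Longrightarrow> semigroup_exp n F 0 X = X"
proof (rule eq_matI)
  fix i j assume "X \<in> carrier_mat n n" "i < dim_row X" "j < dim_col X"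
  then show "semigroup_exp n F 0 X $$ (i, j) = X $$ (i, j)"
    using powser_zero[of "coef X i j"] by (simp add: exp_entry coef_def)
qed (auto simp: semigroup_exp_def)

lemma exp_linear: "linear_superop n (semigroup_exp n F t)"
  unfolding linear_superop_def
proof (intro conjI ballI allI)
  fix X Y :: "complex mat" assume X: "X \<in> carrier_mat n n" and Y: "Y \<in> carrier_mat n n"
  show "semigroup_exp n F t (X + Y) = semigroup_exp n F t X + semigroup_exp n F t Y"
  proof (rule eq_matI)
    fix i j assume "i < dim_row (semigroup_exp n F t X + semigroup_exp n F t Y)"
      "j < dim_col (semigroup_exp n F t X + semigroup_exp n F t Y)"
    then have ij: "i < n" "j < n" by auto
    have "coef (X + Y) i j k * z = coef X i j k * z + coef Y i j k * z" for k z
      using ij X Y carrier_matD[OF pow_closed[OF X, of k]] carrier_matD[OF pow_closed[OF Y, of k]]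
      by (simp add: coef_def pow_add add_divide_distrib distrib_right)
    with ij show "semigroup_exp n F t (X + Y) $$ (i, j) = (semigroup_exp n F t X + semigroup_exp n F t Y) $$ (i, j)"
      by (simp add: exp_entry suminf_add[OF coef_summable[OF X ij] coef_summable[OF Y ij], symmetric])
  qed auto
next
  fix a and X :: "complex mat" assume X: "X \<in> carrier_mat n n"
  show "semigroup_exp n F t (a \<cdot>\<^sub>m X) = a \<cdot>\<^sub>m semigroup_exp n F t X"
  proof (rule eq_matI)
    fix i j assume "i < dim_row (a \<cdot>\<^sub>m semigroup_exp n F t X)"
      "j < dim_col (a \<cdot>\<^sub>m semigroup_exp n F t X)"
    then have ij: "i < n" "j < n" by auto
    have "coef (a \<cdot>\<^sub>m X) i j k = a * coef X i j k" for k
      using ij X carrier_matD[OF pow_closed[OF X, of k]] by (simp add: coef_def pow_smult)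
    with ij show "semigroup_exp n F t (a \<cdot>\<^sub>m X) $$ (i, j) = (a \<cdot>\<^sub>m semigroup_exp n F t X) $$ (i, j)"
      by (simp add: exp_entry mult.assoc suminf_mult[OF coef_summable[OF X ij]])
  qed auto
qed (rule exp_closed)

text \<open>
  The map commutes with the partial sums of the series, and it is continuous for entrywise
  convergence.
\<close>
lemma exp_superop_commute:
  assumes X: "X \<in> carrier_mat n n"
  shows "semigroup_exp n F t (F X) = F (semigroup_exp n F t X)"
proof -
  define P where "P Z N = mat n n (\<lambda>(i, j). \<Sum>k<N. coef Z i j k * complex_of_real t ^ k)" for Z N
  have P_closed: "P Z N \<in> carrier_mat n n" for Z N by (simp add: P_def)
  have lim: "mtendsto n (P Z) (semigroup_exp n F t Z)" if "Z \<in> carrier_mat n n" for Z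
    unfolding mtendsto_def using summable_LIMSEQ[OF coef_summable[OF that]] by (simp add: P_def exp_entry)
  have P_Suc: "P Z (Suc N) = P Z N + (complex_of_real t ^ N / fact N) \<cdot>\<^sub>m (F ^^ N) Z"
    if "Z \<in> carrier_mat n n" for Z N
    using carrier_matD[OF pow_closed[OF that, of N]]
    by (intro eq_matI) (auto simp: P_def coef_def mult.commute)
  have "F (P X N) = P (F X) N" for N
  proof (induction N)
    case 0
    have "P Z 0 = 0\<^sub>m n n" for Z by (auto simp: P_def)
    then show ?case by (simp add: zero)
  next
    case (Suc N)
    then show ?case
      using X pow_closed[OF X, of N] P_closed
      by (simp add: P_Suc closed add smult funpow_swap1)
  qed
  then have "mtendsto n (P (F X)) (F (semigroup_exp n F t X))"
    using tendsto_superop[OF lim[OF X] P_closed exp_closed] by simp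
  with lim[OF closed[OF X]] have "semigroup_exp n F t (F X) $$ (i, j) = F (semigroup_exp n F t X) $$ (i, j)"
    if "i < n" "j < n" for i j
    using that LIMSEQ_unique unfolding mtendsto_def by blast
  then show ?thesis
    using carrier_matD[OF closed[OF exp_closed[of t X]]] by (intro eq_matI) auto
qed

text \<open>
  The term-by-term derivative of the series for \<open>X\<close> is the series for \<open>F X\<close>, by a shift of
  the index.
\<close>
lemma exp_has_derivative:
  assumes X: "X \<in> carrier_mat n n" and ij: "i < n" "j < n"
  shows "((\<lambda>t. semigroup_exp n F t X $$ (i, j)) has_vector_derivative F (semigroup_exp n F t X) $$ (i, j)) (at t)"
proof -
  have "diffs (coef X i j) = coef (F X) i j"
  proof
    fix k
    have "((F ^^ Suc k) X) $$ (i, j) = ((F ^^ k) (F X)) $$ (i, j)"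
      by (simp only: funpow_Suc_right o_apply)
    then show "diffs (coef X i j) k = coef (F X) i j k"
      by (simp add: diffs_def coef_def field_simps del: funpow.simps of_nat_Suc)
  qed
  then have "((\<lambda>z. \<Sum>k. coef X i j k * z ^ k) has_field_derivative F (semigroup_exp n F t X) $$ (i, j)) (at (complex_of_real t))"
    using termdiffs_strong_converges_everywhere[OF coef_summable[OF X ij], of "complex_of_real t"] ij
    by (simp add: exp_entry flip: exp_superop_commute[OF X])
  from has_vector_derivative_real_field[OF this] ij show ?thesis
    by (simp add: exp_entry)
qed

lemma exp_fixed:
  assumes X: "X \<in> carrier_mat n n" and "F X = 0\<^sub>m n n"
  shows "semigroup_exp n F t X = X"
proof (rule eq_matI)
  fix i j assume "i < dim_row X" "j < dim_col X"
  then have ij: "i < n" "j < n" using X by auto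
  have p0: "(F ^^ k) (0\<^sub>m n n) = 0\<^sub>m n n" for k by (induction k) (auto simp: zero)
  have "((F ^^ Suc k) X) $$ (i, j) = 0" for k
    unfolding funpow_Suc_right o_apply assms(2) p0 using ij by simp
  then have "coef X i j k * complex_of_real t ^ k = 0" if "k \<notin> {0}" for k
    using that unfolding coef_def by (cases k) auto
  from suminf_finite[of "{0}" "\<lambda>k. coef X i j k * complex_of_real t ^ k", OF _ this] ij show "semigroup_exp n F t X $$ (i, j) = X $$ (i, j)"
    by (simp add: exp_entry coef_def)
qed (use X in \<open>auto simp: semigroup_exp_def\<close>)

lemma mtrace_exp:
  assumes X: "X \<in> carrier_mat n n" and tr: "\<And>Z. Z \<in> carrier_mat n n \<Longrightarrow> mtrace (F Z) = 0"
  shows "mtrace (semigroup_exp n F t X) = mtrace X"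
proof -
  have "((\<lambda>t. mtrace (semigroup_exp n F t X)) has_vector_derivative 0) (at t)" for t
  proof -
    have "((\<lambda>t. \<Sum>i<n. semigroup_exp n F t X $$ (i, i)) has_vector_derivative
       (\<Sum>i<n. F (semigroup_exp n F t X) $$ (i, i))) (at t)"
      by (intro has_vector_derivative_sum exp_has_derivative X) auto
    also have "(\<Sum>i<n. F (semigroup_exp n F t X) $$ (i, i)) = 0"
      using tr[OF exp_closed[of t X]] carrier_matD[OF closed[OF exp_closed[of t X]]] by (simp add: mtrace_def)
    finally show ?thesis by (simp add: mtrace_def)
  qed
  then have "\<And>s. s \<in> UNIV \<Longrightarrow> ((\<lambda>t. mtrace (semigroup_exp n F t X)) has_vector_derivative 0) (at s within UNIV)" by simp
  from has_vector_derivative_zero_constant[OF convex_UNIV this] obtain c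
    where "\<And>t. mtrace (semigroup_exp n F t X) = c" by auto
  then show ?thesis using exp_zero[OF X] by metis
qed

text \<open>
  The binomial formula for the commuting maps \<open>id\<close> and \<open>F\<close>.
\<close>
lemma euler_step_binomial:
  assumes "X \<in> carrier_mat n n" "i < n" "j < n"
  shows "(((\<lambda>Z. Z + a \<cdot>\<^sub>m F Z) ^^ m) X) $$ (i, j) = (\<Sum>k\<le>m. of_nat (m choose k) * a ^ k * ((F ^^ k) X) $$ (i, j))"
  using assms(1)
proof (induction m arbitrary: X)
  case (Suc m)
  define f where "f k = ((F ^^ k) X) $$ (i, j)" for k
  have FX: "F X \<in> carrier_mat n n" using Suc by (simp add: closed)
  have e: "((F ^^ k) (X + a \<cdot>\<^sub>m F X)) $$ (i, j) = f k + a * f (Suc k)" for k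
    using Suc.prems FX pow_closed[OF Suc.prems, of k] pow_closed[OF FX, of k] assms(2,3)
    by (simp add: pow_add pow_smult f_def funpow_swap1)
  have "(((\<lambda>Z. Z + a \<cdot>\<^sub>m F Z) ^^ Suc m) X) $$ (i, j) = (((\<lambda>Z. Z + a \<cdot>\<^sub>m F Z) ^^ m) (X + a \<cdot>\<^sub>m F X)) $$ (i, j)"
    by (simp only: funpow_Suc_right o_apply)
  also have "\<dots> = (\<Sum>k\<le>m. of_nat (m choose k) * a ^ k * (f k + a * f (Suc k)))"
    using Suc FX by (subst Suc.IH) (simp_all add: e)
  also have "\<dots> = (\<Sum>k\<le>m. of_nat (m choose k) * a ^ k * f k) + (\<Sum>k\<le>m. of_nat (m choose k) * a ^ Suc k * f (Suc k))"
    unfolding sum.distrib[symmetric] by (intro sum.cong refl) (simp add: algebra_simps)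
  also have "(\<Sum>k\<le>m. of_nat (m choose k) * a ^ k * f k) = (\<Sum>k\<le>Suc m. of_nat (m choose k) * a ^ k * f k)"
    by simp
  also have "\<dots> = f 0 + (\<Sum>k\<le>m. of_nat (m choose Suc k) * a ^ Suc k * f (Suc k))"
    by (subst sum.atMost_Suc_shift) simp
  also have "f 0 + (\<Sum>k\<le>m. of_nat (m choose Suc k) * a ^ Suc k * f (Suc k)) + (\<Sum>k\<le>m. of_nat (m choose k) * a ^ Suc k * f (Suc k))
     = f 0 + (\<Sum>k\<le>m. of_nat (Suc m choose Suc k) * a ^ Suc k * f (Suc k))"
    unfolding add.assoc sum.distrib[symmetric] by (intro arg_cong2[of _ _ _ _ "(+)"] sum.cong refl) (simp add: algebra_simps)
  also have "\<dots> = (\<Sum>k\<le>Suc m. of_nat (Suc m choose k) * a ^ k * f k)"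
    by (subst sum.atMost_Suc_shift) simp
  finally show ?case by (simp only: f_def)
qed simp

end

lemma binomial_over_power_tendsto:
  "(\<lambda>N. real (N choose k) / real N ^ k) \<longlonglongrightarrow> inverse (fact k)"
proof (rule Lim_transform_eventually)
  have "(\<lambda>N. (\<Prod>i<k. 1 - real i * inverse (real N)) / fact k) \<longlonglongrightarrow> (\<Prod>i<k. 1 - real i * 0) / fact k"
    by (intro tendsto_intros tendsto_inverse_0_at_top filterlim_real_sequentially) auto
  then show "(\<lambda>N. (\<Prod>i<k. 1 - real i * inverse (real N)) / fact k) \<longlonglongrightarrow> inverse (fact k)"
    by (simp add: inverse_eq_divide)
  show "\<forall>\<^sub>F N in sequentially. (\<Prod>i<k. 1 - real i * inverse (real N)) / fact k = real (N choose k) / real N ^ k"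
    using eventually_gt_at_top[of 0]
  proof eventually_elim
    case (elim N)
    have "real (N choose k) = (\<Prod>i<k. real N - real i) / fact k"
      by (simp add: binomial_gbinomial gbinomial_prod_rev lessThan_atLeast0)
    also have "(\<Prod>i<k. real N - real i) = (\<Prod>i<k. real N * (1 - real i * inverse (real N)))"
      using elim by (intro prod.cong refl) (simp add: field_simps)
    also have "\<dots> = real N ^ k * (\<Prod>i<k. 1 - real i * inverse (real N))"
      by (simp add: prod.distrib)
    finally show ?case using elim by simp
  qed
qed

lemma superop_pow_tendsto:
  assumes F: "superop n F B" and FN: "\<And>N. superop n (FN N) B"
    and lim: "\<And>X. X \<in> carrier_mat n n \<Longrightarrow> mtendsto n (\<lambda>N. FN N X) (F X)"
    and X: "X \<in> carrier_mat n n"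
  shows "mtendsto n (\<lambda>N. (FN N ^^ k) X) ((F ^^ k) X)"
proof (induction k)
  case 0
  show ?case by (simp add: mtendsto_def)
next
  case (Suc k)
  note c = superop.closed[OF F] superop.closed[OF FN] superop.pow_closed[OF F X] superop.pow_closed[OF FN X]
  have "(\<lambda>N. B * norm1 n ((FN N ^^ k) X - (F ^^ k) X) + norm1 n (FN N ((F ^^ k) X) - F ((F ^^ k) X))) \<longlonglongrightarrow> B * 0 + 0"
    by (intro tendsto_add tendsto_mult tendsto_const mtendsto_norm1 Suc lim c)
  then have l: "(\<lambda>N. B * norm1 n ((FN N ^^ k) X - (F ^^ k) X) + norm1 n (FN N ((F ^^ k) X) - F ((F ^^ k) X))) \<longlonglongrightarrow> 0"
    by simp
  show ?case
  proof (subst mtendsto_iff_norm1)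
    show "(\<lambda>N. norm1 n ((FN N ^^ Suc k) X - (F ^^ Suc k) X)) \<longlonglongrightarrow> 0"
    proof (rule Lim_null_comparison[OF _ l], intro always_eventually allI)
      fix N
      let ?a = "(FN N ^^ k) X" and ?b = "(F ^^ k) X"
      have "FN N ?a - F ?b = FN N (?a - ?b) + (FN N ?b - F ?b)"
        using c(1)[OF c(3), of k] c(2)[OF c(3), of N k] c(2)[OF c(4), of N N k] c(3)[of k] c(4)[of N k]
        by (simp add: superop.minus[OF FN c(4) c(3)]) (intro eq_matI, auto)
      also have "norm1 n \<dots> \<le> norm1 n (FN N (?a - ?b)) + norm1 n (FN N ?b - F ?b)"
        by (intro norm1_add minus_carrier_mat c)
      also have "\<dots> \<le> B * norm1 n (?a - ?b) + norm1 n (FN N ?b - F ?b)"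
        by (intro add_right_mono superop.bounded[OF FN] minus_carrier_mat c)
      finally show "norm (norm1 n ((FN N ^^ Suc k) X - (F ^^ Suc k) X))
         \<le> B * norm1 n (?a - ?b) + norm1 n (FN N ?b - F ?b)" by (simp add: norm1_nonneg)
    qed
  qed (use c in auto)
qed

text \<open>
  Each term of the binomial expansion of the \<open>N\<close>-th power converges to the corresponding
  term of the exponential series. Since \<open>binomial N k / N ^ k \<le> 1 / fact k\<close>, the terms are
  dominated by those of \<open>exp (B |t|)\<close>, and Tannery's theorem applies. Letting the generator
  vary with \<open>N\<close> absorbs the second-order error of the Euler step.
\<close>
theorem euler_product_tendsto_exp:
  assumes F: "superop n F B" and FN: "\<And>N. superop n (FN N) B"
    and lim: "\<And>X. X \<in> carrier_mat n n \<Longrightarrow> mtendsto n (\<lambda>N. FN N X) (F X)"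
    and X: "X \<in> carrier_mat n n"
  shows "mtendsto n (\<lambda>N. ((\<lambda>Z. Z + complex_of_real (t / real N) \<cdot>\<^sub>m FN N Z) ^^ N) X) (semigroup_exp n F t X)"
  unfolding mtendsto_def
proof (intro allI impI)
  fix i j assume ij: "i < n" "j < n"
  interpret superop n F B by fact
  define a where "a k N = complex_of_real (real (N choose k) / real N ^ k) * (complex_of_real t ^ k * ((FN N ^^ k) X) $$ (i, j))" for k N
  define b where "b k = complex_of_real (inverse (fact k)) * (complex_of_real t ^ k * ((F ^^ k) X) $$ (i, j))" for k
  have "(\<lambda>N. a k N) \<longlonglongrightarrow> b k" for k
    unfolding a_def b_def
    using superop_pow_tendsto[OF F FN lim X, of k] ij
    by (intro tendsto_mult tendsto_const tendsto_of_real binomial_over_power_tendsto) (simp add: mtendsto_def)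
  moreover have "\<forall>\<^sub>F (k, N) in at_top \<times>\<^sub>F sequentially. norm (a k N) \<le> inverse (fact k) * (B * \<bar>t\<bar>) ^ k * norm1 n X"
  proof -
    have "norm (a k N) \<le> inverse (fact k) * (B * \<bar>t\<bar>) ^ k * norm1 n X" if "N > 0" for k N
    proof -
      have "real (N choose k) * fact k \<le> real N ^ k"
        using of_nat_mono[OF binomial_fact_pow[of N k], where 'a = real] by simp
      then have 1: "real (N choose k) / real N ^ k \<le> inverse (fact k)"
        using that by (simp add: field_simps)
      have 2: "cmod (((FN N ^^ k) X) $$ (i, j)) \<le> B ^ k * norm1 n X"
        using entry_le_norm1[OF ij] superop.pow_bounded[OF FN X] order_trans by blast
      have "norm (a k N) = real (N choose k) / real N ^ k * (\<bar>t\<bar> ^ k * cmod (((FN N ^^ k) X) $$ (i, j)))"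
        by (simp add: a_def norm_mult norm_power norm_divide)
      also have "\<dots> \<le> inverse (fact k) * (\<bar>t\<bar> ^ k * (B ^ k * norm1 n X))"
        by (intro mult_mono 1 2) auto
      finally show ?thesis by (simp add: power_mult_distrib mult_ac)
    qed
    moreover have "\<forall>\<^sub>F (k :: nat, N :: nat) in at_top \<times>\<^sub>F sequentially. N > 0"
      using eventually_gt_at_top[of "0 :: nat"] by (subst eventually_prod2) auto
    ultimately show ?thesis by (auto elim!: eventually_mono)
  qed
  moreover have "summable (\<lambda>k. inverse (fact k) * (B * \<bar>t\<bar>) ^ k * norm1 n X)"
    by (intro summable_mult2 summable_exp)
  ultimately have "(\<lambda>N. \<Sum>k. a k N) \<longlonglongrightarrow> (\<Sum>k. b k)"
    using tannerys_theorem[of a b sequentially] by simp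
  moreover have "(\<Sum>k. b k) = semigroup_exp n F t X $$ (i, j)"
    using ij by (simp add: b_def exp_entry coef_def field_simps)
  moreover have "(\<Sum>k. a k N) = (((\<lambda>Z. Z + complex_of_real (t / real N) \<cdot>\<^sub>m FN N Z) ^^ N) X) $$ (i, j)" for N
  proof -
    have "(\<Sum>k. a k N) = (\<Sum>k\<le>N. a k N)"
      by (rule suminf_finite) (auto simp: a_def)
    also have "\<dots> = (\<Sum>k\<le>N. of_nat (N choose k) * complex_of_real (t / real N) ^ k * ((FN N ^^ k) X) $$ (i, j))"
      by (intro sum.cong refl) (simp add: a_def power_divide)
    finally show ?thesis by (simp add: superop.euler_step_binomial[OF FN X ij])
  qed
  ultimately show "(\<lambda>N. (((\<lambda>Z. Z + complex_of_real (t / real N) \<cdot>\<^sub>m FN N Z) ^^ N) X) $$ (i, j)) \<longlonglongrightarrow> semigroup_exp n F t X $$ (i, j)"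
    by simp
qed

section \<open>Complete positivity\<close>

lemma quadratic_form:
  assumes "M \<in> carrier_mat m m" "v \<in> carrier_vec m"
  shows "(M *\<^sub>v v) \<bullet>c v = (\<Sum>r<m. \<Sum>s<m. cnj (v $ r) * M $$ (r, s) * (v $ s :: complex))"
  using assms
  by (auto simp: scalar_prod_def lessThan_atLeast0 sum_distrib_right sum_distrib_left mult_ac intro!: sum.cong)

lemma positive_matI:
  assumes "M \<in> carrier_mat m m"
    and "\<And>v. v \<in> carrier_vec m \<Longrightarrow> 0 \<le> (\<Sum>r<m. \<Sum>s<m. cnj (v $ r) * M $$ (r, s) * v $ s)"
  shows "positive_mat m M"
  using assms unfolding positive_mat_def by (simp add: quadratic_form)

lemma positive_matD:
  assumes "positive_mat m M"
  shows "M \<in> carrier_mat m m"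
    and "0 \<le> (\<Sum>r<m. \<Sum>s<m. cnj (w r) * M $$ (r, s) * w s)"
proof -
  show M: "M \<in> carrier_mat m m" using assms by (simp add: positive_mat_def)
  have "0 \<le> (M *\<^sub>v vec m w) \<bullet>c vec m w" using assms by (simp add: positive_mat_def)
  also have "\<dots> = (\<Sum>r<m. \<Sum>s<m. cnj (w r) * M $$ (r, s) * w s)"
    by (subst quadratic_form[OF M]) auto
  finally show "0 \<le> (\<Sum>r<m. \<Sum>s<m. cnj (w r) * M $$ (r, s) * w s)" .
qed

definition block :: "nat \<Rightarrow> complex mat \<Rightarrow> nat \<Rightarrow> nat \<Rightarrow> complex mat" where
  "block n M a b = mat n n (\<lambda>(i, j). M $$ (a * n + i, b * n + j))"

lemma block_closed [simp]: "block n M a b \<in> carrier_mat n n"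
  by (simp add: block_def)

lemma ampliation_closed: "ampliation n k F M \<in> carrier_mat (k * n) (k * n)"
  by (simp add: ampliation_def)

lemma block_index: "a < k \<Longrightarrow> i < n \<Longrightarrow> a * n + i < k * (n :: nat)"
proof -
  assume "a < k" "i < n"
  then have "a * n + i < Suc a * n" by simp
  also have "\<dots> \<le> k * n" using \<open>a < k\<close> by (intro mult_le_mono1) simp
  finally show ?thesis .
qed

lemma ampliation_entry:
  assumes "r < k * n" "s < k * n"
  shows "ampliation n k F M $$ (r, s) = F (block n M (r div n) (s div n)) $$ (r mod n, s mod n)"
  using assms by (simp add: ampliation_def block_def)

lemma ampliation_block_entry:
  assumes "a < k" "b < k" "i < n" "j < n"
  shows "ampliation n k F M $$ (a * n + i, b * n + j) = F (block n M a b) $$ (i, j)"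
  using assms by (subst ampliation_entry) (auto intro: block_index)

lemma sum_blocks:
  fixes f :: "nat \<Rightarrow> 'a::comm_monoid_add"
  shows "(\<Sum>r<k * n. f r) = (\<Sum>a<k. \<Sum>i<n. f (a * n + i))"
proof -
  have "(\<Sum>a<k. \<Sum>i<n. f (a * n + i)) = (\<Sum>a<k. sum f {a * n..<a * n + n})"
  proof (rule sum.cong[OF refl])
    fix a
    show "(\<Sum>i<n. f (a * n + i)) = sum f {a * n..<a * n + n}"
      by (rule sum.reindex_bij_witness[of _ "\<lambda>r. r - a * n" "\<lambda>i. a * n + i"]) auto
  qed
  then show ?thesis by (simp add: sum.nat_group)
qed

text \<open>
  The positivity half of complete positivity, kept apart from linearity because it is what
  passes to compositions, sums and limits.
\<close>
definition ampliation_positive :: "nat \<Rightarrow> (complex mat \<Rightarrow> complex mat) \<Rightarrow> bool" where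
  "ampliation_positive n F \<longleftrightarrow>
     (\<forall>k M. positive_mat (k * n) M \<longrightarrow> positive_mat (k * n) (ampliation n k F M))"

lemma ampliation_positive_cong:
  assumes "\<And>X. X \<in> carrier_mat n n \<Longrightarrow> F X = G X"
  shows "ampliation_positive n F \<longleftrightarrow> ampliation_positive n G"
  using assms unfolding ampliation_positive_def ampliation_def by simp

lemma ampliation_positive_comp:
  assumes F: "ampliation_positive n F" and G: "ampliation_positive n G"
    and c: "\<And>X. X \<in> carrier_mat n n \<Longrightarrow> G X \<in> carrier_mat n n"
  shows "ampliation_positive n (\<lambda>X. F (G X))"
  unfolding ampliation_positive_def
proof (intro allI impI)
  fix k M assume M: "positive_mat (k * n) M"
  have "block n (ampliation n k G M) a b = G (block n M a b)" if "a < k" "b < k" for a b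
    using carrier_matD[OF c[OF block_closed[of n M a b]]] that
    by (intro eq_matI) (auto simp: block_def[of n "ampliation n k G M"] ampliation_block_entry)
  then have "ampliation n k (\<lambda>X. F (G X)) M = ampliation n k F (ampliation n k G M)"
    by (intro eq_matI) (auto simp: ampliation_entry ampliation_closed[THEN carrier_matD(1)]
        ampliation_closed[THEN carrier_matD(2)] less_mult_imp_div_less)
  with F G M show "positive_mat (k * n) (ampliation n k (\<lambda>X. F (G X)) M)"
    unfolding ampliation_positive_def by simp
qed

lemma ampliation_positive_funpow:
  assumes "ampliation_positive n F" "\<And>X. X \<in> carrier_mat n n \<Longrightarrow> F X \<in> carrier_mat n n"
  shows "ampliation_positive n (F ^^ m)"
proof (induction m)
  case 0
  have "ampliation n k (\<lambda>X. X) M = M" if "M \<in> carrier_mat (k * n) (k * n)" for k M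
    using that
    by (intro eq_matI) (auto simp: ampliation_entry block_def ampliation_closed[THEN carrier_matD(1)]
        ampliation_closed[THEN carrier_matD(2)] mod_less_divisor dest: gr_implies_not0)
  then show ?case by (simp add: ampliation_positive_def positive_mat_def id_def)
next
  case (Suc m)
  have "(F ^^ Suc m) = (\<lambda>X. (F ^^ m) (F X))" by (auto simp: funpow_swap1)
  then show ?case using ampliation_positive_comp[OF Suc assms] by simp
qed

lemma block_mod: "r < k * n \<Longrightarrow> r mod n < (n :: nat)"
  by (cases "n = 0") auto

lemma ampliation_positive_add_scale:
  assumes F: "ampliation_positive n F" and G: "ampliation_positive n G" and c: "0 \<le> c"
    and cF: "\<And>X. X \<in> carrier_mat n n \<Longrightarrow> F X \<in> carrier_mat n n"
    and cG: "\<And>X. X \<in> carrier_mat n n \<Longrightarrow> G X \<in> carrier_mat n n"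
  shows "ampliation_positive n (\<lambda>X. F X + complex_of_real c \<cdot>\<^sub>m G X)"
  unfolding ampliation_positive_def
proof (intro allI impI positive_matI ampliation_closed)
  fix k M and v :: "complex vec" assume M: "positive_mat (k * n) M" and v: "v \<in> carrier_vec (k * n)"
  let ?A = "ampliation n k (\<lambda>X. F X + complex_of_real c \<cdot>\<^sub>m G X) M"
  have e: "?A $$ (r, s) = ampliation n k F M $$ (r, s) + complex_of_real c * ampliation n k G M $$ (r, s)"
    if "r < k * n" "s < k * n" for r s
    using that block_mod[OF that(1)] block_mod[OF that(2)]
      carrier_matD[OF cF[OF block_closed[of n M "r div n" "s div n"]]]
      carrier_matD[OF cG[OF block_closed[of n M "r div n" "s div n"]]]
    by (simp add: ampliation_entry)
  have "(\<Sum>r<k * n. \<Sum>s<k * n. cnj (v $ r) * ?A $$ (r, s) * v $ s)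
     = (\<Sum>r<k * n. \<Sum>s<k * n. cnj (v $ r) * ampliation n k F M $$ (r, s) * v $ s)
       + complex_of_real c * (\<Sum>r<k * n. \<Sum>s<k * n. cnj (v $ r) * ampliation n k G M $$ (r, s) * v $ s)"
    unfolding sum_distrib_left sum.distrib[symmetric]
    by (intro sum.cong refl) (simp add: e algebra_simps)
  moreover have "0 \<le> (\<Sum>r<k * n. \<Sum>s<k * n. cnj (v $ r) * ampliation n k F M $$ (r, s) * v $ s)"
    "0 \<le> (\<Sum>r<k * n. \<Sum>s<k * n. cnj (v $ r) * ampliation n k G M $$ (r, s) * v $ s)"
    using F G M by (auto simp: ampliation_positive_def intro!: positive_matD(2))
  ultimately show "0 \<le> (\<Sum>r<k * n. \<Sum>s<k * n. cnj (v $ r) * ?A $$ (r, s) * v $ s)"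
    using c by (simp add: less_eq_complex_def)
qed

lemma conjugation_entry:
  assumes "W \<in> carrier_mat n n" "X \<in> carrier_mat n n" "V \<in> carrier_mat n n" "i < n" "j < n"
  shows "(V * X * W) $$ (i, j) = (\<Sum>k<n. \<Sum>l<n. V $$ (i, k) * X $$ (k, l) * W $$ (l, j))"
  using assms by (simp add: scalar_prod_def lessThan_atLeast0 sum_distrib_left mult.assoc)

lemma bilinear_conjugation:
  fixes x y :: "nat \<Rightarrow> complex"
  assumes "W \<in> carrier_mat n n" "X \<in> carrier_mat n n" "V \<in> carrier_mat n n"
  shows "(\<Sum>i<n. \<Sum>j<n. x i * (V * X * W) $$ (i, j) * y j)
    = (\<Sum>p<n. \<Sum>q<n. (\<Sum>i<n. x i * V $$ (i, p)) * X $$ (p, q) * (\<Sum>j<n. W $$ (q, j) * y j))"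
proof -
  let ?f = "\<lambda>i j p q. x i * (V $$ (i, p) * X $$ (p, q) * W $$ (q, j)) * y j"
  have pairs: "(\<Sum>i<n. \<Sum>j<n. g i j) = (\<Sum>x\<in>{..<n} \<times> {..<n}. g (fst x) (snd x))" for g :: "nat \<Rightarrow> nat \<Rightarrow> complex"
    by (simp only: sum.cartesian_product split_def)
  have "(\<Sum>i<n. \<Sum>j<n. x i * (V * X * W) $$ (i, j) * y j) = (\<Sum>i<n. \<Sum>j<n. \<Sum>p<n. \<Sum>q<n. ?f i j p q)"
    by (intro sum.cong refl) (simp only: conjugation_entry[OF assms] lessThan_iff sum_distrib_left sum_distrib_right)
  also have "\<dots> = (\<Sum>x\<in>{..<n} \<times> {..<n}. \<Sum>z\<in>{..<n} \<times> {..<n}. ?f (fst x) (snd x) (fst z) (snd z))"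
    by (subst pairs, rule sum.cong[OF refl], rule pairs)
  also have "\<dots> = (\<Sum>z\<in>{..<n} \<times> {..<n}. \<Sum>x\<in>{..<n} \<times> {..<n}. ?f (fst x) (snd x) (fst z) (snd z))"
    by (rule sum.swap)
  also have "\<dots> = (\<Sum>p<n. \<Sum>q<n. \<Sum>i<n. \<Sum>j<n. ?f i j p q)"
    by (rule sym, subst pairs, rule sum.cong[OF refl], rule pairs)
  also have "\<dots> = (\<Sum>p<n. \<Sum>q<n. (\<Sum>i<n. x i * V $$ (i, p)) * X $$ (p, q) * (\<Sum>j<n. W $$ (q, j) * y j))"
    unfolding sum_distrib_left sum_distrib_right
    by (rule sum.cong[OF refl], rule sum.cong[OF refl], subst sum.swap) (intro sum.cong refl, simp add: mult_ac)
  finally show ?thesis .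
qed

text \<open>
  The quadratic form of the ampliated matrix at \<open>v\<close> is that of \<open>M\<close> at \<open>w\<close>, the vector to
  which \<open>W\<close> has been applied in each block.
\<close>
lemma ampliation_positive_conjugation:
  assumes W: "W \<in> carrier_mat n n" and V: "V \<in> carrier_mat n n"
    and VW: "\<And>i j. i < n \<Longrightarrow> j < n \<Longrightarrow> V $$ (i, j) = cnj (W $$ (j, i))"
  shows "ampliation_positive n (\<lambda>X. V * X * W)"
  unfolding ampliation_positive_def
proof (intro allI impI positive_matI ampliation_closed)
  fix k M and v :: "complex vec" assume M: "positive_mat (k * n) M" and v: "v \<in> carrier_vec (k * n)"
  let ?A = "ampliation n k (\<lambda>X. V * X * W) M"
  define w where "w r = (\<Sum>i<n. W $$ (r mod n, i) * v $ (r div n * n + i))" for r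
  define S where "S a b = (\<Sum>i<n. \<Sum>j<n. cnj (v $ (a * n + i)) * (V * block n M a b * W) $$ (i, j) * v $ (b * n + j))" for a b
  have S: "S a b = (\<Sum>p<n. \<Sum>q<n. cnj (w (a * n + p)) * M $$ (a * n + p, b * n + q) * w (b * n + q))" for a b
    unfolding S_def bilinear_conjugation[OF W block_closed V]
    by (intro sum.cong refl) (simp add: w_def VW block_def mult.commute)
  have "(\<Sum>r<k * n. \<Sum>s<k * n. cnj (v $ r) * ?A $$ (r, s) * v $ s)
     = (\<Sum>a<k. \<Sum>i<n. \<Sum>b<k. \<Sum>j<n. cnj (v $ (a * n + i)) * (V * block n M a b * W) $$ (i, j) * v $ (b * n + j))"
    unfolding sum_blocks by (intro sum.cong refl) (simp only: ampliation_block_entry lessThan_iff)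
  also have "\<dots> = (\<Sum>a<k. \<Sum>b<k. S a b)"
    unfolding S_def by (rule sum.cong[OF refl], rule sum.swap)
  also have "\<dots> = (\<Sum>r<k * n. \<Sum>s<k * n. cnj (w r) * M $$ (r, s) * w s)"
    unfolding sum_blocks S by (rule sum.cong[OF refl], rule sum.swap)
  finally show "0 \<le> (\<Sum>r<k * n. \<Sum>s<k * n. cnj (v $ r) * ?A $$ (r, s) * v $ s)"
    using positive_matD(2)[OF M, of w] by simp
qed

lemma ampliation_positive_limit:
  assumes pos: "\<And>N. N > 0 \<Longrightarrow> ampliation_positive n (FN N)"
    and lim: "\<And>X. X \<in> carrier_mat n n \<Longrightarrow> mtendsto n (\<lambda>N. FN N X) (F X)"
  shows "ampliation_positive n F"
  unfolding ampliation_positive_def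
proof (intro allI impI positive_matI ampliation_closed)
  fix k M and v :: "complex vec" assume M: "positive_mat (k * n) M" and v: "v \<in> carrier_vec (k * n)"
  define qf where "qf G = (\<Sum>r<k * n. \<Sum>s<k * n. cnj (v $ r) * ampliation n k G M $$ (r, s) * v $ s)" for G
  have "(\<lambda>N. qf (FN N)) \<longlonglongrightarrow> qf F"
    unfolding qf_def
  proof (intro tendsto_sum tendsto_mult tendsto_const)
    fix r s assume "r \<in> {..<k * n}" "s \<in> {..<k * n}"
    then show "(\<lambda>N. ampliation n k (FN N) M $$ (r, s)) \<longlonglongrightarrow> ampliation n k F M $$ (r, s)"
      using lim[OF block_closed, of M "r div n" "s div n"] block_mod[of r k n] block_mod[of s k n]
      by (simp add: ampliation_entry mtendsto_def)
  qed
  then have "(\<lambda>N. Re (qf (FN N))) \<longlonglongrightarrow> Re (qf F)" "(\<lambda>N. Im (qf (FN N))) \<longlonglongrightarrow> Im (qf F)"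
    by (auto intro: tendsto_Re tendsto_Im)
  moreover have "0 \<le> qf (FN N)" if "N > 0" for N
    using pos[OF that] M unfolding qf_def by (auto simp: ampliation_positive_def intro!: positive_matD(2))
  then have ev: "\<forall>\<^sub>F N in sequentially. 0 \<le> Re (qf (FN N)) \<and> Im (qf (FN N)) = 0"
    by (intro eventually_sequentiallyI[of 1]) (simp add: less_eq_complex_def)
  ultimately have "0 \<le> Re (qf F)" "Im (qf F) = 0"
    by (auto intro: tendsto_lowerbound[OF _ eventually_mono[OF ev]] LIMSEQ_unique[OF _ tendsto_eventually[OF eventually_mono[OF ev]]])
  then show "0 \<le> (\<Sum>r<k * n. \<Sum>s<k * n. cnj (v $ r) * ampliation n k F M $$ (r, s) * v $ s)"
    unfolding qf_def[symmetric] by (simp add: less_eq_complex_def)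
qed

section \<open>The dephasing Lindbladian as a quantum Markov generator\<close>

lemma mat_adjoint_closed: "X \<in> carrier_mat n n \<Longrightarrow> mat_adjoint X \<in> carrier_mat n n"
  by (auto simp: mat_adjoint_def)

lemma mat_adjoint_entry:
  "X \<in> carrier_mat n n \<Longrightarrow> i < n \<Longrightarrow> j < n \<Longrightarrow> mat_adjoint X $$ (i, j) = cnj (X $$ (j, i))"
  by (simp add: mat_adjoint_def mat_of_rows_def)

lemma hermitian_entry:
  "hermitian_mat X \<Longrightarrow> X \<in> carrier_mat n n \<Longrightarrow> i < n \<Longrightarrow> j < n \<Longrightarrow> X $$ (i, j) = cnj (X $$ (j, i))"
  using mat_adjoint_entry unfolding hermitian_mat_def by metis

lemma mtrace_mult_commute:
  assumes "X \<in> carrier_mat n n" "Y \<in> carrier_mat n n"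
  shows "mtrace (X * Y) = mtrace (Y * X)"
proof -
  have e: "mtrace (X * Y) = (\<Sum>i<n. \<Sum>k<n. X $$ (i, k) * Y $$ (k, i))"
    if "X \<in> carrier_mat n n" "Y \<in> carrier_mat n n" for X Y
    using that by (simp add: mtrace_def scalar_prod_def lessThan_atLeast0)
  show ?thesis
    unfolding e[OF assms] e[OF assms(2,1)] by (subst sum.swap) (simp add: mult.commute)
qed

lemma mtrace_commutator:
  assumes "X \<in> carrier_mat n n" "Y \<in> carrier_mat n n"
  shows "mtrace (commutator X Y) = 0"
proof -
  have "mtrace (commutator X Y) = mtrace (X * Y) - mtrace (Y * X)"
    using assms by (simp add: commutator_def mtrace_def sum_subtractf)
  then show ?thesis using mtrace_mult_commute[OF assms] by simp
qed

lemma commutator_closed: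
  "X \<in> carrier_mat n n \<Longrightarrow> Y \<in> carrier_mat n n \<Longrightarrow> commutator X Y \<in> carrier_mat n n"
  unfolding commutator_def by (intro minus_carrier_mat mult_carrier_mat)

lemma norm1_commutator:
  assumes "H \<in> carrier_mat n n" "X \<in> carrier_mat n n"
  shows "norm1 n (commutator H X) \<le> 2 * norm1 n H * norm1 n X"
proof -
  have "norm1 n (commutator H X) \<le> norm1 n (H * X) + norm1 n (X * H)"
    unfolding commutator_def using assms by (intro norm1_minus) auto
  also have "\<dots> \<le> norm1 n H * norm1 n X + norm1 n X * norm1 n H"
    by (intro add_mono norm1_mult assms)
  finally show ?thesis by simp
qed

lemma linear_superop_cong:
  assumes "\<And>X. X \<in> carrier_mat n n \<Longrightarrow> F X = G X" and "linear_superop n G"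
  shows "linear_superop n F"
  using assms unfolding linear_superop_def by simp

lemma linear_superop_conjugation:
  assumes "V \<in> carrier_mat n n" and "W \<in> carrier_mat n n"
  shows "linear_superop n (\<lambda>X. V * X * W)"
  unfolding linear_superop_def
  using assms by (auto simp: add_mult_distrib_mat[of _ n n _ _ n] mult_add_distrib_mat[of _ n n _ n]
     mult_smult_distrib[of _ n n _ n] mult_smult_assoc_mat[of _ n n _ n])

lemma linear_superop_add_scale:
  assumes F: "linear_superop n F" and G: "linear_superop n G"
  shows "linear_superop n (\<lambda>X. F X + c \<cdot>\<^sub>m G X)"
proof -
  have cl: "dim_row (F X) = n" "dim_col (F X) = n" "dim_row (G X) = n" "dim_col (G X) = n"
    if "X \<in> carrier_mat n n" for X
    using F G that unfolding linear_superop_def by (meson carrier_matD)+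
  have add: "F (X + Z) = F X + F Z" "G (X + Z) = G X + G Z"
    if "X \<in> carrier_mat n n" "Z \<in> carrier_mat n n" for X Z
    using F G that unfolding linear_superop_def by blast+
  have smult: "F (a \<cdot>\<^sub>m X) = a \<cdot>\<^sub>m F X" "G (a \<cdot>\<^sub>m X) = a \<cdot>\<^sub>m G X"
    if "X \<in> carrier_mat n n" for a X
    using F G that unfolding linear_superop_def by blast+
  show ?thesis
    unfolding linear_superop_def
    by (auto simp: add smult cl algebra_simps intro!: eq_matI)
qed

locale dephasing_Lindbladian =
  fixes n :: nat and H A :: "complex mat" and \<gamma> :: real
  assumes H: "H \<in> carrier_mat n n" and A: "A \<in> carrier_mat n n"
    and H_herm: "hermitian_mat H" and A_herm: "hermitian_mat A"
    and \<gamma>_nonneg: "0 \<le> \<gamma>"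
begin

abbreviation "\<L> \<equiv> Lindbladian H A \<gamma>"

lemma dephasing_closed: "X \<in> carrier_mat n n \<Longrightarrow> dephasing A X \<in> carrier_mat n n"
  by (simp add: dephasing_def commutator_closed A)

text \<open>
  The generator without its jump term is \<open>X \<mapsto> J\<^sup>* X + X J\<close>; the remaining part \<open>2 \<gamma> A X A\<close>
  is completely positive. \<open>J'\<close> is the adjoint of \<open>J\<close>.
\<close>
definition J :: "complex mat" where
  "J = (- \<i>) \<cdot>\<^sub>m H + complex_of_real (- \<gamma>) \<cdot>\<^sub>m (A * A)"

definition J' :: "complex mat" where
  "J' = \<i> \<cdot>\<^sub>m H + complex_of_real (- \<gamma>) \<cdot>\<^sub>m (A * A)"

lemma J_closed: "J \<in> carrier_mat n n" "J' \<in> carrier_mat n n"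
  using H A by (auto simp: J_def J'_def)

text \<open>
  A Kraus-type form of the generator. The terms \<open>A\<^sup>2 X\<close> and \<open>X A\<^sup>2\<close> of the double commutator
  combine with the Hamiltonian into \<open>J' X + X J\<close>.
\<close>
lemma Lindbladian_eq:
  assumes X: "X \<in> carrier_mat n n"
  shows "\<L> X = J' * X + X * J + (2 * complex_of_real \<gamma>) \<cdot>\<^sub>m (A * X * A)"
proof -
  define a b c d e where defs: "a = H * X" "b = X * H" "c = A * A * X" "d = X * (A * A)" "e = A * X * A"
  have cl: "a \<in> carrier_mat n n" "b \<in> carrier_mat n n" "c \<in> carrier_mat n n" "d \<in> carrier_mat n n"
    "e \<in> carrier_mat n n"
    unfolding defs using H A X by auto
  have AX: "A * X \<in> carrier_mat n n" and XA: "X * A \<in> carrier_mat n n" and AA: "A * A \<in> carrier_mat n n"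
    using A X by auto
  have "commutator A (commutator A X) = (A * (A * X) - A * (X * A)) - (A * X * A - X * A * A)"
    unfolding commutator_def mult_minus_distrib_mat[OF A AX XA] minus_mult_distrib_mat[OF AX XA A] ..
  also have "\<dots> = (c - e) - (e - d)"
    unfolding defs assoc_mult_mat[OF A A X] assoc_mult_mat[OF A X A] assoc_mult_mat[OF X A A] ..
  finally have L: "\<L> X = \<i> \<cdot>\<^sub>m (a - b) + complex_of_real \<gamma> \<cdot>\<^sub>m (- ((c - e) - (e - d)))"
    unfolding Lindbladian_def dephasing_def by (simp add: commutator_def[of H X] defs)
  have J'X: "J' * X = \<i> \<cdot>\<^sub>m a + complex_of_real (- \<gamma>) \<cdot>\<^sub>m c"
    unfolding J'_def defs
    using H AA X by (subst add_mult_distrib_mat[of _ n n _ _ n]) (auto simp: mult_smult_assoc_mat[OF H X] mult_smult_assoc_mat[OF AA X])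
  have XJ: "X * J = (- \<i>) \<cdot>\<^sub>m b + complex_of_real (- \<gamma>) \<cdot>\<^sub>m d"
    unfolding J_def defs
    using H AA X by (subst mult_add_distrib_mat[of _ n n _ n]) (auto simp: mult_smult_distrib[OF X H] mult_smult_distrib[OF X AA])
  show ?thesis
    unfolding L J'X XJ defs(5)[symmetric] using cl by (intro eq_matI) (auto simp: algebra_simps)
qed

lemma Lindbladian_linear: "linear_superop n \<L>"
proof (rule linear_superop_cong)
  show "linear_superop n (\<lambda>X. (J' * X * 1\<^sub>m n + 1 \<cdot>\<^sub>m (1\<^sub>m n * X * J)) + (2 * complex_of_real \<gamma>) \<cdot>\<^sub>m (A * X * A))"
    by (intro linear_superop_add_scale linear_superop_conjugation J_closed one_carrier_mat A)
  fix X :: "complex mat" assume X: "X \<in> carrier_mat n n"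
  have "J' * X * 1\<^sub>m n = J' * X" "1 \<cdot>\<^sub>m (1\<^sub>m n * X * J) = X * J"
    using X J_closed by (auto simp: mult_carrier_mat[of _ n n _ n] intro!: eq_matI)
  then show "\<L> X = (J' * X * 1\<^sub>m n + 1 \<cdot>\<^sub>m (1\<^sub>m n * X * J)) + (2 * complex_of_real \<gamma>) \<cdot>\<^sub>m (A * X * A)"
    by (simp only: Lindbladian_eq[OF X])
qed

definition bound :: real where
  "bound = 2 * norm1 n H + 4 * \<gamma> * (norm1 n A)\<^sup>2"

lemma bound_nonneg: "0 \<le> bound"
  using \<gamma>_nonneg by (simp add: bound_def norm1_nonneg)

lemma Lindbladian_bounded:
  assumes X: "X \<in> carrier_mat n n"
  shows "norm1 n (\<L> X) \<le> bound * norm1 n X"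
proof -
  have "norm1 n (\<L> X) \<le> norm1 n (\<i> \<cdot>\<^sub>m commutator H X) + norm1 n (complex_of_real \<gamma> \<cdot>\<^sub>m dephasing A X)"
    unfolding Lindbladian_def
    by (intro norm1_add smult_carrier_mat commutator_closed dephasing_closed H X)
  also have "\<dots> = norm1 n (commutator H X) + \<gamma> * norm1 n (commutator A (commutator A X))"
    unfolding dephasing_def
    using \<gamma>_nonneg by (simp add: norm1_smult norm1_uminus commutator_closed[OF H X] commutator_closed[OF A commutator_closed[OF A X]])
  also have "\<dots> \<le> 2 * norm1 n H * norm1 n X + \<gamma> * (2 * norm1 n A * (2 * norm1 n A * norm1 n X))"
    by (intro add_mono mult_left_mono \<gamma>_nonneg order_trans[OF norm1_commutator[OF A commutator_closed[OF A X]]]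
        norm1_commutator H A X) (simp add: norm1_nonneg)
  also have "\<dots> = bound * norm1 n X"
    by (simp add: bound_def algebra_simps power2_eq_square)
  finally show ?thesis .
qed

sublocale superop n \<L> bound
  by unfold_locales (auto simp: Lindbladian_linear bound_nonneg Lindbladian_bounded)

lemma mtrace_Lindbladian:
  assumes X: "X \<in> carrier_mat n n"
  shows "mtrace (\<L> X) = 0"
proof -
  define p r where d: "p = commutator H X" "r = commutator A (commutator A X)"
  have c: "p \<in> carrier_mat n n" "r \<in> carrier_mat n n"
    unfolding d by (intro commutator_closed H A X)+
  have "mtrace (\<L> X) = \<i> * mtrace p - complex_of_real \<gamma> * mtrace r"
    unfolding Lindbladian_def dephasing_def d[symmetric]
    using c by (simp add: mtrace_def sum.distrib sum_distrib_left sum_negf sum_subtractf)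
  moreover have "mtrace p = 0" "mtrace r = 0"
    unfolding d by (rule mtrace_commutator[OF H X] mtrace_commutator[OF A commutator_closed[OF A X]])+
  ultimately show ?thesis by simp
qed

lemma Lindbladian_one: "\<L> (1\<^sub>m n) = 0\<^sub>m n n"
proof -
  have "commutator H (1\<^sub>m n) = 0\<^sub>m n n" "commutator A (1\<^sub>m n) = 0\<^sub>m n n"
    using H A by (simp_all add: commutator_def minus_r_inv_mat)
  then show ?thesis
    using A by (simp add: Lindbladian_def dephasing_def commutator_def) (intro eq_matI, auto)
qed

lemma J_adjoint: "i < n \<Longrightarrow> j < n \<Longrightarrow> J' $$ (i, j) = cnj (J $$ (j, i))"
proof -
  assume ij: "i < n" "j < n"
  define p where "p = A * A"
  have p: "p \<in> carrier_mat n n" using A by (simp add: p_def)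
  have e: "p $$ (i, j) = (\<Sum>k<n. A $$ (i, k) * A $$ (k, j))" if "i < n" "j < n" for i j
    using that A by (simp add: p_def scalar_prod_def lessThan_atLeast0)
  have "cnj (p $$ (j, i)) = (\<Sum>k<n. A $$ (k, j) * A $$ (i, k))"
    using ij by (simp add: e hermitian_entry[OF A_herm A, symmetric])
  then have "p $$ (i, j) = cnj (p $$ (j, i))"
    using ij by (simp add: e mult.commute)
  then show ?thesis
    unfolding J_def J'_def p_def[symmetric] using ij H p hermitian_entry[OF H_herm H ij, symmetric] by simp
qed

text \<open>
  Expanding the product on the right gives \<open>X + s (J' X + X J) + s\<^sup>2 J' X J\<close>. The Euler step
  is thus in Kraus form once the generator is corrected by the second-order term \<open>s J' X J\<close>.
\<close>
lemma euler_step_Kraus: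
  assumes X: "X \<in> carrier_mat n n"
  shows "X + s \<cdot>\<^sub>m (\<L> X + s \<cdot>\<^sub>m (J' * X * J))
    = (1\<^sub>m n + s \<cdot>\<^sub>m J') * X * (1\<^sub>m n + s \<cdot>\<^sub>m J) + (2 * complex_of_real \<gamma> * s) \<cdot>\<^sub>m (A * X * A)"
proof -
  define a b e f where defs: "a = J' * X" "b = X * J" "e = A * X * A" "f = J' * X * J"
  have cl: "a \<in> carrier_mat n n" "b \<in> carrier_mat n n" "e \<in> carrier_mat n n" "f \<in> carrier_mat n n"
    unfolding defs using A X J_closed by auto
  have J'Xc: "J' * X \<in> carrier_mat n n" and sJ': "s \<cdot>\<^sub>m J' \<in> carrier_mat n n" and sJ: "s \<cdot>\<^sub>m J \<in> carrier_mat n n"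
    using J_closed X by auto
  have "(1\<^sub>m n + s \<cdot>\<^sub>m J') * X = X + s \<cdot>\<^sub>m (J' * X)"
    using add_mult_distrib_mat[OF one_carrier_mat sJ' X] X mult_smult_assoc_mat[OF J_closed(2) X] by simp
  then have "(1\<^sub>m n + s \<cdot>\<^sub>m J') * X * (1\<^sub>m n + s \<cdot>\<^sub>m J) = (X + s \<cdot>\<^sub>m (J' * X)) * (1\<^sub>m n + s \<cdot>\<^sub>m J)" by simp
  also have "\<dots> = (X + s \<cdot>\<^sub>m (J' * X)) + (X + s \<cdot>\<^sub>m (J' * X)) * (s \<cdot>\<^sub>m J)"
    using mult_add_distrib_mat[OF _ one_carrier_mat sJ, of "X + s \<cdot>\<^sub>m (J' * X)" n] X J'Xc by simp
  also have "(X + s \<cdot>\<^sub>m (J' * X)) * (s \<cdot>\<^sub>m J) = s \<cdot>\<^sub>m (X * J + s \<cdot>\<^sub>m f)"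
  proof -
    have c1: "X + s \<cdot>\<^sub>m (J' * X) \<in> carrier_mat n n" and c2: "s \<cdot>\<^sub>m (J' * X) \<in> carrier_mat n n" using X J'Xc by auto
    show ?thesis
      unfolding mult_smult_distrib[OF c1 J_closed(1)] add_mult_distrib_mat[OF X c2 J_closed(1)]
        mult_smult_assoc_mat[OF J'Xc J_closed(1)] defs(4) ..
  qed
  finally have R: "(1\<^sub>m n + s \<cdot>\<^sub>m J') * X * (1\<^sub>m n + s \<cdot>\<^sub>m J) = (X + s \<cdot>\<^sub>m (J' * X)) + s \<cdot>\<^sub>m (X * J + s \<cdot>\<^sub>m f)" .
  show ?thesis
    unfolding R Lindbladian_eq[OF X] defs(4)[symmetric] unfolding defs(1-3)[symmetric]
    using X cl by (intro eq_matI) (auto simp: algebra_simps)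
qed

lemma euler_step_positive:
  assumes "0 \<le> s"
  shows "ampliation_positive n (\<lambda>X. X + complex_of_real s \<cdot>\<^sub>m (\<L> X + complex_of_real s \<cdot>\<^sub>m (J' * X * J)))"
proof (subst ampliation_positive_cong)
  have WJ: "1\<^sub>m n + complex_of_real s \<cdot>\<^sub>m J \<in> carrier_mat n n" "1\<^sub>m n + complex_of_real s \<cdot>\<^sub>m J' \<in> carrier_mat n n"
    using J_closed by auto
  have "ampliation_positive n (\<lambda>X. (1\<^sub>m n + complex_of_real s \<cdot>\<^sub>m J') * X * (1\<^sub>m n + complex_of_real s \<cdot>\<^sub>m J))"
    using J_closed by (intro ampliation_positive_conjugation WJ) (auto simp: J_adjoint)
  moreover have "ampliation_positive n (\<lambda>X. A * X * A)"
    using A hermitian_entry[OF A_herm A] by (intro ampliation_positive_conjugation)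
  ultimately show "ampliation_positive n (\<lambda>X. (1\<^sub>m n + complex_of_real s \<cdot>\<^sub>m J') * X * (1\<^sub>m n + complex_of_real s \<cdot>\<^sub>m J)
       + complex_of_real (2 * \<gamma> * s) \<cdot>\<^sub>m (A * X * A))"
    using assms \<gamma>_nonneg A WJ by (intro ampliation_positive_add_scale) auto
qed (simp add: euler_step_Kraus)

theorem exp_completely_positive:
  assumes t: "0 \<le> t"
  shows "completely_positive n (semigroup_exp n \<L> t)"
proof -
  define FN where "FN N X = \<L> X + complex_of_real (t / real N) \<cdot>\<^sub>m (J' * X * J)" for N X
  define B where "B = bound + t * (norm1 n J' * norm1 n J)"
  have JXJ: "norm1 n (J' * X * J) \<le> norm1 n J' * norm1 n J * norm1 n X" if X: "X \<in> carrier_mat n n" for X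
  proof -
    have "norm1 n (J' * X * J) \<le> norm1 n (J' * X) * norm1 n J" using J_closed X by (intro norm1_mult) auto
    also have "\<dots> \<le> norm1 n J' * norm1 n X * norm1 n J" using J_closed X by (intro mult_right_mono norm1_mult norm1_nonneg)
    finally show ?thesis by (simp add: mult_ac)
  qed
  have F: "superop n \<L> B"
  proof (unfold_locales, rule linear)
    show "0 \<le> B" using bound_nonneg t by (simp add: B_def norm1_nonneg)
    fix X :: "complex mat" assume "X \<in> carrier_mat n n"
    then show "norm1 n (\<L> X) \<le> B * norm1 n X"
      by (rule order_trans[OF bounded mult_right_mono[OF _ norm1_nonneg]]) (use t in \<open>simp add: B_def norm1_nonneg\<close>)
  qed
  have FN: "superop n (FN N) B" for N
  proof (unfold_locales)
    show "linear_superop n (FN N)"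
      unfolding FN_def
      by (intro linear_superop_add_scale linear_superop_conjugation linear J_closed)
    show "0 \<le> B" using bound_nonneg t by (simp add: B_def norm1_nonneg)
    fix X :: "complex mat" assume X: "X \<in> carrier_mat n n"
    then have JX: "J' * X * J \<in> carrier_mat n n" using J_closed by auto
    \<comment> \<open>Division by zero gives zero, so the step \<open>N = 0\<close> satisfies the same bound.\<close>
    have "t / real N \<le> t"
    proof (cases "N = 0")
      case False
      then have "t * 1 \<le> t * real N" by (intro mult_left_mono) (use t in auto)
      with False show ?thesis by (simp add: field_simps)
    qed (use t in simp)
    with t have tN: "cmod (complex_of_real (t / real N)) \<le> t" by (subst norm_of_real) simp
    have "norm1 n (FN N X) \<le> norm1 n (\<L> X) + cmod (complex_of_real (t / real N)) * norm1 n (J' * X * J)"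
      unfolding FN_def norm1_smult[OF JX, symmetric] by (intro norm1_add closed X smult_carrier_mat JX)
    also have "\<dots> \<le> bound * norm1 n X + t * (norm1 n J' * norm1 n J * norm1 n X)"
      using t by (intro add_mono bounded X mult_mono JXJ tN norm1_nonneg)
    finally show "norm1 n (FN N X) \<le> B * norm1 n X" by (simp add: B_def algebra_simps)
  qed
  have lim: "mtendsto n (\<lambda>N. FN N X) (\<L> X)" if X: "X \<in> carrier_mat n n" for X
    unfolding mtendsto_def
  proof (intro allI impI)
    fix i j assume ij: "i < n" "j < n"
    have "(\<lambda>N. \<L> X $$ (i, j) + complex_of_real (t * inverse (real N)) * (J' * X * J) $$ (i, j))
        \<longlonglongrightarrow> \<L> X $$ (i, j) + complex_of_real (t * 0) * (J' * X * J) $$ (i, j)"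
      by (intro tendsto_intros tendsto_inverse_0_at_top filterlim_real_sequentially)
    moreover have "FN N X $$ (i, j) = \<L> X $$ (i, j) + complex_of_real (t * inverse (real N)) * (J' * X * J) $$ (i, j)" for N
    proof -
      define p where "p = J' * X * J"
      have "p \<in> carrier_mat n n" using J_closed X unfolding p_def by auto
      then show ?thesis unfolding FN_def p_def[symmetric] using ij closed[OF X] by (simp add: divide_inverse)
    qed
    ultimately show "(\<lambda>N. FN N X $$ (i, j)) \<longlonglongrightarrow> \<L> X $$ (i, j)" by simp
  qed
  have "ampliation_positive n (semigroup_exp n \<L> t)"
  proof (rule ampliation_positive_limit[OF _ euler_product_tendsto_exp[OF F FN lim]])
    fix N :: nat
    show "ampliation_positive n ((\<lambda>Z. Z + complex_of_real (t / real N) \<cdot>\<^sub>m FN N Z) ^^ N)"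
    proof (rule ampliation_positive_funpow)
      show "ampliation_positive n (\<lambda>Z. Z + complex_of_real (t / real N) \<cdot>\<^sub>m FN N Z)"
        unfolding FN_def by (rule euler_step_positive) (use t in simp)
    qed (use superop.closed[OF FN] in auto)
  qed
  then show ?thesis
    unfolding completely_positive_def ampliation_positive_def using exp_linear by blast
qed

theorem quantum_Markov_generator: "quantum_Markov_generator n \<L>"
  unfolding quantum_Markov_generator_def
  using exp_completely_positive exp_fixed[OF one_carrier_mat Lindbladian_one] Lindbladian_linear by auto

end

section \<open>Coordinates in an orthonormal basis\<close>

locale eigenbasis =
  fixes n :: nat and u :: "nat \<Rightarrow> complex vec"
  assumes u_closed: "i < n \<Longrightarrow> u i \<in> carrier_vec n"
    and u_orthonormal: "i < n \<Longrightarrow> j < n \<Longrightarrow> u i \<bullet>c u j = (if i = j then 1 else 0)"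
begin

definition U :: "complex mat" where "U = mat n n (\<lambda>(a, i). u i $ a)"
definition Uh :: "complex mat" where "Uh = mat n n (\<lambda>(i, a). cnj (u i $ a))"

lemma U_closed [simp]: "U \<in> carrier_mat n n" "Uh \<in> carrier_mat n n"
  by (simp_all add: U_def Uh_def)

lemma Uh_U: "Uh * U = 1\<^sub>m n"
proof (rule eq_matI)
  fix i j assume "i < dim_row (1\<^sub>m n :: complex mat)" "j < dim_col (1\<^sub>m n :: complex mat)"
  then have ij: "i < n" "j < n" by auto
  have "(Uh * U) $$ (i, j) = (\<Sum>a<n. cnj (u i $ a) * u j $ a)"
    using ij by (simp add: U_def Uh_def scalar_prod_def lessThan_atLeast0)
  also have "\<dots> = u j \<bullet>c u i"
    using u_closed[OF ij(1)] u_closed[OF ij(2)] by (simp add: scalar_prod_def lessThan_atLeast0 mult.commute)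
  finally show "(Uh * U) $$ (i, j) = 1\<^sub>m n $$ (i, j)" using ij by (simp add: u_orthonormal)
qed (auto simp: U_def Uh_def)

text \<open>
  A left inverse of a square matrix is a right inverse; this is completeness of the basis.
\<close>
lemma U_Uh: "U * Uh = 1\<^sub>m n"
  by (rule mat_mult_left_right_inverse[OF U_closed(2,1) Uh_U])

text \<open>
  The matrix \<open>U\<^sup>* X U\<close> of \<open>X\<close> in the basis \<open>u\<close>. Conjugation by a unitary preserves products,
  adjoints and traces, hence the Hilbert--Schmidt structure.
\<close>
definition coord_mat :: "complex mat \<Rightarrow> complex mat" where
  "coord_mat X = Uh * X * U"

definition coord :: "complex mat \<Rightarrow> nat \<Rightarrow> nat \<Rightarrow> complex" where
  "coord X i j = coord_mat X $$ (i, j)"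

lemma coord_mat_closed [simp]: "X \<in> carrier_mat n n \<Longrightarrow> coord_mat X \<in> carrier_mat n n"
  unfolding coord_mat_def by (rule mult_carrier_mat[OF mult_carrier_mat[OF U_closed(2)] U_closed(1)])

lemma coord_mat_mult:
  assumes X: "X \<in> carrier_mat n n" and Y: "Y \<in> carrier_mat n n"
  shows "coord_mat (X * Y) = coord_mat X * coord_mat Y"
proof -
  have "coord_mat X * coord_mat Y = Uh * X * ((U * Uh) * (Y * U))"
    unfolding coord_mat_def using X Y U_closed by (simp add: assoc_mult_mat[of _ n n _ n _ n] mult_carrier_mat[of _ n n _ n])
  also have "\<dots> = Uh * (X * Y) * U"
    unfolding U_Uh using X Y U_closed by (simp add: assoc_mult_mat[of _ n n _ n _ n] mult_carrier_mat[of _ n n _ n])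
  finally show ?thesis by (simp add: coord_mat_def)
qed

lemma coord_mult:
  assumes "X \<in> carrier_mat n n" "Y \<in> carrier_mat n n" "i < n" "j < n"
  shows "coord (X * Y) i j = (\<Sum>k<n. coord X i k * coord Y k j)"
  using assms carrier_matD[OF coord_mat_closed[OF assms(1)]] carrier_matD[OF coord_mat_closed[OF assms(2)]]
  by (simp add: coord_def coord_mat_mult scalar_prod_def lessThan_atLeast0)

lemma coord_entry:
  assumes "X \<in> carrier_mat n n" "i < n" "j < n"
  shows "coord X i j = (\<Sum>a<n. \<Sum>b<n. cnj (u i $ a) * X $$ (a, b) * u j $ b)"
  unfolding coord_def coord_mat_def using assms
  by (subst conjugation_entry[OF U_closed(1) _ U_closed(2)]) (auto simp: U_def Uh_def)

lemma coord_add: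
  assumes "X \<in> carrier_mat n n" "Y \<in> carrier_mat n n" "i < n" "j < n"
  shows "coord (X + Y) i j = coord X i j + coord Y i j"
  using assms by (simp add: coord_entry sum.distrib distrib_left distrib_right)

lemma coord_minus:
  assumes "X \<in> carrier_mat n n" "Y \<in> carrier_mat n n" "i < n" "j < n"
  shows "coord (X - Y) i j = coord X i j - coord Y i j"
proof -
  have "X - Y \<in> carrier_mat n n" using assms(2) by (rule minus_carrier_mat)
  then show ?thesis
    using assms by (simp add: coord_entry sum_subtractf left_diff_distrib right_diff_distrib)
qed

lemma coord_smult:
  assumes "X \<in> carrier_mat n n" "i < n" "j < n"
  shows "coord (a \<cdot>\<^sub>m X) i j = a * coord X i j"
  using assms by (simp add: coord_entry sum_distrib_left mult_ac)

lemma coord_uminus: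
  assumes "X \<in> carrier_mat n n" "i < n" "j < n"
  shows "coord (- X) i j = - coord X i j"
  using assms by (simp add: coord_entry sum_negf)

lemma coord_adjoint:
  assumes X: "X \<in> carrier_mat n n" and ij: "i < n" "j < n"
  shows "coord (mat_adjoint X) i j = cnj (coord X j i)"
proof -
  have "coord (mat_adjoint X) i j = (\<Sum>a<n. \<Sum>b<n. cnj (u i $ a) * cnj (X $$ (b, a)) * u j $ b)"
    using ij by (simp add: coord_entry mat_adjoint_closed[OF X] mat_adjoint_entry[OF X])
  also have "\<dots> = cnj (coord X j i)"
    by (subst sum.swap) (simp add: coord_entry[OF X ij(2,1)] mult_ac)
  finally show ?thesis .
qed

lemma mtrace_coord:
  assumes X: "X \<in> carrier_mat n n"
  shows "mtrace X = (\<Sum>i<n. coord X i i)"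
proof -
  have "(\<Sum>i<n. coord X i i) = mtrace (coord_mat X)"
    using carrier_matD[OF coord_mat_closed[OF X]] by (simp add: mtrace_def coord_def)
  also have "\<dots> = mtrace (U * (Uh * X))"
    unfolding coord_mat_def by (intro mtrace_mult_commute[OF mult_carrier_mat[OF U_closed(2) X] U_closed(1)])
  also have "U * (Uh * X) = (U * Uh) * X"
    using X U_closed by (intro assoc_mult_mat[symmetric, of _ n n _ n _ n]) auto
  also have "\<dots> = X" unfolding U_Uh using X by simp
  finally show ?thesis by simp
qed

lemma hs_inner_coord:
  assumes X: "X \<in> carrier_mat n n" and Y: "Y \<in> carrier_mat n n"
  shows "hs_inner n X Y = (\<Sum>i<n. \<Sum>j<n. cnj (coord X i j) * coord Y i j) / of_nat n"
proof -
  have "mtrace (mat_adjoint X * Y) = (\<Sum>i<n. \<Sum>k<n. cnj (coord X k i) * coord Y k i)"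
    using X Y mat_adjoint_closed[OF X] by (simp add: mtrace_coord coord_mult coord_adjoint)
  also have "\<dots> = (\<Sum>i<n. \<Sum>j<n. cnj (coord X i j) * coord Y i j)" by (rule sum.swap)
  finally show ?thesis by (simp add: hs_inner_def)
qed

lemma Re_hs_inner_coord:
  assumes X: "X \<in> carrier_mat n n" and Y: "Y \<in> carrier_mat n n"
  shows "Re (hs_inner n X Y) = hsp n (coord X) (coord Y) / n"
  unfolding hs_inner_coord[OF assms] hsp_def
  by (simp add: inner_complex_def Re_divide_of_nat)

lemma hs_norm_coord:
  "X \<in> carrier_mat n n \<Longrightarrow> hs_norm n X = hsn n (coord X) / sqrt n"
  by (simp add: hs_norm_def Re_hs_inner_coord hsn_def real_sqrt_divide)

lemma coord_inj:
  assumes X: "X \<in> carrier_mat n n" and Y: "Y \<in> carrier_mat n n"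
    and e: "\<And>i j. i < n \<Longrightarrow> j < n \<Longrightarrow> coord X i j = coord Y i j"
  shows "X = Y"
proof -
  have inv: "Z = U * coord_mat Z * Uh" if Z: "Z \<in> carrier_mat n n" for Z
  proof -
    have "U * coord_mat Z * Uh = (U * Uh) * Z * (U * Uh)"
      unfolding coord_mat_def using Z U_closed by (simp add: assoc_mult_mat[of _ n n _ n _ n] mult_carrier_mat[of _ n n _ n])
    then show ?thesis unfolding U_Uh using Z by simp
  qed
  have "coord_mat X = coord_mat Y"
    using e carrier_matD[OF coord_mat_closed[OF X]] carrier_matD[OF coord_mat_closed[OF Y]]
    by (intro eq_matI) (auto simp: coord_def)
  then show ?thesis using inv[OF X] inv[OF Y] by simp
qed

lemma basis_op_closed: "basis_op n u c \<in> carrier_mat n n"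
  by (simp add: basis_op_def)

lemma basis_op_eq: "basis_op n u c = U * mat n n (\<lambda>(i, j). c i j) * Uh"
proof (rule eq_matI)
  fix a b assume "a < dim_row (U * mat n n (\<lambda>(i, j). c i j) * Uh)" "b < dim_col (U * mat n n (\<lambda>(i, j). c i j) * Uh)"
  then have ab: "a < n" "b < n" by (auto simp: U_def Uh_def)
  show "basis_op n u c $$ (a, b) = (U * mat n n (\<lambda>(i, j). c i j) * Uh) $$ (a, b)"
    using ab by (subst conjugation_entry[of _ n]) (auto simp: basis_op_def U_def Uh_def mult_ac intro!: sum.cong)
qed (auto simp: basis_op_def U_def Uh_def)

lemma coord_basis_op:
  assumes "i < n" "j < n"
  shows "coord (basis_op n u c) i j = c i j"
proof -
  define M where "M = mat n n (\<lambda>(i, j). c i j)"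
  have M: "M \<in> carrier_mat n n" by (simp add: M_def)
  have "coord_mat (basis_op n u c) = (Uh * U) * M * (Uh * U)"
    unfolding coord_mat_def basis_op_eq M_def[symmetric]
    using M U_closed by (simp add: assoc_mult_mat[of _ n n _ n _ n] mult_carrier_mat[of _ n n _ n])
  also have "\<dots> = M" unfolding Uh_U using M by simp
  finally show ?thesis using assms by (simp add: coord_def M_def)
qed

lemma diag_op_closed: "diag_op n u x \<in> carrier_mat n n"
  by (simp add: diag_op_def basis_op_closed)

lemma coord_diag_op: "i < n \<Longrightarrow> j < n \<Longrightarrow> coord (diag_op n u x) i j = diag_array (\<lambda>i. x $ i) i j"
  by (simp add: diag_op_def coord_basis_op diag_array_def)

lemma hermitian_basis_op:
  assumes "\<And>i j. i < n \<Longrightarrow> j < n \<Longrightarrow> c i j = cnj (c j i)"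
  shows "hermitian_mat (basis_op n u c)"
  unfolding hermitian_mat_def
  by (rule coord_inj[OF mat_adjoint_closed[OF basis_op_closed] basis_op_closed])
     (use assms in \<open>simp add: coord_adjoint[OF basis_op_closed] coord_basis_op flip: assms\<close>)

lemma coord_commutator:
  assumes "X \<in> carrier_mat n n" "Y \<in> carrier_mat n n" "i < n" "j < n"
  shows "coord (commutator X Y) i j = (\<Sum>k<n. coord X i k * coord Y k j - coord Y i k * coord X k j)"
  unfolding commutator_def
  using assms by (simp add: coord_minus coord_mult sum_subtractf)

lemma coord_has_derivative:
  assumes "\<And>a b. a < n \<Longrightarrow> b < n \<Longrightarrow> ((\<lambda>t. X t $$ (a, b)) has_vector_derivative Y $$ (a, b)) (at t)"
    and "\<And>t. X t \<in> carrier_mat n n" "Y \<in> carrier_mat n n" "i < n" "j < n"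
  shows "((\<lambda>t. coord (X t) i j) has_vector_derivative coord Y i j) (at t)"
  unfolding coord_entry[OF assms(2,4,5)] coord_entry[OF assms(3-5)]
  by (intro has_vector_derivative_sum has_vector_derivative_mult_left has_vector_derivative_mult_right assms(1)) auto

end

section \<open>The lifted semigroup\<close>

locale quantum_lift =
  fixes n :: nat and Q :: "real mat" and A :: "complex mat" and \<kappa> :: "nat \<Rightarrow> real"
    and u :: "nat \<Rightarrow> complex vec"
  assumes standing: "standing_assumptions n Q A \<kappa> u"
begin

lemma n2: "2 \<le> n" and Q_closed: "Q \<in> carrier_mat n n" and A_closed: "A \<in> carrier_mat n n"
  and A_hermitian: "hermitian_mat A" and \<kappa>_inj: "inj_on \<kappa> {..<n}"
  and A_eigen: "i < n \<Longrightarrow> A *\<^sub>v u i = complex_of_real (\<kappa> i) \<cdot>\<^sub>v u i"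
  using standing
  by (auto simp: standing_assumptions_def Q_matrix_def orthonormal_eigenbasis_def)

lemma Q_sym: "i < n \<Longrightarrow> j < n \<Longrightarrow> Q $$ (i, j) = Q $$ (j, i)"
  using standing Q_closed unfolding standing_assumptions_def by (metis carrier_matD index_transpose_mat(1))

sublocale symmetric_chain n "\<lambda>i j. Q $$ (i, j)"
  using standing Q_sym
  by unfold_locales (auto simp: standing_assumptions_def Q_matrix_def irreducible_Q_def)

sublocale eigenbasis n u
  using standing by unfold_locales (auto simp: standing_assumptions_def orthonormal_eigenbasis_def)

lemma finite_gaps: "finite {\<bar>\<kappa> i - \<kappa> j\<bar> | i j. i < n \<and> j < n \<and> P i j}"
  by (rule finite_subset[of _ "(\<lambda>(i, j). \<bar>\<kappa> i - \<kappa> j\<bar>) ` ({..<n} \<times> {..<n})"]) auto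

sublocale dephased_lift n "\<lambda>i j. Q $$ (i, j)" \<kappa> "min_gap n \<kappa>" "max_gap n \<kappa>"
proof
  show "min_gap n \<kappa> \<le> \<bar>\<kappa> i - \<kappa> j\<bar>" if "i < n" "j < n" "i \<noteq> j" for i j
    unfolding min_gap_def using that by (intro Min_le finite_gaps) auto
  show "\<bar>\<kappa> i - \<kappa> j\<bar> \<le> max_gap n \<kappa>" if "i < n" "j < n" for i j
    unfolding max_gap_def using that finite_gaps[of "\<lambda>_ _. True"] by (intro Max_ge) auto
  have "\<bar>\<kappa> 0 - \<kappa> 1\<bar> \<in> {\<bar>\<kappa> i - \<kappa> j\<bar> | i j. i < n \<and> j < n \<and> i \<noteq> j}"
    using n2 by (intro CollectI exI[of _ 0] exI[of _ 1]) auto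
  then have "{\<bar>\<kappa> i - \<kappa> j\<bar> | i j. i < n \<and> j < n \<and> i \<noteq> j} \<noteq> {}" by blast
  then have "min_gap n \<kappa> \<in> {\<bar>\<kappa> i - \<kappa> j\<bar> | i j. i < n \<and> j < n \<and> i \<noteq> j}"
    unfolding min_gap_def by (intro Min_in finite_gaps)
  then show "0 < min_gap n \<kappa>" using \<kappa>_inj by (auto simp: inj_on_def)
qed

definition Ham :: "complex mat" where "Ham = Hamiltonian n u Q"

lemma Ham_closed: "Ham \<in> carrier_mat n n"
  by (simp add: Ham_def Hamiltonian_def basis_op_closed)

lemma coord_Ham: "i < n \<Longrightarrow> j < n \<Longrightarrow> coord Ham i j = complex_of_real (h i j)"
  by (simp add: Ham_def Hamiltonian_def coord_basis_op h_def)

lemma Ham_hermitian: "hermitian_mat Ham"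
  unfolding Ham_def Hamiltonian_def by (rule hermitian_basis_op) (simp add: Q_sym)

lemma coord_A:
  assumes ij: "i < n" "j < n"
  shows "coord A i j = (if i = j then complex_of_real (\<kappa> j) else 0)"
proof -
  have Au: "(\<Sum>b<n. A $$ (a, b) * u j $ b) = complex_of_real (\<kappa> j) * u j $ a" if "a < n" for a
  proof -
    have "(\<Sum>b<n. A $$ (a, b) * u j $ b) = (A *\<^sub>v u j) $ a"
      using that A_closed u_closed[OF ij(2)] by (simp add: scalar_prod_def lessThan_atLeast0)
    then show ?thesis using that u_closed[OF ij(2)] by (simp add: A_eigen[OF ij(2)])
  qed
  have "coord A i j = (\<Sum>a<n. cnj (u i $ a) * (\<Sum>b<n. A $$ (a, b) * u j $ b))"
    unfolding coord_entry[OF A_closed ij] sum_distrib_left by (simp add: mult.assoc)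
  also have "\<dots> = (\<Sum>a<n. complex_of_real (\<kappa> j) * (u j $ a * cnj (u i $ a)))"
    by (intro sum.cong refl) (simp add: Au)
  also have "\<dots> = complex_of_real (\<kappa> j) * (\<Sum>a<n. u j $ a * cnj (u i $ a))"
    by (simp only: sum_distrib_left)
  also have "(\<Sum>a<n. u j $ a * cnj (u i $ a)) = u j \<bullet>c u i"
    using u_closed[OF ij(1)] u_closed[OF ij(2)] by (simp add: scalar_prod_def lessThan_atLeast0)
  finally show ?thesis using ij by (simp add: u_orthonormal)
qed

lemma coord_commutator_A:
  assumes X: "X \<in> carrier_mat n n" and ij: "i < n" "j < n"
  shows "coord (commutator A X) i j = complex_of_real (\<kappa> i - \<kappa> j) * coord X i j"
proof -
  have "coord (commutator A X) i j = (\<Sum>k<n. coord A i k * coord X k j) - (\<Sum>k<n. coord X i k * coord A k j)"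
    using coord_commutator[OF A_closed X ij] by (simp add: sum_subtractf)
  also have "(\<Sum>k<n. coord A i k * coord X k j) = (\<Sum>k<n. if k = i then complex_of_real (\<kappa> i) * coord X i j else 0)"
    by (intro sum.cong refl) (use ij in \<open>auto simp: coord_A\<close>)
  also have "(\<Sum>k<n. coord X i k * coord A k j) = (\<Sum>k<n. if k = j then complex_of_real (\<kappa> j) * coord X i j else 0)"
    by (intro sum.cong refl) (use ij in \<open>auto simp: coord_A\<close>)
  finally show ?thesis using ij by (simp add: algebra_simps)
qed

lemma coord_commutator_Ham:
  assumes X: "X \<in> carrier_mat n n" and ij: "i < n" "j < n"
  shows "\<i> * coord (commutator Ham X) i j = T (coord X) i j"
  unfolding coord_commutator[OF Ham_closed X ij] T_def
  using ij by (intro arg_cong[of _ _ "\<lambda>x. \<i> * x"] sum.cong refl)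
    (simp add: coord_Ham scaleR_conv_of_real mult.commute)

lemma coord_Lindbladian:
  assumes X: "X \<in> carrier_mat n n" and ij: "i < n" "j < n"
  shows "coord (Lindbladian Ham A \<gamma> X) i j = L \<gamma> (coord X) i j"
proof -
  note cH = commutator_closed[OF Ham_closed X] and cA = commutator_closed[OF A_closed X]
  note cAA = commutator_closed[OF A_closed cA]
  have "coord (Lindbladian Ham A \<gamma> X) i j
      = \<i> * coord (commutator Ham X) i j + complex_of_real \<gamma> * (- coord (commutator A (commutator A X)) i j)"
    unfolding Lindbladian_def dephasing_def
    using ij cH cAA by (simp add: coord_add coord_smult coord_uminus)
  then show ?thesis
    unfolding coord_commutator_Ham[OF X ij] coord_commutator_A[OF cA ij] coord_commutator_A[OF X ij] L_def S_def
    by (simp add: scaleR_conv_of_real power2_eq_square)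
qed

text \<open>
  Since \<open>T = i [H, -]\<close>, the double commutator is \<open>- T T\<close>.
\<close>
lemma hsn_double_commutator:
  assumes X: "X \<in> carrier_mat n n"
  shows "hsn n (coord (commutator Ham (commutator Ham X))) = hsn n (T (T (coord X)))"
proof -
  have 1: "coord (commutator Ham X) i j = - \<i> * T (coord X) i j" if "i < n" "j < n" for i j
    using coord_commutator_Ham[OF X that, symmetric] by simp
  have "coord (commutator Ham (commutator Ham X)) i j = - \<i> * T (coord (commutator Ham X)) i j" if "i < n" "j < n" for i j
    using coord_commutator_Ham[OF commutator_closed[OF Ham_closed X] that, symmetric] by simp
  also have "- \<i> * T (coord (commutator Ham X)) i j = - \<i> * T (\<lambda>i j. - \<i> * T (coord X) i j) i j" if "i < n" "j < n" for i j
    using T_cong[OF 1 that] by simp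
  also have "- \<i> * T (\<lambda>i j. - \<i> * T (coord X) i j) i j = - T (T (coord X)) i j" for i j
    unfolding T_def[of "\<lambda>i j. - \<i> * T (coord X) i j"] T_def[of "T (coord X)"]
    by (simp add: sum_distrib_left right_diff_distrib sum_subtractf sum_negf scaleR_conv_of_real mult_ac)
  finally have "coord (commutator Ham (commutator Ham X)) i j = - T (T (coord X)) i j" if "i < n" "j < n" for i j
    using that by simp
  then show ?thesis unfolding hsn_def hsp_self by (intro arg_cong[of _ _ sqrt] sum.cong refl) simp
qed

lemma apply_Q_entry:
  assumes "y \<in> carrier_vec n" "i < n"
  shows "apply_Q Q y $ i = - D (\<lambda>j. y $ j) i"
  using assms Q_closed
  by (simp add: apply_Q_def D_def scalar_prod_def lessThan_atLeast0 scaleR_conv_of_real)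

lemma l2_norm_apply_Q:
  assumes "y \<in> carrier_vec n"
  shows "l2_norm n (apply_Q Q y) = hsn n (diag_array (D (\<lambda>j. y $ j))) / sqrt n"
proof -
  have "Re (l2_inner n (apply_Q Q y) (apply_Q Q y)) = (\<Sum>i<n. (cmod (D (\<lambda>j. y $ j) i))\<^sup>2) / n"
    unfolding l2_inner_def Re_divide_of_nat Re_sum using assms
    by (intro arg_cong[of _ _ "\<lambda>x. x / real n"] sum.cong refl) (simp add: apply_Q_entry cmod_power2 flip: power2_eq_square)
  then show ?thesis by (simp add: l2_norm_def hsn_diag real_sqrt_divide)
qed

lemma Re_l2_inner_Q:
  assumes "x \<in> carrier_vec n" "y \<in> carrier_vec n"
  shows "- Re (l2_inner n x (apply_Q Q y)) = (\<Sum>i<n. inner (x $ i) (D (\<lambda>j. y $ j) i)) / n"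
  unfolding l2_inner_def using assms
  by (simp add: apply_Q_entry Re_divide_of_nat inner_complex_def sum_negf flip: sum_subtractf)

end

locale quantum_lift_semigroup = quantum_lift +
  fixes \<gamma> :: real
  assumes \<gamma>_pos: "0 < \<gamma>"
begin

sublocale QL: dephasing_Lindbladian n Ham A \<gamma>
  by unfold_locales (use \<gamma>_pos in \<open>auto simp: Ham_closed A_closed Ham_hermitian A_hermitian\<close>)

abbreviation "Lind \<equiv> Lindbladian Ham A \<gamma>"

text \<open>
  The trajectory \<open>exp (t L) X\<close> in coordinates.
\<close>
definition orbit :: "complex mat \<Rightarrow> real \<Rightarrow> nat \<Rightarrow> nat \<Rightarrow> complex" where
  "orbit X t = coord (semigroup_exp n Lind t X)"

lemma orbit_zero: "X \<in> carrier_mat n n \<Longrightarrow> orbit X 0 = coord X"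
  by (simp add: orbit_def QL.exp_zero)

lemma orbit_ode:
  assumes X: "X \<in> carrier_mat n n" and ij: "i < n" "j < n"
  shows "((\<lambda>t. orbit X t i j) has_vector_derivative L \<gamma> (orbit X t) i j) (at t)"
  unfolding orbit_def coord_Lindbladian[OF QL.exp_closed ij, symmetric]
  by (rule coord_has_derivative[OF QL.exp_has_derivative[OF X]])
     (use ij in \<open>auto intro: QL.closed QL.exp_closed\<close>)

lemma orbit_trace: "X \<in> carrier_mat n n \<Longrightarrow> (\<Sum>i<n. orbit X t i i) = mtrace X"
  unfolding orbit_def
  by (simp add: QL.mtrace_exp QL.mtrace_Lindbladian QL.exp_closed flip: mtrace_coord)

lemma hs_norm_exp: "hs_norm n (semigroup_exp n Lind t X) = hsn n (orbit X t) / sqrt n"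
  unfolding orbit_def by (rule hs_norm_coord[OF QL.exp_closed])

lemma decay_estimate_iff:
  "decay_estimate n Lind C \<nu> \<longleftrightarrow>
     (\<forall>t\<ge>0. \<forall>X \<in> carrier_mat n n. mtrace X = 0 \<longrightarrow> hsn n (orbit X t) \<le> C * exp (- \<nu> * t) * hsn n (coord X))"
proof -
  have "0 < sqrt (real n)" using n2 by simp
  then show ?thesis
    unfolding decay_estimate_def hs_norm_exp by (simp add: hs_norm_coord divide_le_cancel cong: ball_cong)
qed

lemma hypocoercive_decay:
  assumes K: "\<And>y. (\<Sum>i<n. y i) = 0 \<Longrightarrow> hsn n (T (T (diag_array y))) \<le> K * hsn n (diag_array (D y))"
    and \<epsilon>: "0 \<le> \<epsilon>" "\<epsilon> \<le> sqrt gap / 2"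
      "\<epsilon> * (3 / 2 + (K + \<gamma> * (max_gap n \<kappa>)\<^sup>2 / sqrt gap)\<^sup>2 / 2) \<le> \<gamma> * (min_gap n \<kappa>)\<^sup>2"
  shows "decay_estimate n Lind 2 (\<epsilon> / 3)"
  unfolding decay_estimate_iff
proof (intro allI impI ballI)
  fix t :: real and X assume t: "0 \<le> t" and X: "X \<in> carrier_mat n n" "mtrace X = 0"
  have "hsn n (orbit X t) \<le> 2 * exp (- (\<epsilon> / 3) * t) * hsn n (orbit X 0)"
    by (rule coordinate_decay[OF orbit_ode[OF X(1)] _ _ K \<epsilon> t])
       (use X \<gamma>_pos in \<open>auto simp: orbit_trace\<close>)
  then show "hsn n (orbit X t) \<le> 2 * exp (- (\<epsilon> / 3) * t) * hsn n (coord X)"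
    by (simp add: orbit_zero[OF X(1)])
qed

text \<open>
  For a fixed chain the constants need not be uniform: any admissible \<open>K\<close> and a sufficiently
  small \<open>\<epsilon>\<close> give exponential decay at every \<open>\<gamma> > 0\<close>.
\<close>
lemma decay_exists: "\<exists>\<nu>>0. decay_estimate n Lind 2 \<nu>"
proof -
  obtain K where K: "\<And>y. (\<Sum>i<n. y i) = 0 \<Longrightarrow> hsn n (T (T (diag_array y))) \<le> K * hsn n (diag_array (D y))"
    using TT_bounded_by_D by blast
  define M where "M = 3 / 2 + (K + \<gamma> * (max_gap n \<kappa>)\<^sup>2 / sqrt gap)\<^sup>2 / 2"
  have M: "M > 0" unfolding M_def by (rule add_pos_nonneg) auto
  define \<epsilon> where "\<epsilon> = min (sqrt gap / 2) (\<gamma> * (min_gap n \<kappa>)\<^sup>2 / M)"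
  have "\<epsilon> * M \<le> \<gamma> * (min_gap n \<kappa>)\<^sup>2 / M * M"
    unfolding \<epsilon>_def using M by (intro mult_right_mono) auto
  then have "\<epsilon> * M \<le> \<gamma> * (min_gap n \<kappa>)\<^sup>2" using M by simp
  moreover have "\<epsilon> > 0" unfolding \<epsilon>_def using gap_pos \<gamma>_pos M \<delta>_pos by simp
  moreover have "\<epsilon> \<le> sqrt gap / 2" unfolding \<epsilon>_def by (rule min.cobounded1)
  ultimately have "decay_estimate n Lind 2 (\<epsilon> / 3)"
    using hypocoercive_decay[OF K, of \<epsilon>] unfolding M_def by simp
  then show ?thesis using \<open>\<epsilon> > 0\<close> by (intro exI[of _ "\<epsilon> / 3"]) simp
qed

lemma orbit_norm_derivative:
  assumes X: "X \<in> carrier_mat n n"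
  shows "((\<lambda>t. hsp n (orbit X t) (orbit X t)) has_real_derivative
     2 * \<gamma> * hsp n (orbit X t) (S (orbit X t))) (at t)"
proof -
  have "((\<lambda>t. hsp n (orbit X t) (orbit X t)) has_real_derivative
     hsp n (L \<gamma> (orbit X t)) (orbit X t) + hsp n (orbit X t) (L \<gamma> (orbit X t))) (at t)"
    by (rule hsp_has_derivative) (auto intro: orbit_ode X)
  also have "hsp n (L \<gamma> (orbit X t)) (orbit X t) = hsp n (orbit X t) (L \<gamma> (orbit X t))"
    by (rule hsp_commute)
  also have "hsp n (orbit X t) (L \<gamma> (orbit X t)) = \<gamma> * hsp n (orbit X t) (S (orbit X t))"
    unfolding L_def hsp_add_right hsp_scaleR_right hsp_T_self by simp
  finally show ?thesis by (simp add: algebra_simps)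
qed

lemma contraction:
  assumes X: "X \<in> carrier_mat n n" and t: "0 \<le> t"
  shows "hsn n (orbit X t) \<le> hsn n (coord X)"
proof -
  have "hsp n (orbit X t) (orbit X t) \<le> hsp n (orbit X 0) (orbit X 0)"
  proof (rule DERIV_nonpos_imp_nonincreasing[OF t])
    fix s
    have "hsp n (orbit X s) (S (orbit X s)) \<le> 0"
      by (rule order_trans[OF hsp_S]) simp
    then have "2 * \<gamma> * hsp n (orbit X s) (S (orbit X s)) \<le> 0"
      using \<gamma>_pos by (intro mult_nonneg_nonpos) auto
    then show "\<exists>y. ((\<lambda>t. hsp n (orbit X t) (orbit X t)) has_real_derivative y) (at s) \<and> y \<le> 0"
      using orbit_norm_derivative[OF X] by blast
  qed
  then show ?thesis unfolding hsn_def orbit_zero[OF X] by simp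
qed

text \<open>
  The diagonal observable of a unit eigenvector for the spectral gap. It is invisible to the
  dissipator, and the Hamiltonian part moves it at speed \<open>\<surd>gap\<close>.
\<close>
lemma gap_observable:
  obtains X where "X \<in> carrier_mat n n" "mtrace X = 0" "hsn n (coord X) = 1"
    "\<forall>i<n. \<forall>j<n. i \<noteq> j \<longrightarrow> coord X i j = 0"
    "hsn n (T (coord X)) = sqrt gap"
proof -
  obtain v :: "nat \<Rightarrow> real" where v: "(\<Sum>i<n. v i) = 0" "(\<Sum>i<n. (v i)\<^sup>2) = 1" "\<forall>i<n. D v i = gap * v i"
    using gap_eigenvector by blast
  define w where "w i = complex_of_real (v i)" for i
  define X where "X = diag_op n u (vec n w)"
  have X: "X \<in> carrier_mat n n" by (simp add: X_def diag_op_closed)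
  have crdX: "coord X i j = diag_array w i j" if "i < n" "j < n" for i j
    using that by (simp add: X_def coord_diag_op diag_array_def)
  have Dw: "D w i = complex_of_real (gap * v i)" if "i < n" for i
  proof -
    have "D w i = complex_of_real (D v i)" by (simp add: D_def w_def scaleR_conv_of_real)
    with v(3) that show ?thesis by simp
  qed
  show ?thesis
  proof
    show "X \<in> carrier_mat n n" by fact
    have "(\<Sum>i<n. coord X i i) = (\<Sum>i<n. complex_of_real (v i))"
      by (intro sum.cong refl) (simp add: crdX diag_array_def w_def)
    also have "\<dots> = complex_of_real (\<Sum>i<n. v i)" by simp
    finally show "mtrace X = 0" unfolding mtrace_coord[OF X] by (simp add: v(1) del: of_real_sum)
    have "hsn n (coord X) = hsn n (diag_array w)"
      unfolding hsn_def by (intro arg_cong[of _ _ sqrt] hsp_cong crdX)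
    also have "\<dots> = 1" by (simp add: hsn_diag w_def v(2))
    finally show "hsn n (coord X) = 1" .
    show "\<forall>i<n. \<forall>j<n. i \<noteq> j \<longrightarrow> coord X i j = 0"
      by (simp add: crdX diag_array_def)
    have "hsp n (T (coord X)) (T (coord X)) = hsp n (T (diag_array w)) (T (diag_array w))"
      by (intro hsp_cong T_cong crdX)
    also have "\<dots> = (\<Sum>i<n. gap * (v i)\<^sup>2)"
      unfolding hsp_T_diag by (intro sum.cong refl) (simp add: Dw w_def inner_complex_def power2_eq_square)
    also have "\<dots> = gap" by (simp add: v(2) flip: sum_distrib_left)
    finally show "hsn n (T (coord X)) = sqrt gap" by (simp add: hsn_def)
  qed
qed

lemma hsp_diag_S:
  assumes "\<forall>i<n. \<forall>j<n. i \<noteq> j \<longrightarrow> f i j = 0"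
  shows "hsp n f (S g) = 0"
proof -
  have "hsp n f (S g) = hsp n (diag_array (\<lambda>i. f i i)) (S g)"
    using assms by (intro hsp_cong refl) (simp add: diag_array_def)
  then show ?thesis by (simp add: hsp_diag_left S_def)
qed

text \<open>
  The dissipator annihilates a diagonal observable and the Hamiltonian part is
  antisymmetric, so \<open>|z t|\<^sup>2\<close> has derivative zero at \<open>t = 0\<close>. For an observable of norm one,
  decay with prefactor one would force a derivative of at most \<open>- 2 \<nu>\<close>.
\<close>
lemma no_decay_without_prefactor:
  assumes "\<nu> > 0"
  shows "\<not> decay_estimate n Lind 1 \<nu>"
proof
  assume dec: "decay_estimate n Lind 1 \<nu>"
  obtain X where X: "X \<in> carrier_mat n n" "mtrace X = 0" "hsn n (coord X) = 1"
    "\<forall>i<n. \<forall>j<n. i \<noteq> j \<longrightarrow> coord X i j = 0"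
    "hsn n (T (coord X)) = sqrt gap"
    by (rule gap_observable)
  define N where "N t = hsp n (orbit X t) (orbit X t)" for t
  have N0: "N 0 = 1" using X(1,3) by (simp add: N_def orbit_zero flip: hsn_power2)
  have "(N has_real_derivative 0) (at 0)"
    using orbit_norm_derivative[OF X(1), of 0] hsp_diag_S[OF X(4)] unfolding N_def
    by (simp add: orbit_zero[OF X(1)])
  then have "((\<lambda>t. N t * exp (2 * \<nu> * t)) has_real_derivative 2 * \<nu>) (at 0)"
    by (auto intro!: derivative_eq_intros simp: N0)
  from DERIV_pos_inc_right[OF this] assms obtain d
    where d: "d > 0" "\<And>h. 0 < h \<Longrightarrow> h < d \<Longrightarrow> 1 < N h * exp (2 * \<nu> * h)"
    using N0 by auto
  define t where "t = d / 2"
  have t: "t > 0" "t < d" using d(1) by (auto simp: t_def)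
  have "hsn n (orbit X t) \<le> 1 * exp (- \<nu> * t) * hsn n (coord X)"
    using dec X(1,2) t(1) unfolding decay_estimate_iff by auto
  then have "hsn n (orbit X t) \<le> exp (- \<nu> * t)" by (simp add: X(3))
  then have "(hsn n (orbit X t))\<^sup>2 \<le> (exp (- \<nu> * t))\<^sup>2" by (rule power_mono) (rule hsn_nonneg)
  then have "N t \<le> exp (- 2 * \<nu> * t)" by (simp add: N_def hsn_power2 mult.assoc flip: exp_double)
  then have "N t * exp (2 * \<nu> * t) \<le> exp (- 2 * \<nu> * t) * exp (2 * \<nu> * t)" by (intro mult_right_mono) auto
  also have "\<dots> = 1" by (simp flip: exp_add)
  finally show False using d(2)[OF t] by simp
qed

theorem hypocoercive: "hypocoercive n Lind"
proof -
  have "(1 :: real) < 2" by simp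
  with decay_exists no_decay_without_prefactor show ?thesis unfolding hypocoercive_def by blast
qed

text \<open>
  The overlap of the trajectory with its initial observable \<open>X\<close> can decrease only at speed
  \<open>|T X| = \<surd>gap\<close>, because the dissipator does not see \<open>X\<close> and the semigroup is a
  contraction. It bounds the norm from below.
\<close>
theorem decay_rate_upper:
  assumes dec: "decay_estimate n Lind C' \<nu>" and C: "C' \<le> C" "1 \<le> C"
  shows "\<nu> \<le> 2 * ln (2 * C) * sqrt gap"
proof -
  obtain X where X: "X \<in> carrier_mat n n" "mtrace X = 0" "hsn n (coord X) = 1"
    "\<forall>i<n. \<forall>j<n. i \<noteq> j \<longrightarrow> coord X i j = 0"
    "hsn n (T (coord X)) = sqrt gap"
    by (rule gap_observable)
  define a where "a t = hsp n (coord X) (orbit X t)" for t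
  have da: "(a has_real_derivative hsp n (coord X) (L \<gamma> (orbit X t))) (at t)" for t
  proof -
    have "((\<lambda>t. hsp n (coord X) (orbit X t)) has_real_derivative
      hsp n (\<lambda>_ _. 0) (orbit X t) + hsp n (coord X) (L \<gamma> (orbit X t))) (at t)"
      by (rule hsp_has_derivative) (auto intro: orbit_ode X)
    then show ?thesis unfolding a_def by (simp add: hsp_def)
  qed
  have slope: "hsp n (coord X) (L \<gamma> (orbit X t)) \<ge> - sqrt gap" if "0 \<le> t" for t
  proof -
    have "hsp n (coord X) (L \<gamma> (orbit X t)) = - hsp n (T (coord X)) (orbit X t)"
      unfolding L_def hsp_add_right hsp_scaleR_right hsp_T_antisym by (simp add: hsp_diag_S[OF X(4)])
    moreover have "\<bar>hsp n (T (coord X)) (orbit X t)\<bar> \<le> sqrt gap * hsn n (orbit X t)"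
      using hsp_Cauchy_Schwarz[of n "T (coord X)"] X(5) by simp
    moreover have "sqrt gap * hsn n (orbit X t) \<le> sqrt gap * 1"
      using contraction[OF X(1) that] X(3) gap_pos by (intro mult_left_mono) auto
    ultimately show ?thesis by linarith
  qed
  \<comment> \<open>At this time the overlap has lost at most half of its initial value.\<close>
  define t where "t = 1 / (2 * sqrt gap)"
  have sg: "sqrt gap > 0" using gap_pos by simp
  have t: "t > 0" using sg by (simp add: t_def)
  have "a 0 + sqrt gap * 0 \<le> a t + sqrt gap * t"
  proof (rule DERIV_nonneg_imp_nondecreasing[of 0 t "\<lambda>s. a s + sqrt gap * s"])
    fix s assume "0 \<le> s" "s \<le> t"
    have "((\<lambda>s. a s + sqrt gap * s) has_real_derivative hsp n (coord X) (L \<gamma> (orbit X s)) + sqrt gap) (at s)"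
      by (auto intro!: derivative_eq_intros da)
    with slope[OF \<open>0 \<le> s\<close>] show "\<exists>y. ((\<lambda>s. a s + sqrt gap * s) has_real_derivative y) (at s) \<and> 0 \<le> y"
      by (intro exI[of _ "hsp n (coord X) (L \<gamma> (orbit X s)) + sqrt gap"]) auto
  qed (use t in simp)
  moreover have "a 0 = 1" using X(3) by (simp add: a_def orbit_zero[OF X(1)] flip: hsn_power2)
  moreover have "sqrt gap * t = 1 / 2" using sg by (simp add: t_def)
  ultimately have "1 / 2 \<le> a t" by simp
  also have "a t \<le> hsn n (coord X) * hsn n (orbit X t)"
    unfolding a_def using hsp_Cauchy_Schwarz by (rule abs_le_D1)
  also have "\<dots> = hsn n (orbit X t)" by (simp add: X(3))
  also have "\<dots> \<le> C' * exp (- \<nu> * t) * hsn n (coord X)"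
    using dec X(1,2) t unfolding decay_estimate_iff by auto
  also have "\<dots> = C' * exp (- \<nu> * t)" by (simp add: X(3))
  also have "\<dots> \<le> C * exp (- \<nu> * t)" using C by (intro mult_right_mono) auto
  finally have "1 / 2 * exp (\<nu> * t) \<le> C * exp (- \<nu> * t) * exp (\<nu> * t)" by (intro mult_right_mono) auto
  also have "\<dots> = C" by (simp add: mult.assoc flip: exp_add)
  finally have "exp (\<nu> * t) \<le> 2 * C" by simp
  then have "\<nu> * t \<le> ln (2 * C)" using C by (simp add: ln_ge_iff)
  then show ?thesis using sg by (simp add: t_def field_simps)
qed

lemma invariant_maximally_mixed: "invariant_state n Lind (maximally_mixed n)"
proof -
  have n0: "real n > 0" using n2 by simp
  have c: "maximally_mixed n \<in> carrier_mat n n" by (simp add: maximally_mixed_def)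
  have "positive_mat n (maximally_mixed n)"
  proof (rule positive_matI[OF c])
    fix v :: "complex vec" assume "v \<in> carrier_vec n"
    have "(\<Sum>r<n. \<Sum>s<n. cnj (v $ r) * maximally_mixed n $$ (r, s) * v $ s)
      = (\<Sum>r<n. \<Sum>s<n. if r = s then complex_of_real ((cmod (v $ r))\<^sup>2 / n) else 0)"
      by (intro sum.cong refl) (auto simp: maximally_mixed_def complex_norm_square[symmetric] mult.commute
          simp flip: of_real_power)
    also have "\<dots> = complex_of_real (\<Sum>r<n. (cmod (v $ r))\<^sup>2 / n)" by simp
    also have "\<dots> \<ge> 0" by (simp add: less_eq_complex_def sum_nonneg)
    finally show "0 \<le> (\<Sum>r<n. \<Sum>s<n. cnj (v $ r) * maximally_mixed n $$ (r, s) * v $ s)" .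
  qed
  moreover have "mtrace (maximally_mixed n) = 1"
    using n0 by (simp add: mtrace_def maximally_mixed_def)
  moreover have tr: "mtrace (maximally_mixed n * Y) = mtrace Y / of_nat n" if Y: "Y \<in> carrier_mat n n" for Y
  proof -
    have "maximally_mixed n * Y = (1 / of_nat n) \<cdot>\<^sub>m Y"
      unfolding maximally_mixed_def mult_smult_assoc_mat[OF one_carrier_mat Y] using Y by simp
    then show ?thesis using Y by (simp add: mtrace_def sum_divide_distrib)
  qed
  ultimately show ?thesis
    unfolding invariant_state_def quantum_state_def
    by (auto simp: tr QL.exp_closed QL.mtrace_exp QL.mtrace_Lindbladian)
qed

lemma Re_mtrace_mult:
  assumes X: "X \<in> carrier_mat n n" and Y: "Z \<in> carrier_mat n n"
  shows "Re (mtrace (X * Z)) = hsp n (coord (mat_adjoint X)) (coord Z)"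
proof -
  have "mat_adjoint (mat_adjoint X) = X"
    using mat_adjoint_closed[OF mat_adjoint_closed[OF X]] X
    by (intro eq_matI) (auto simp: mat_adjoint_entry[OF mat_adjoint_closed[OF X]] mat_adjoint_entry[OF X])
  then have "mtrace (X * Z) = of_nat n * hs_inner n (mat_adjoint X) Z"
    using n2 by (simp add: hs_inner_def)
  then show ?thesis
    using Re_hs_inner_coord[OF mat_adjoint_closed[OF X] Y] n2 by simp
qed

text \<open>
  The expectation \<open>mtrace (\<sigma> * exp (t L) X)\<close> is constant in \<open>t\<close> and tends to zero. The
  coordinate inner product yields the real part only; the imaginary part follows by applying
  this to \<open>\<i> X\<close>.
\<close>
lemma invariant_state_annihilates_traceless:
  assumes inv: "invariant_state n Lind \<sigma>" and X: "X \<in> carrier_mat n n" "mtrace X = 0"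
  shows "mtrace (\<sigma> * X) = 0"
proof -
  have \<sigma>: "\<sigma> \<in> carrier_mat n n"
    using inv by (simp add: invariant_state_def quantum_state_def positive_mat_def)
  obtain \<nu> where \<nu>: "\<nu> > 0" "decay_estimate n Lind 2 \<nu>" using decay_exists by blast
  have Re0: "Re (mtrace (\<sigma> * X)) = 0" if X: "X \<in> carrier_mat n n" "mtrace X = 0" for X
  proof -
    define c where "c = hsn n (coord (mat_adjoint \<sigma>)) * (2 * hsn n (coord X))"
    have le: "\<bar>Re (mtrace (\<sigma> * X))\<bar> \<le> c * exp (- \<nu> * t)" if "t \<ge> 0" for t
    proof -
      have "\<bar>Re (mtrace (\<sigma> * X))\<bar> = \<bar>Re (mtrace (\<sigma> * semigroup_exp n Lind t X))\<bar>"
        using inv X that by (simp add: invariant_state_def)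
      also have "\<dots> \<le> hsn n (coord (mat_adjoint \<sigma>)) * hsn n (orbit X t)"
        unfolding Re_mtrace_mult[OF \<sigma> QL.exp_closed] orbit_def by (rule hsp_Cauchy_Schwarz)
      also have "\<dots> \<le> hsn n (coord (mat_adjoint \<sigma>)) * (2 * exp (- \<nu> * t) * hsn n (coord X))"
        using \<nu>(2) X that unfolding decay_estimate_iff by (intro mult_left_mono hsn_nonneg) auto
      finally show ?thesis by (simp add: c_def mult_ac)
    qed
    have "((\<lambda>t. c * exp (- \<nu> * t)) \<longlongrightarrow> 0) at_top"
      using \<nu>(1) by real_asymp
    then have "\<bar>Re (mtrace (\<sigma> * X))\<bar> \<le> 0"
      by (rule tendsto_lowerbound) (intro eventually_mono[OF eventually_ge_at_top[of 0]] le, auto)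
    then show ?thesis by simp
  qed
  have "mtrace (\<i> \<cdot>\<^sub>m X) = \<i> * mtrace X" using X by (simp add: mtrace_def flip: sum_distrib_left)
  then have "Re (mtrace (\<sigma> * (\<i> \<cdot>\<^sub>m X))) = 0" using X by (intro Re0) auto
  moreover have "mtrace (\<sigma> * (\<i> \<cdot>\<^sub>m X)) = \<i> * mtrace (\<sigma> * X)"
  proof -
    define P where "P = \<sigma> * X"
    have "P \<in> carrier_mat n n" using \<sigma> X by (simp add: P_def)
    then show ?thesis
      unfolding mult_smult_distrib[OF \<sigma> X(1)] P_def[symmetric] by (simp add: mtrace_def sum_distrib_left)
  qed
  ultimately show ?thesis using Re0[OF X] by (simp add: complex_eq_iff)
qed

text \<open>
  The difference of two invariant states annihilates every traceless observable, in
  particular its own adjoint, so its Hilbert--Schmidt norm vanishes.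
\<close>
theorem invariant_state_iff: "invariant_state n Lind \<sigma> \<longleftrightarrow> \<sigma> = maximally_mixed n"
proof
  assume inv: "invariant_state n Lind \<sigma>"
  then have \<sigma>: "\<sigma> \<in> carrier_mat n n" and tr: "mtrace \<sigma> = 1"
    by (auto simp: invariant_state_def quantum_state_def positive_mat_def)
  have mm: "maximally_mixed n \<in> carrier_mat n n" by (simp add: maximally_mixed_def)
  have mm_inv: "invariant_state n Lind (maximally_mixed n)" by (rule invariant_maximally_mixed)
  then have mm_tr: "mtrace (maximally_mixed n) = 1" by (simp add: invariant_state_def quantum_state_def)
  define X where "X = mat_adjoint (\<sigma> - maximally_mixed n)"
  have d: "\<sigma> - maximally_mixed n \<in> carrier_mat n n" using mm by (rule minus_carrier_mat)
  have X: "X \<in> carrier_mat n n" unfolding X_def by (rule mat_adjoint_closed[OF d])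
  have "mtrace X = cnj (mtrace \<sigma> - mtrace (maximally_mixed n))"
    using carrier_matD[OF X] \<sigma> mm d
    by (simp add: mtrace_def X_def mat_adjoint_entry[OF d] sum_subtractf)
  then have trX: "mtrace X = 0" by (simp add: tr mm_tr)
  have "(\<sigma> - maximally_mixed n) * X = \<sigma> * X - maximally_mixed n * X"
    by (rule minus_mult_distrib_mat[OF \<sigma> mm X])
  moreover have "mtrace (P - R) = mtrace P - mtrace R" if "P \<in> carrier_mat n n" "R \<in> carrier_mat n n" for P R
    using that by (simp add: mtrace_def sum_subtractf)
  ultimately have "mtrace ((\<sigma> - maximally_mixed n) * X) = mtrace (\<sigma> * X) - mtrace (maximally_mixed n * X)"
    using \<sigma> mm X by simp
  also have "\<dots> = 0"
    using invariant_state_annihilates_traceless[OF inv X trX] invariant_state_annihilates_traceless[OF mm_inv X trX] by simp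
  finally have "hsp n (coord X) (coord X) = 0"
    using Re_mtrace_mult[OF d X] by (simp add: X_def)
  then have 0: "coord X i j = 0" if "i < n" "j < n" for i j
  proof -
    have "(\<Sum>j<n. (cmod (coord X i j))\<^sup>2) = 0"
      by (rule sum_nonneg_0[of "{..<n}" "\<lambda>i. \<Sum>j<n. (cmod (coord X i j))\<^sup>2"])
         (use \<open>hsp n (coord X) (coord X) = 0\<close> that in \<open>auto simp: hsp_self intro: sum_nonneg\<close>)
    then have "(cmod (coord X i j))\<^sup>2 = 0"
      by (rule sum_nonneg_0[of "{..<n}" "\<lambda>j. (cmod (coord X i j))\<^sup>2", rotated 2]) (use that in auto)
    then show ?thesis by simp
  qed
  have "\<sigma> = maximally_mixed n"
  proof (rule coord_inj[OF \<sigma> mm])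
    fix i j assume ij: "i < n" "j < n"
    have "cnj (coord (\<sigma> - maximally_mixed n) i j) = 0"
      using 0[OF ij(2,1)] coord_adjoint[OF d ij(2,1)] by (simp add: X_def)
    then show "coord \<sigma> i j = coord (maximally_mixed n) i j" using coord_minus[OF \<sigma> mm ij] by simp
  qed
  then show "\<sigma> = maximally_mixed n" .
qed (simp add: invariant_maximally_mixed)

theorem primitive: "primitive n Lind"
proof -
  have c: "maximally_mixed n \<in> carrier_mat n n" by (simp add: maximally_mixed_def)
  have "Determinant.det (maximally_mixed n) \<noteq> 0"
    using n2 by (simp add: maximally_mixed_def)
  then have "vec_space.rank n (maximally_mixed n) = n"
    using vec_space.det_rank_iff[OF c] by simp
  then show ?thesis
    unfolding primitive_def using QL.quantum_Markov_generator invariant_state_iff by blast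
qed

lemma coord_Lind_diag:
  assumes "i < n" "j < n"
  shows "coord (Lind (diag_op n u x)) i j = T (diag_array (\<lambda>i. x $ i)) i j"
proof -
  have "coord (Lind (diag_op n u x)) i j = T (coord (diag_op n u x)) i j + \<gamma> *\<^sub>R S (coord (diag_op n u x)) i j"
    using coord_Lindbladian[OF diag_op_closed assms] by (simp add: L_def)
  also have "T (coord (diag_op n u x)) i j = T (diag_array (\<lambda>i. x $ i)) i j"
    by (rule T_cong[OF coord_diag_op assms])
  also have "S (coord (diag_op n u x)) i j = 0"
    using assms by (simp add: S_def coord_diag_op diag_array_def)
  finally show ?thesis by simp
qed

lemma hs_inner_smult_right:
  assumes "X \<in> carrier_mat n n" "Z \<in> carrier_mat n n"
  shows "hs_inner n X (a \<cdot>\<^sub>m Z) = a * hs_inner n X Z"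
  using assms by (simp add: hs_inner_coord coord_smult sum_distrib_left mult_ac)

text \<open>
  The positive operator is the identity. The lifting identity is an equality of real parts;
  replacing \<open>y\<close> by \<open>- \<i> y\<close> gives the imaginary parts.
\<close>
theorem second_order_lift: "second_order_lift n u Lind Q"
proof -
  have first: "hs_inner n X (Lind Y) = 0" if XY: "X \<in> H_O n u" "Y \<in> H_O n u" for X Y
  proof -
    obtain x y where xy: "X = diag_op n u x" "Y = diag_op n u y" using XY by (auto simp: H_O_def)
    have "cnj (coord X i j) * coord (Lind Y) i j = 0" if "i < n" "j < n" for i j
    proof (cases "i = j")
      case True
      then show ?thesis using that by (simp add: xy coord_Lind_diag T_diag_diag)
    next
      case False
      then show ?thesis using that by (simp add: xy coord_diag_op diag_array_def)
    qed
    then show ?thesis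
      using hs_inner_coord[of X "Lind Y"] QL.closed[of Y]
      by (simp only: xy diag_op_closed) (simp add: sum.neutral)
  qed
  have ReEq: "Re (hs_inner n (Lind (diag_op n u x)) (Lind (diag_op n u y))) = - Re (l2_inner n x (apply_Q Q y))"
    if "x \<in> carrier_vec n" "y \<in> carrier_vec n" for x y
  proof -
    have "hsp n (coord (Lind (diag_op n u x))) (coord (Lind (diag_op n u y)))
       = hsp n (T (diag_array (\<lambda>i. x $ i))) (T (diag_array (\<lambda>i. y $ i)))"
      by (intro hsp_cong coord_Lind_diag)
    then show ?thesis
      unfolding Re_l2_inner_Q[OF that] Re_hs_inner_coord[OF QL.closed[OF diag_op_closed] QL.closed[OF diag_op_closed]]
      by (simp add: hsp_T_diag)
  qed
  have second: "hs_inner n (Lind (diag_op n u x)) (Lind (diag_op n u y)) = - l2_inner n x (apply_Q Q y)"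
    if x: "x \<in> carrier_vec n" and y: "y \<in> carrier_vec n" for x y
  proof -
    let ?y = "(- \<i>) \<cdot>\<^sub>v y"
    have "diag_op n u ?y = (- \<i>) \<cdot>\<^sub>m diag_op n u y"
      by (rule coord_inj) (use y in \<open>auto simp: diag_op_closed coord_diag_op coord_smult diag_array_def\<close>)
    then have "Lind (diag_op n u ?y) = (- \<i>) \<cdot>\<^sub>m Lind (diag_op n u y)"
      by (simp add: QL.smult diag_op_closed)
    then have 1: "hs_inner n (Lind (diag_op n u x)) (Lind (diag_op n u ?y))
        = - \<i> * hs_inner n (Lind (diag_op n u x)) (Lind (diag_op n u y))"
      using hs_inner_smult_right[OF QL.closed[OF diag_op_closed] QL.closed[OF diag_op_closed], of x "- \<i>" y] by simp
    have "apply_Q Q ?y $ i = - \<i> * apply_Q Q y $ i" if "i < n" for i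
      using that y by (simp add: apply_Q_entry D_def sum_distrib_left scaleR_conv_of_real mult_ac sum_negf)
    then have 2: "l2_inner n x (apply_Q Q ?y) = - \<i> * l2_inner n x (apply_Q Q y)"
      by (simp add: l2_inner_def sum_distrib_left mult_ac sum_negf)
    have "Im (hs_inner n (Lind (diag_op n u x)) (Lind (diag_op n u y))) = Im (- l2_inner n x (apply_Q Q y))"
      using ReEq[OF x, of ?y] y unfolding 1 2 by simp
    moreover have "Re (hs_inner n (Lind (diag_op n u x)) (Lind (diag_op n u y))) = Re (- l2_inner n x (apply_Q Q y))"
      using ReEq[OF x y] by simp
    ultimately show ?thesis by (rule complex_eqI[rotated])
  qed
  have "positive_bounded_op_on n (H_O_perp n u) (\<lambda>X. X)"
    unfolding positive_bounded_op_on_def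
  proof (intro conjI ballI allI)
    fix X assume "X \<in> H_O_perp n u"
    then have X: "X \<in> carrier_mat n n" by (simp add: H_O_perp_def)
    have "hs_inner n X X = complex_of_real (\<Sum>i<n. \<Sum>j<n. (cmod (coord X i j))\<^sup>2 / n)"
      unfolding hs_inner_coord[OF X X] of_real_sum sum_divide_distrib
    proof (intro sum.cong refl)
      fix i j
      have "cnj (coord X i j) * coord X i j = complex_of_real ((cmod (coord X i j))\<^sup>2)"
        using complex_norm_square[of "coord X i j"] by (simp add: mult.commute)
      then show "cnj (coord X i j) * coord X i j / of_nat n = complex_of_real ((cmod (coord X i j))\<^sup>2 / real n)"
        by simp
    qed
    also have "\<dots> \<ge> 0" by (simp add: less_eq_complex_def sum_nonneg)
    finally show "0 \<le> hs_inner n X X" .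
  next
    show "\<exists>B. \<forall>X\<in>H_O_perp n u. hs_norm n X \<le> B * hs_norm n X" by (rule exI[of _ 1]) simp
  qed auto
  with first second show ?thesis unfolding second_order_lift_def by blast
qed

end

section \<open>The convergence rate at the optimal dephasing strength\<close>

context quantum_lift
begin

text \<open>
  Constants in \<open>\<parallel>[H, [H, Y]]\<parallel> \<le> K \<parallel>Q y\<parallel>\<close>. Their infimum refers to the chain alone, so that
  \<open>\<gamma>\<close> can be fixed before \<open>K\<^sub>1\<close> and \<open>K\<^sub>2\<close>.
\<close>
definition admissible_consts :: "real set" where
  "admissible_consts =
     {K. 0 \<le> K \<and> (\<forall>y. (\<Sum>i<n. y i) = 0 \<longrightarrow> hsn n (T (T (diag_array y))) \<le> K * hsn n (diag_array (D y)))}"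

definition best_const :: real where
  "best_const = Inf admissible_consts"

lemma best_const_nonneg: "0 \<le> best_const"
  unfolding best_const_def admissible_consts_def
  using TT_bounded_by_D by (intro cInf_greatest) auto

lemma best_const_le: "K \<in> admissible_consts \<Longrightarrow> best_const \<le> K"
  unfolding best_const_def by (rule cInf_lower) (auto simp: admissible_consts_def intro: bdd_belowI)

lemma best_const_admissible:
  assumes y: "(\<Sum>i<n. y i) = 0"
  shows "hsn n (T (T (diag_array y))) \<le> best_const * hsn n (diag_array (D y))"
proof -
  let ?a = "hsn n (T (T (diag_array y)))" and ?b = "hsn n (diag_array (D y))"
  obtain K where K: "K \<in> admissible_consts" using TT_bounded_by_D unfolding admissible_consts_def by blast
  have le: "?a \<le> K' * ?b" if "K' \<in> admissible_consts" for K'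
    using that y unfolding admissible_consts_def by blast
  show ?thesis
  proof (cases "?b = 0")
    case True
    with le[OF K] show ?thesis by simp
  next
    case False
    then have b: "?b > 0" using hsn_nonneg[of n "diag_array (D y)"] by simp
    have "?a / ?b \<le> best_const"
      unfolding best_const_def
    proof (rule cInf_greatest)
      show "?a / ?b \<le> K'" if "K' \<in> admissible_consts" for K'
        using le[OF that] b by (simp add: field_simps)
    qed (use K in blast)
    with b show ?thesis by (simp add: field_simps)
  qed
qed

text \<open>
  For mean-zero \<open>y\<close> the Dirichlet form is at most \<open>\<parallel>Q y\<parallel>\<^sup>2 / gap\<close>, which merges the two
  terms of the bound into one.
\<close>
lemma double_commutator_bound_admissible:
  assumes b: "double_commutator_bound n u Q K\<^sub>1 K\<^sub>2" and K: "0 < K\<^sub>1" "0 < K\<^sub>2"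
  shows "K\<^sub>1 + K\<^sub>2 / sqrt gap \<in> admissible_consts"
proof -
  have sn: "sqrt (real n) > 0" using n2 by simp
  have "hsn n (T (T (diag_array y))) \<le> (K\<^sub>1 + K\<^sub>2 / sqrt gap) * hsn n (diag_array (D y))" if y: "(\<Sum>i<n. y i) = 0" for y
  proof -
    define v where "v = vec n y"
    have v: "v \<in> carrier_vec n" by (simp add: v_def)
    have Dv: "D (\<lambda>j. v $ j) i = D y i" for i by (simp add: D_def v_def)
    define X where "X = diag_op n u v"
    have X: "X \<in> carrier_mat n n" by (simp add: X_def diag_op_closed)
    have "hsn n (T (T (coord X))) = hsn n (T (T (diag_array y)))"
      unfolding hsn_def
      by (intro arg_cong[of _ _ sqrt] hsp_cong T_cong) (auto simp: X_def coord_diag_op v_def diag_array_def)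
    then have "hs_norm n (commutator Ham (commutator Ham X)) = hsn n (T (T (diag_array y))) / sqrt n"
      using hs_norm_coord[OF commutator_closed[OF Ham_closed commutator_closed[OF Ham_closed X]]]
        hsn_double_commutator[OF X] by simp
    moreover have "l2_norm n (apply_Q Q v) = hsn n (diag_array (D y)) / sqrt n"
      unfolding l2_norm_apply_Q[OF v] hsn_diag Dv ..
    moreover have "sqrt (- Re (l2_inner n v (apply_Q Q v))) \<le> hsn n (diag_array (D y)) / sqrt gap / sqrt n"
    proof -
      have "- Re (l2_inner n v (apply_Q Q v)) = (\<Sum>i<n. inner (y i) (D y i)) / n"
        unfolding Re_l2_inner_Q[OF v v] Dv by (simp add: v_def)
      also have "\<dots> \<le> (hsn n (diag_array (D y)))\<^sup>2 / gap / n"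
        using hsn_diag_le_D(2)[OF y] by (intro divide_right_mono) auto
      finally have "sqrt (- Re (l2_inner n v (apply_Q Q v))) \<le> sqrt ((hsn n (diag_array (D y)))\<^sup>2 / gap / n)"
        by (rule real_sqrt_le_mono)
      then show ?thesis by (simp add: real_sqrt_divide real_sqrt_mult hsn_nonneg)
    qed
    ultimately have "hsn n (T (T (diag_array y))) / sqrt n \<le> K\<^sub>1 * (hsn n (diag_array (D y)) / sqrt n) + K\<^sub>2 * sqrt (- Re (l2_inner n v (apply_Q Q v)))"
      using b v unfolding double_commutator_bound_def Ham_def X_def by fastforce
    also have "\<dots> \<le> K\<^sub>1 * (hsn n (diag_array (D y)) / sqrt n) + K\<^sub>2 * (hsn n (diag_array (D y)) / sqrt gap / sqrt n)"
      using \<open>sqrt (- Re (l2_inner n v (apply_Q Q v))) \<le> hsn n (diag_array (D y)) / sqrt gap / sqrt n\<close> K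
      by (intro add_left_mono mult_left_mono) auto
    also have "\<dots> = (K\<^sub>1 + K\<^sub>2 / sqrt gap) * hsn n (diag_array (D y)) / sqrt n"
      by (simp add: algebra_simps add_divide_distrib)
    finally show ?thesis using sn by (simp add: divide_le_cancel)
  qed
  then show ?thesis using K gap_pos unfolding admissible_consts_def by auto
qed

text \<open>
  With this choice the two sources of error in \<open>energy_rate_le\<close>, namely \<open>K\<close> from the double
  commutator and \<open>\<gamma> \<Delta>\<^sup>2 / \<surd>gap\<close> from the dissipator, are both of order \<open>1 + K\<close>.
\<close>
definition \<gamma>_max :: real where
  "\<gamma>_max = sqrt gap * (1 + best_const)"

lemma \<gamma>_max_pos: "0 < \<gamma>_max"
  using gap_pos best_const_nonneg by (simp add: \<gamma>_max_def)

text \<open>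
  The two entries of the minimum come from the two smallness conditions on \<open>\<epsilon>\<close> in
  \<open>coordinate_decay\<close>.
\<close>
definition rate_const :: real where
  "rate_const = min (1 / 2) ((min_gap n \<kappa>)\<^sup>2 / (3 / 2 + (1 + (max_gap n \<kappa>)\<^sup>2)\<^sup>2 / 2))"

lemma rate_const_pos: "0 < rate_const"
  unfolding rate_const_def using \<delta>_pos by (auto intro!: divide_pos_pos add_pos_nonneg)

text \<open>
  With \<open>M \<le> (1 + K) (1 + \<Delta>\<^sup>2)\<close> the condition \<open>\<epsilon> (3 / 2 + M\<^sup>2 / 2) \<le> \<gamma> \<delta>\<^sup>2\<close> allows \<open>\<epsilon>\<close> to be
  a multiple of \<open>\<gamma> / (1 + K)\<^sup>2 = \<surd>gap / (1 + K)\<close>.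
\<close>
lemma optimal_decay:
  "decay_estimate n (Lindbladian Ham A \<gamma>_max) 2 (rate_const / 3 * (sqrt gap / (1 + best_const)))"
proof -
  interpret quantum_lift_semigroup n Q A \<kappa> u \<gamma>_max by unfold_locales (rule \<gamma>_max_pos)
  let ?b = "1 + best_const" and ?D = "1 + (max_gap n \<kappa>)\<^sup>2" and ?s = "sqrt gap"
  define \<epsilon> where "\<epsilon> = rate_const * (?s / ?b)"
  define M where "M = best_const + \<gamma>_max * (max_gap n \<kappa>)\<^sup>2 / ?s"
  have s: "?s > 0" using gap_pos by simp
  have b1: "1 \<le> ?b" using best_const_nonneg by simp
  have M_eq: "M = best_const + ?b * (max_gap n \<kappa>)\<^sup>2"
    using s by (simp add: M_def \<gamma>_max_def)
  then have M: "M \<le> ?b * ?D" by (simp add: algebra_simps)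
  have M0: "0 \<le> M" using best_const_nonneg by (simp add: M_eq)
  have "3 / 2 + M\<^sup>2 / 2 \<le> 3 / 2 * ?b\<^sup>2 + (?b * ?D)\<^sup>2 / 2"
    using M M0 b1 by (intro add_mono divide_right_mono power_mono) (auto simp: one_le_power)
  also have "\<dots> = (3 / 2 + ?D\<^sup>2 / 2) * ?b\<^sup>2" by (simp only: power_mult_distrib) (simp add: field_simps)
  finally have Mb: "3 / 2 + M\<^sup>2 / 2 \<le> (3 / 2 + ?D\<^sup>2 / 2) * ?b\<^sup>2" .
  have P: "3 / 2 + ?D\<^sup>2 / 2 > 0" by (rule add_pos_nonneg) auto
  have "rate_const * (3 / 2 + ?D\<^sup>2 / 2) \<le> (min_gap n \<kappa>)\<^sup>2 / (3 / 2 + ?D\<^sup>2 / 2) * (3 / 2 + ?D\<^sup>2 / 2)"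
    unfolding rate_const_def using P by (intro mult_right_mono) auto
  also have "\<dots> = (min_gap n \<kappa>)\<^sup>2" using P by simp
  finally have c: "rate_const * (3 / 2 + ?D\<^sup>2 / 2) \<le> (min_gap n \<kappa>)\<^sup>2" .
  have \<epsilon>0: "0 \<le> \<epsilon>" unfolding \<epsilon>_def using rate_const_pos s b1 by simp
  have "\<epsilon> \<le> 1 / 2 * ?s"
    unfolding \<epsilon>_def
  proof (rule mult_mono)
    show "rate_const \<le> 1 / 2" unfolding rate_const_def by (rule min.cobounded1)
    show "?s / ?b \<le> ?s" using s b1 by (simp add: divide_le_eq mult_le_cancel_left1)
  qed (use s b1 in auto)
  then have \<epsilon>1: "\<epsilon> \<le> ?s / 2" by simp
  have "\<epsilon> * (3 / 2 + M\<^sup>2 / 2) \<le> \<epsilon> * ((3 / 2 + ?D\<^sup>2 / 2) * ?b\<^sup>2)"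
    using Mb \<epsilon>0 by (rule mult_left_mono)
  also have "\<dots> = (rate_const * (3 / 2 + ?D\<^sup>2 / 2)) * (?s * ?b)"
    using b1 by (simp add: \<epsilon>_def power2_eq_square)
  also have "\<dots> \<le> (min_gap n \<kappa>)\<^sup>2 * (?s * ?b)"
    using c s b1 by (intro mult_right_mono) auto
  also have "\<dots> = \<gamma>_max * (min_gap n \<kappa>)\<^sup>2" by (simp add: \<gamma>_max_def)
  finally have \<epsilon>2: "\<epsilon> * (3 / 2 + M\<^sup>2 / 2) \<le> \<gamma>_max * (min_gap n \<kappa>)\<^sup>2" .
  have "decay_estimate n Lind 2 (\<epsilon> / 3)"
    by (rule hypocoercive_decay[OF best_const_admissible \<epsilon>0 \<epsilon>1]) (use \<epsilon>2 in \<open>simp_all add: M_def\<close>)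
  then show ?thesis by (simp only: \<epsilon>_def times_divide_eq_left)
qed

theorem L2_rate_bounds:
  assumes C: "2 \<le> C" and K: "0 < K\<^sub>1" "0 < K\<^sub>2" and b: "double_commutator_bound n u Q K\<^sub>1 K\<^sub>2"
  shows "rate_const / 3 * (sqrt gap / (1 + K\<^sub>1 + K\<^sub>2 / sqrt gap)) \<le> L2_rate n (Lindbladian Ham A \<gamma>_max) C"
    and "L2_rate n (Lindbladian Ham A \<gamma>_max) C \<le> 2 * ln (2 * C) * sqrt gap"
proof -
  interpret quantum_lift_semigroup n Q A \<kappa> u \<gamma>_max by unfold_locales (rule \<gamma>_max_pos)
  let ?R = "{\<nu>. 0 \<le> \<nu> \<and> (\<exists>C'\<le>C. decay_estimate n Lind C' \<nu>)}"
  let ?r = "rate_const / 3 * (sqrt gap / (1 + best_const))"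
  have upper: "\<nu> \<le> 2 * ln (2 * C) * sqrt gap" if "\<nu> \<in> ?R" for \<nu>
    using that C decay_rate_upper[of _ \<nu> C] by auto
  have r: "?r \<in> ?R"
    using optimal_decay C rate_const_pos gap_pos best_const_nonneg by auto
  have "best_const \<le> K\<^sub>1 + K\<^sub>2 / sqrt gap"
    by (rule best_const_le[OF double_commutator_bound_admissible[OF b K]])
  then have "rate_const / 3 * (sqrt gap / (1 + K\<^sub>1 + K\<^sub>2 / sqrt gap)) \<le> ?r"
    using rate_const_pos gap_pos best_const_nonneg K
    by (intro mult_left_mono divide_left_mono mult_pos_pos add_pos_pos add_pos_nonneg) auto
  also have "?r \<le> Sup ?R"
    using upper by (intro cSup_upper[OF r]) (rule bdd_aboveI)
  finally show "rate_const / 3 * (sqrt gap / (1 + K\<^sub>1 + K\<^sub>2 / sqrt gap)) \<le> L2_rate n (Lindbladian Ham A \<gamma>_max) C"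
    by (simp add: L2_rate_def)
  show "L2_rate n (Lindbladian Ham A \<gamma>_max) C \<le> 2 * ln (2 * C) * sqrt gap"
    unfolding L2_rate_def by (rule cSup_least) (use r upper in auto)
qed

end

theorem proposition4p2:
  shows
    "(\<forall>n Q A \<kappa> u \<gamma>. standing_assumptions n Q A \<kappa> u \<and> 0 < \<gamma> \<longrightarrow>
        primitive n (Lindbladian (Hamiltonian n u Q) A \<gamma>) \<and>
        hypocoercive n (Lindbladian (Hamiltonian n u Q) A \<gamma>) \<and>
        (\<forall>\<rho>. invariant_state n (Lindbladian (Hamiltonian n u Q) A \<gamma>) \<rho>
               \<longleftrightarrow> \<rho> = maximally_mixed n) \<and>
        second_order_lift n u (Lindbladian (Hamiltonian n u Q) A \<gamma>) Q)
     \<and>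
     (\<forall>\<delta> \<Delta> :: real. \<exists>C\<^sub>0\<ge>1. \<exists>c>0. \<exists>c' :: real \<Rightarrow> real. (\<forall>C. 0 < c' C) \<and>
        (\<forall>n Q A \<kappa> u.
           standing_assumptions n Q A \<kappa> u \<and> min_gap n \<kappa> = \<delta> \<and> max_gap n \<kappa> = \<Delta> \<longrightarrow>
           (\<exists>\<gamma>\<^sub>m\<^sub>a\<^sub>x>0. \<forall>C\<ge>C\<^sub>0. \<forall>K\<^sub>1>0. \<forall>K\<^sub>2>0.
              double_commutator_bound n u Q K\<^sub>1 K\<^sub>2 \<longrightarrow>
              c * (sqrt (spectral_gap Q) / (1 + K\<^sub>1 + K\<^sub>2 / sqrt (spectral_gap Q)))
                \<le> L2_rate n (Lindbladian (Hamiltonian n u Q) A \<gamma>\<^sub>m\<^sub>a\<^sub>x) C \<and>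
              L2_rate n (Lindbladian (Hamiltonian n u Q) A \<gamma>\<^sub>m\<^sub>a\<^sub>x) C
                \<le> c' C * sqrt (spectral_gap Q))))"
proof (rule conjI, goal_cases)
  case 1
  show ?case
  proof (intro allI impI)
    fix n Q A \<kappa> u and \<gamma> :: real assume "standing_assumptions n Q A \<kappa> u \<and> 0 < \<gamma>"
    then interpret quantum_lift_semigroup n Q A \<kappa> u \<gamma> by unfold_locales auto
    show "primitive n (Lindbladian (Hamiltonian n u Q) A \<gamma>) \<and>
        hypocoercive n (Lindbladian (Hamiltonian n u Q) A \<gamma>) \<and>
        (\<forall>\<rho>. invariant_state n (Lindbladian (Hamiltonian n u Q) A \<gamma>) \<rho> \<longleftrightarrow> \<rho> = maximally_mixed n) \<and>
        second_order_lift n u (Lindbladian (Hamiltonian n u Q) A \<gamma>) Q"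
      using primitive hypocoercive invariant_state_iff second_order_lift unfolding Ham_def by blast
  qed
next
  case 2
  show ?case
  proof (intro allI, goal_cases)
    case (1 \<delta> \<Delta>)
    \<comment> \<open>For \<open>\<delta> = 0\<close> no chain qualifies, as the gaps are positive, but the constant must still be
      positive.\<close>
    define c where "c = (if \<delta> = 0 then 1 else min (1 / 2) (\<delta>\<^sup>2 / (3 / 2 + (1 + \<Delta>\<^sup>2)\<^sup>2 / 2)) / 3)"
    \<comment> \<open>The maximum only matters for \<open>C < 2\<close>, where it keeps the value positive.\<close>
    define c' :: "real \<Rightarrow> real" where "c' C = 2 * ln (2 * max C 2)" for C
    have "0 < c" unfolding c_def by (auto intro!: divide_pos_pos add_pos_nonneg)
    moreover have "\<forall>C. 0 < c' C" unfolding c'_def by (auto intro!: ln_gt_zero)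
    moreover have "\<exists>\<gamma>\<^sub>m\<^sub>a\<^sub>x>0. \<forall>C\<ge>2. \<forall>K\<^sub>1>0. \<forall>K\<^sub>2>0.
        double_commutator_bound n u Q K\<^sub>1 K\<^sub>2 \<longrightarrow>
        c * (sqrt (spectral_gap Q) / (1 + K\<^sub>1 + K\<^sub>2 / sqrt (spectral_gap Q)))
          \<le> L2_rate n (Lindbladian (Hamiltonian n u Q) A \<gamma>\<^sub>m\<^sub>a\<^sub>x) C \<and>
        L2_rate n (Lindbladian (Hamiltonian n u Q) A \<gamma>\<^sub>m\<^sub>a\<^sub>x) C \<le> c' C * sqrt (spectral_gap Q)"
      if *: "standing_assumptions n Q A \<kappa> u \<and> min_gap n \<kappa> = \<delta> \<and> max_gap n \<kappa> = \<Delta>" for n Q A \<kappa> u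
    proof -
      interpret quantum_lift n Q A \<kappa> u using * by unfold_locales auto
      have gap: "spectral_gap Q = gap" by (rule spectral_gap_eq[OF Q_closed refl])
      have c: "c = rate_const / 3" using * \<delta>_pos by (auto simp: c_def rate_const_def)
      show ?thesis
        unfolding gap c
        using L2_rate_bounds \<gamma>_max_pos by (intro exI[of _ \<gamma>_max]) (auto simp: c'_def Ham_def max_def)
    qed
    ultimately show ?case
      by (intro exI[of _ "2::real"] exI[of _ c] exI[of _ c'] conjI) auto
  qed
qed

end
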